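(* Assume $0<a<b<\infty$. The restriction of $I_{[0,1]^d}$ to $\mathcal N^*$ is continuous for the metric $\mathfrak d_\infty$. If furthermore $\nu(\{b\})=0$, then the restriction of $I_{[0,1]^d}$ to $\mathcal N$ is continuous (as a $[0,\infty]$-valued map).
   Context: Let $d\ge2$ be an integer and $\mathbb E^d$ the set of non-oriented nearest-neighbour edges of $\mathbb Z^d$. Let $\nu$ be a probability distribution on $[0,\infty)$, and let $a$ and $b$ be the infimum and supremum of its support. Let $(\tau_e)_{e\in\mathbb E^d}$ be i.i.d. random variables with distribution $\nu$. Write $\|x\|=\sum_{i=1}^d|x_i|$ on $\mathbb R^d$. For $z,z'\in\mathbb R^d$, let $\tau(z,z')=\tau_{(v,v')}\|z-z'\|$ if there exist adjacent vertices $v,v'\in\mathbb Z^d$ such that $z,z'$ belong to the segment $[v,v']$, and $\tau(z,z')=b\|z-z'\|$ otherwise. For a finite sequence $\pi=(x_0,\dots,x_r)$ of points of $\mathbb R^d$, let $\tau(\pi)=\sum_{i=0}^{r-1}\tau(x_i,x_{i+1})$. For a compact convex set $X\subset\mathbb R^d$ with nonempty interior and $x,y\in X$, $\mathbf T_X(x,y)$ is the infimum of $\tau(\pi)$ over all finite sequences $\pi$ of points of $X$ with endpoints $x$ and $y$, and $\widetilde{\mathbf T}_{n,X}(x,y)=\frac1n\mathbf T_{nX}(nx,ny)$ for $n\ge1$. $\mathcal N$ is the set of norms $g$ on $\mathbb R^d$ such that $a\|\cdot\|\le g\le b\|\cdot\|$, and $\mathcal N^*$ is the subset of those $g$ with $g(x)<b\|x\|$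 for all $x\ne0$. A norm $g$ is identified with the metric $(x,y)\mapsto g(x-y)$ on $[0,1]^d$, and $\mathfrak d_\infty(D_1,D_2)=\max_{x,y\in[0,1]^d}|D_1(x,y)-D_2(x,y)|$. For $g\in\mathcal N$ and $\varepsilon>0$, let $\mathrm{LD}_{n,[0,1]^d}(g,\varepsilon)=\{\mathfrak d_\infty(g,\widetilde{\mathbf T}_{n,[0,1]^d})\le\varepsilon\}$. $I_{[0,1]^d}(g)\in[0,\infty]$ denotes the common value of $\lim_{\varepsilon\to0}\liminf_{n\to\infty}-\frac1{n^d}\log\mathbb P(\mathrm{LD}_{n,[0,1]^d}(g,\varepsilon))$ and $\lim_{\varepsilon\to0}\limsup_{n\to\infty}-\frac1{n^d}\log\mathbb P(\mathrm{LD}_{n,[0,1]^d}(g,\varepsilon))$ (these two monotone limits coincide for $g\in\mathcal N$). *)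

theory Defs
  imports "HOL-Probability.Probability"
begin

definition adjacent :: "int ^ 'n::finite \<Rightarrow> int ^ 'n \<Rightarrow> bool" where
  "adjacent v w \<longleftrightarrow> (\<Sum>i\<in>UNIV. \<bar>v $ i - w $ i\<bar>) = 1"

text \<open>A non-oriented edge is the two-element set of its endpoints.\<close>

definition edges :: "(int ^ 'n::finite) set set" where
  "edges = {{v, w} |v w. adjacent v w}"

definition emb :: "int ^ 'n::finite \<Rightarrow> real ^ 'n" where
  "emb v = (\<chi> i. of_int (v $ i))"

definition l1norm :: "real ^ 'n::finite \<Rightarrow> real" where
  "l1norm x = (\<Sum>i\<in>UNIV. \<bar>x $ i\<bar>)"

definition unit_cube :: "(real ^ 'n::finite) set" where
  "unit_cube = {x. \<forall>i. 0 \<le> x $ i \<and> x $ i \<le> 1}"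

definition measure_support :: "real measure \<Rightarrow> real set" where
  "measure_support \<nu> = {x. \<forall>\<epsilon>>0. measure \<nu> (ball x \<epsilon>) > 0}"

definition on_edge :: "(int ^ 'n::finite) set \<Rightarrow> real ^ 'n \<Rightarrow> real ^ 'n \<Rightarrow> bool" where
  "on_edge e z z' \<longleftrightarrow> (\<exists>v w. adjacent v w \<and> e = {v, w} \<and>
     z \<in> closed_segment (emb v) (emb w) \<and> z' \<in> closed_segment (emb v) (emb w))"

text \<open>The edge is unique unless \<open>z = z'\<close>, and then the factor
  \<open>l1norm (z - z')\<close> vanishes, so the choice of edge is irrelevant.\<close>

definition step_time ::
    "((int ^ 'n::finite) set \<Rightarrow> real) \<Rightarrow> real \<Rightarrow> real ^ 'n \<Rightarrow> real ^ 'n \<Rightarrow> real" where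
  "step_time t b z z' =
     (if \<exists>e. on_edge e z z' then t (SOME e. on_edge e z z') * l1norm (z - z')
      else b * l1norm (z - z'))"

definition path_time ::
    "((int ^ 'n::finite) set \<Rightarrow> real) \<Rightarrow> real \<Rightarrow> (real ^ 'n) list \<Rightarrow> real" where
  "path_time t b xs = (\<Sum>i<length xs - 1. step_time t b (xs ! i) (xs ! Suc i))"

definition paths :: "(real ^ 'n::finite) set \<Rightarrow> real ^ 'n \<Rightarrow> real ^ 'n \<Rightarrow> (real ^ 'n) list set" where
  "paths X x y = {xs. xs \<noteq> [] \<and> set xs \<subseteq> X \<and> hd xs = x \<and> last xs = y}"

definition T_in ::
    "((int ^ 'n::finite) set \<Rightarrow> real) \<Rightarrow> real \<Rightarrow> (real ^ 'n) set \<Rightarrow> real ^ 'n \<Rightarrow> real ^ 'n \<Rightarrow> real" where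
  "T_in t b X x y = (INF xs\<in>paths X x y. path_time t b xs)"

definition T_scaled ::
    "((int ^ 'n::finite) set \<Rightarrow> real) \<Rightarrow> real \<Rightarrow> nat \<Rightarrow> (real ^ 'n) set \<Rightarrow> real ^ 'n \<Rightarrow> real ^ 'n \<Rightarrow> real" where
  "T_scaled t b n X x y =
     T_in t b ((\<lambda>z. real n *\<^sub>R z) ` X) (real n *\<^sub>R x) (real n *\<^sub>R y) / real n"

definition is_norm :: "(real ^ 'n::finite \<Rightarrow> real) \<Rightarrow> bool" where
  "is_norm g \<longleftrightarrow> (\<forall>x. g x \<ge> 0) \<and> (\<forall>x. g x = 0 \<longleftrightarrow> x = 0) \<and>
     (\<forall>c x. g (c *\<^sub>R x) = \<bar>c\<bar> * g x) \<and> (\<forall>x y. g (x + y) \<le> g x + g y)"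

definition norms :: "real \<Rightarrow> real \<Rightarrow> (real ^ 'n::finite \<Rightarrow> real) set" where
  "norms a b = {g. is_norm g \<and> (\<forall>x. a * l1norm x \<le> g x \<and> g x \<le> b * l1norm x)}"

definition norms_star :: "real \<Rightarrow> real \<Rightarrow> (real ^ 'n::finite \<Rightarrow> real) set" where
  "norms_star a b = {g \<in> norms a b. \<forall>x. x \<noteq> 0 \<longrightarrow> g x < b * l1norm x}"

definition norm_metric :: "(real ^ 'n::finite \<Rightarrow> real) \<Rightarrow> real ^ 'n \<Rightarrow> real ^ 'n \<Rightarrow> real" where
  "norm_metric g x y = g (x - y)"

definition d_infty ::
    "(real ^ 'n::finite \<Rightarrow> real ^ 'n \<Rightarrow> real) \<Rightarrow> (real ^ 'n \<Rightarrow> real ^ 'n \<Rightarrow> real) \<Rightarrow> ereal" where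
  "d_infty D1 D2 = (SUP (x, y)\<in>unit_cube \<times> unit_cube. ereal \<bar>D1 x y - D2 x y\<bar>)"

definition norm_dist :: "(real ^ 'n::finite \<Rightarrow> real) \<Rightarrow> (real ^ 'n \<Rightarrow> real) \<Rightarrow> real" where
  "norm_dist g h = real_of_ereal (d_infty (norm_metric g) (norm_metric h))"

definition norm_topology :: "(real ^ 'n::finite \<Rightarrow> real) set \<Rightarrow> (real ^ 'n \<Rightarrow> real) topology" where
  "norm_topology S = Metric_space.mtopology S norm_dist"

definition LD ::
    "'w measure \<Rightarrow> ((int ^ 'n::finite) set \<Rightarrow> 'w \<Rightarrow> real) \<Rightarrow> real \<Rightarrow> nat \<Rightarrow> (real ^ 'n \<Rightarrow> real) \<Rightarrow> real \<Rightarrow> 'w set" where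
  "LD M \<tau> b n g \<epsilon> = {\<omega> \<in> space M.
     d_infty (norm_metric g) (T_scaled (\<lambda>e. \<tau> e \<omega>) b n unit_cube) \<le> ereal \<epsilon>}"

text \<open>The convention \<open>- log 0 = \<infinity>\<close> has to be explicit, since \<open>ln 0 = 0\<close> in the library.\<close>

definition neg_log :: "real \<Rightarrow> ereal" where
  "neg_log p = (if p = 0 then \<infinity> else ereal (- ln p))"

text \<open>The rate at \<open>g\<close> is defined through the liminf; for \<open>g \<in> norms a b\<close> the
  limsup gives the same value. Both expressions are monotone in \<open>\<epsilon>\<close>, so the limit exists.\<close>

definition rate ::
    "'w measure \<Rightarrow> ((int ^ 'n::finite) set \<Rightarrow> 'w \<Rightarrow> real) \<Rightarrow> real \<Rightarrow> (real ^ 'n \<Rightarrow> real) \<Rightarrow> ereal" where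
  "rate M \<tau> b g = Lim (at_right 0) (\<lambda>\<epsilon>. liminf (\<lambda>n.
     neg_log (measure M (LD M \<tau> b n g \<epsilon>)) / ereal (real n ^ CARD('n))))"

lemma l1norm_nonneg: "0 \<le> l1norm x"
  unfolding l1norm_def by (simp add: sum_nonneg)

lemma zero_in_unit_cube: "0 \<in> unit_cube"
  by (simp add: unit_cube_def)

lemma l1norm_cube_le:
  fixes x y :: "real ^ 'n::finite"
  assumes "x \<in> unit_cube" "y \<in> unit_cube"
  shows "l1norm (x - y) \<le> CARD('n)"
proof -
  have "\<bar>(x - y) $ i\<bar> \<le> 1" for i
    using assms unfolding unit_cube_def by (simp add: abs_le_iff) (smt (verit))
  then have "(\<Sum>i\<in>UNIV. \<bar>(x - y) $ i\<bar>) \<le> (\<Sum>i\<in>(UNIV::'n set). 1)"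
    by (intro sum_mono) auto
  then show ?thesis by (simp add: l1norm_def)
qed

lemma norms_diff_bounded:
  fixes g h :: "real ^ 'n::finite \<Rightarrow> real"
  assumes "g \<in> norms a b" "h \<in> norms a b" "x \<in> unit_cube" "y \<in> unit_cube"
  shows "\<bar>norm_metric g x y - norm_metric h x y\<bar> \<le> \<bar>b\<bar> * CARD('n)"
proof -
  have "b * l1norm (x - y) \<le> \<bar>b\<bar> * CARD('n)"
    by (intro mult_mono l1norm_cube_le assms l1norm_nonneg) auto
  moreover have "0 \<le> g (x - y)" "0 \<le> h (x - y)"
      "g (x - y) \<le> b * l1norm (x - y)" "h (x - y) \<le> b * l1norm (x - y)"
    using assms(1,2) by (auto simp: norms_def is_norm_def)
  ultimately show ?thesis unfolding norm_metric_def by linarith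
qed

lemma d_infty_upper:
  assumes "x \<in> unit_cube" "y \<in> unit_cube"
  shows "ereal \<bar>D1 x y - D2 x y\<bar> \<le> d_infty D1 D2"
  unfolding d_infty_def by (rule SUP_upper2[of "(x, y)"]) (use assms in auto)

lemma d_infty_nonneg: "0 \<le> d_infty D1 D2"
  using d_infty_upper[OF zero_in_unit_cube zero_in_unit_cube, of D1 D2]
  by (rule order_trans[rotated]) simp

lemma d_infty_norms:
  fixes g h :: "real ^ 'n::finite \<Rightarrow> real"
  assumes "g \<in> norms a b" "h \<in> norms a b"
  shows "d_infty (norm_metric g) (norm_metric h) = ereal (norm_dist g h)"
proof -
  have "d_infty (norm_metric g) (norm_metric h) \<le> ereal (\<bar>b\<bar> * CARD('n))"
    unfolding d_infty_def using norms_diff_bounded[OF assms] by (auto intro!: SUP_least)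
  then show ?thesis
    using d_infty_nonneg[of "norm_metric g" "norm_metric h"]
    unfolding norm_dist_def by (cases "d_infty (norm_metric g) (norm_metric h)") auto
qed

lemma norm_dist_upper:
  assumes "g \<in> norms a b" "h \<in> norms a b" "x \<in> unit_cube" "y \<in> unit_cube"
  shows "\<bar>g (x - y) - h (x - y)\<bar> \<le> norm_dist g h"
  using d_infty_upper[OF assms(3,4), of "norm_metric g" "norm_metric h"]
  unfolding d_infty_norms[OF assms(1,2)] by (simp add: norm_metric_def)

lemma norm_dist_least:
  assumes "g \<in> norms a b" "h \<in> norms a b"
    and "\<And>x y. x \<in> unit_cube \<Longrightarrow> y \<in> unit_cube \<Longrightarrow> \<bar>g (x - y) - h (x - y)\<bar> \<le> c"
  shows "norm_dist g h \<le> c"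
proof -
  have "d_infty (norm_metric g) (norm_metric h) \<le> ereal c"
    unfolding d_infty_def norm_metric_def using assms(3) by (auto intro!: SUP_least)
  then show ?thesis by (simp add: d_infty_norms[OF assms(1,2)])
qed

lemma cube_difference:
  fixes x :: "real ^ 'n::finite"
  obtains c y z where "c > 0" "y \<in> unit_cube" "z \<in> unit_cube" "c *\<^sub>R x = y - z"
proof
  let ?c = "1 / (1 + l1norm x)"
  have pos: "0 < 1 + l1norm x" using l1norm_nonneg[of x] by linarith
  then show "?c > 0" by simp
  have le: "\<bar>x $ i\<bar> \<le> 1 + l1norm x" for i
    using member_le_sum[of i UNIV "\<lambda>i. \<bar>x $ i\<bar>"] by (simp add: l1norm_def)
  let ?y = "(\<chi> i. ?c * max (x $ i) 0) :: real ^ 'n"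
  let ?z = "(\<chi> i. ?c * max (- x $ i) 0) :: real ^ 'n"
  have "max (x $ i) 0 \<le> 1 + l1norm x" "max (- x $ i) 0 \<le> 1 + l1norm x" for i
    using le[of i] pos by linarith+
  then show "?y \<in> unit_cube" "?z \<in> unit_cube"
    using pos by (auto simp: unit_cube_def divide_simps)
  show "?c *\<^sub>R x = ?y - ?z"
    by (simp add: vec_eq_iff flip: right_diff_distrib diff_divide_distrib) (smt (verit))
qed

lemma Metric_space_norms: "Metric_space (norms a b) norm_dist"
proof
  show "0 \<le> norm_dist g h" for g h :: "real ^ 'n::finite \<Rightarrow> real"
    unfolding norm_dist_def by (simp add: d_infty_nonneg real_of_ereal_pos)
  show "norm_dist g h = norm_dist h g" for g h :: "real ^ 'n::finite \<Rightarrow> real"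
    unfolding norm_dist_def d_infty_def by (simp add: abs_minus_commute)
next
  fix g h :: "real ^ 'n::finite \<Rightarrow> real"
  assume gh: "g \<in> norms a b" "h \<in> norms a b"
  show "norm_dist g h = 0 \<longleftrightarrow> g = h"
  proof
    assume 0: "norm_dist g h = 0"
    show "g = h"
    proof
      fix x :: "real ^ 'n"
      obtain c y z where c: "c > 0" "y \<in> unit_cube" "z \<in> unit_cube" "c *\<^sub>R x = y - z"
        by (rule cube_difference)
      have "g (c *\<^sub>R x) = h (c *\<^sub>R x)"
        using norm_dist_upper[OF gh c(2,3)] 0 c(4) by simp
      then have "\<bar>c\<bar> * g x = \<bar>c\<bar> * h x"
        using gh by (simp add: norms_def is_norm_def)
      then show "g x = h x" using c(1) by simp
    qed
  next
    assume "g = h"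
    have "norm_dist g g \<le> 0" "\<bar>g (0 - 0) - g (0 - 0)\<bar> \<le> norm_dist g g"
      using norm_dist_least[OF gh(1) gh(1), of 0]
        norm_dist_upper[OF gh(1) gh(1) zero_in_unit_cube zero_in_unit_cube] by auto
    with \<open>g = h\<close> show "norm_dist g h = 0" by simp
  qed
next
  fix f g h :: "real ^ 'n::finite \<Rightarrow> real"
  assume f: "f \<in> norms a b" and g: "g \<in> norms a b" and h: "h \<in> norms a b"
  show "norm_dist f h \<le> norm_dist f g + norm_dist g h"
  proof (rule norm_dist_least[OF f h])
    fix x y :: "real ^ 'n"
    assume "x \<in> unit_cube" "y \<in> unit_cube"
    from norm_dist_upper[OF f g this] norm_dist_upper[OF g h this]
    show "\<bar>f (x - y) - h (x - y)\<bar> \<le> norm_dist f g + norm_dist g h" by linarith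
  qed
qed

lemma Metric_space_norms_star: "Metric_space (norms_star a b) norm_dist"
  by (rule Metric_space.subspace[OF Metric_space_norms]) (auto simp: norms_star_def)

end

theory Submission
  imports Defs
begin

text \<open>
  The passage time from \<open>x\<close> is the largest function vanishing at \<open>x\<close> that is 1-Lipschitz for the step
  costs, so lower bounds on passage times are proved by exhibiting potentials.

  Lower semicontinuity of the rate is immediate. For upper semicontinuity at \<open>g \<in> norms_star a b\<close>, a
  configuration whose metric is close to \<open>g\<close> is modified, at small exponential cost, into one whose
  metric is close to a given norm \<open>h\<close> near \<open>g\<close>. First, resampling a small proportion of the edges, those
  in thin macroscopic slabs orthogonal to the axes, to values near \<open>b\<close> raises the metric above \<open>h\<close>;
  this gains a fixed amount because \<open>g\<close> is bounded by \<open>(b - 2 \<kappa>) l1norm\<close>. Then the metric is lowered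
  to \<open>h\<close> by finitely many highways, one for each pair of points of a finite net: in a thin tube around
  a segment the weights are replaced by a pattern of \<open>a\<close> and \<open>b\<close> with the speed prescribed by \<open>h\<close>,
  insulated by edges of weight \<open>b\<close>. As \<open>d \<ge> 2\<close>, the tubes contain an arbitrarily small proportion of
  the edges.

  If \<open>\<nu> {b} = 0\<close>, a norm outside \<open>norms_star a b\<close> equals \<open>b l1norm\<close> on an axis, which forces almost all
  edges parallel to that axis to have weight close to \<open>b\<close>; hence its rate is infinite, and lower
  semicontinuity already gives continuity there.
\<close>

section \<open>The passage time as a maximal Lipschitz function\<close>

text \<open>The order of the constants makes the modification affordable. A slab edge only has to
  reach b - \<kappa>, where \<kappa> depends on \<open>g\<close> alone; the price of one such edge
  is therefore fixed, and their proportion \<delta> is chosen afterwards, together with the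
  neighbourhood of \<open>g\<close> in which \<open>h\<close> may lie. All other modified edges must
  match a or b up to an error \<rho> that shrinks with \<epsilon>, so their price depends on
  \<epsilon>; their proportion \<eta> is chosen last. The total loss is then free of \<epsilon> and
  survives the supremum over \<epsilon>. Slabs precede highways because a highway only lowers the
  metric safely: its walls keep it from undercutting \<open>h\<close> provided the old metric is
  already above \<open>h\<close> up to a small error. Potentials replace the decomposition of paths:
  potentials adapted to different weights are combined by a minimum, each one being the minimum
  where its weights are in force. The modified edges and their target weights depend on n but never
  on the configuration, so that Fubini applies to the whole event at once.\<close>

lemma l1norm_zero [simp]: "l1norm 0 = 0"
  by (simp add: l1norm_def)

lemma l1norm_eq_0_iff: "l1norm x = 0 \<longleftrightarrow> x = 0"
  by (simp add: l1norm_def sum_nonneg_eq_0_iff vec_eq_iff)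

lemma l1norm_minus [simp]: "l1norm (- x) = l1norm x"
  by (simp add: l1norm_def)

lemma l1norm_minus_commute: "l1norm (x - y) = l1norm (y - x)"
  using l1norm_minus[of "x - y"] by simp

lemma l1norm_triangle: "l1norm (x + y) \<le> l1norm x + l1norm y"
  unfolding l1norm_def by (simp add: sum_mono abs_triangle_ineq flip: sum.distrib)

lemma l1norm_triangle3: "l1norm (x - z) \<le> l1norm (x - y) + l1norm (y - z)"
  using l1norm_triangle[of "x - y" "y - z"] by simp

lemma l1norm_scaleR: "l1norm (c *\<^sub>R x) = \<bar>c\<bar> * l1norm x"
  by (simp add: l1norm_def abs_mult sum_distrib_left)

lemma abs_component_le_l1norm: "\<bar>x $ i\<bar> \<le> l1norm x"
  unfolding l1norm_def by (rule member_le_sum) auto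

lemma l1norm_le_card: "(\<And>i. \<bar>x $ i\<bar> \<le> c) \<Longrightarrow> l1norm x \<le> real CARD('n) * c"
  for x :: "real ^ 'n::finite"
  unfolding l1norm_def using sum_bounded_above[of UNIV "\<lambda>i. \<bar>x $ i\<bar>" c] by simp

section \<open>The box of side n\<close>

definition cube :: "nat \<Rightarrow> (real ^ 'n::finite) set" where
  "cube n = {z. \<forall>i. 0 \<le> z $ i \<and> z $ i \<le> real n}"

lemma scaled_unit_cube: "n > 0 \<Longrightarrow> (\<lambda>z. real n *\<^sub>R z) ` unit_cube = cube n"
proof (intro set_eqI iffI)
  fix z :: "real ^ 'n"
  assume "n > 0" "z \<in> cube n"
  then have "(1 / real n) *\<^sub>R z \<in> unit_cube" "z = real n *\<^sub>R ((1 / real n) *\<^sub>R z)"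
    by (auto simp: cube_def unit_cube_def divide_simps)
  then show "z \<in> (\<lambda>z. real n *\<^sub>R z) ` unit_cube" by blast
qed (auto simp: cube_def unit_cube_def mult_left_le)

lemma zero_in_cube: "0 \<in> cube n"
  by (simp add: cube_def)

lemma scaleR_in_cube: "x \<in> unit_cube \<Longrightarrow> real n *\<^sub>R x \<in> cube n"
  by (auto simp: cube_def unit_cube_def mult_left_le)

lemma cube_convex: "x \<in> cube n \<Longrightarrow> y \<in> cube n \<Longrightarrow> 0 \<le> s \<Longrightarrow> s \<le> 1 \<Longrightarrow>
    x + s *\<^sub>R (y - x) \<in> cube n" for x :: "real ^ 'n::finite"
proof -
  assume *: "x \<in> cube n" "y \<in> cube n" "0 \<le> s" "s \<le> 1"
  have "x $ i + s * (y $ i - x $ i) = (1 - s) * x $ i + s * y $ i" for i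
    by (simp add: algebra_simps)
  moreover have "(1 - s) * x $ i + s * y $ i \<le> (1 - s) * n + s * n" for i
    using * by (intro add_mono mult_left_mono) (auto simp: cube_def)
  moreover have "(1 - s) * n + s * n = real n" by (simp add: algebra_simps)
  ultimately show ?thesis
    using * by (auto simp: cube_def)
qed

lemma l1norm_cube_diff_le: "x \<in> cube n \<Longrightarrow> y \<in> cube n \<Longrightarrow>
    l1norm (x - y) \<le> real CARD('n) * real n" for x y :: "real ^ 'n::finite"
proof (rule l1norm_le_card)
  fix i assume "x \<in> cube n" "y \<in> cube n"
  then have "0 \<le> x $ i" "x $ i \<le> n" "0 \<le> y $ i" "y $ i \<le> n" by (auto simp: cube_def)
  then show "\<bar>(x - y) $ i\<bar> \<le> real n" by simp
qed

text \<open>The segment spanned by an edge, and empty when \<open>e\<close> is not an edge, so that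
  membership of both points characterises \<open>on_edge\<close>.\<close>

definition points_of :: "(int ^ 'n::finite) set \<Rightarrow> (real ^ 'n) set" where
  "points_of e = {z. on_edge e z z}"

lemma adjacent_commute: "adjacent v w \<longleftrightarrow> adjacent w v"
  by (simp add: adjacent_def abs_minus_commute)

lemma points_of_edge: "adjacent v w \<Longrightarrow> points_of {v, w} = closed_segment (emb v) (emb w)"
  by (auto simp: on_edge_def points_of_def doubleton_eq_iff closed_segment_commute)

lemma on_edge_iff: "on_edge e y z \<longleftrightarrow> y \<in> points_of e \<and> z \<in> points_of e"
proof (cases "\<exists>v w. adjacent v w \<and> e = {v, w}")
  case True
  then obtain v w where vw: "adjacent v w" "e = {v, w}" by blast
  then show ?thesis
    by (auto simp: points_of_edge) (auto simp: on_edge_def doubleton_eq_iff closed_segment_commute)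
qed (auto simp: on_edge_def points_of_def)

lemma on_edge_edges: "on_edge e y z \<Longrightarrow> e \<in> edges"
  by (auto simp: on_edge_def edges_def)

lemma on_edge_commute: "on_edge e y z \<longleftrightarrow> on_edge e z y"
  by (auto simp: on_edge_iff)

text \<open>Names the choice hidden in \<open>step_time\<close>. It does not depend on the weights,
  so the same edge serves when two configurations are compared.\<close>

definition edge_through :: "real ^ 'n::finite \<Rightarrow> real ^ 'n \<Rightarrow> (int ^ 'n) set" where
  "edge_through y z = (SOME e. on_edge e y z)"

lemma edge_through: "on_edge e y z \<Longrightarrow> on_edge (edge_through y z) y z"
  unfolding edge_through_def by (rule someI)

lemma step_time_on_edge:
  "on_edge e y z \<Longrightarrow> step_time t b y z = t (edge_through y z) * l1norm (y - z)"
  by (auto simp: step_time_def edge_through_def)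

lemma step_time_off_edge:
  "\<nexists>e. on_edge e y z \<Longrightarrow> step_time t b y z = b * l1norm (y - z)"
  by (auto simp: step_time_def)

lemma step_time_cases:
  obtains e where "on_edge e y z" "e = edge_through y z" "e \<in> edges"
      "\<And>t. step_time t b y z = t e * l1norm (y - z)"
  | "\<And>t. step_time t b y z = b * l1norm (y - z)"
  by (metis edge_through on_edge_edges step_time_off_edge step_time_on_edge)

lemma step_time_commute: "step_time t b y z = step_time t b z y"
  by (simp add: step_time_def on_edge_commute l1norm_minus_commute)

lemma step_time_refl [simp]: "step_time t b y y = 0"
  by (simp add: step_time_def)

definition lip :: "((int ^ 'n::finite) set \<Rightarrow> real) \<Rightarrow> real \<Rightarrow> (real ^ 'n) set
    \<Rightarrow> (real ^ 'n \<Rightarrow> real) \<Rightarrow> bool" where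
  "lip t b X f \<longleftrightarrow> (\<forall>y\<in>X. \<forall>z\<in>X. f z - f y \<le> step_time t b y z)"

lemma lipD: "lip t b X f \<Longrightarrow> y \<in> X \<Longrightarrow> z \<in> X \<Longrightarrow> f z - f y \<le> step_time t b y z"
  by (simp add: lip_def)

lemma lipI:
  assumes "\<And>y z. y \<in> X \<Longrightarrow> z \<in> X \<Longrightarrow> f z - f y \<le> b * l1norm (y - z)"
    and "\<And>e y z. e \<in> edges \<Longrightarrow> e = edge_through y z \<Longrightarrow> y \<in> X \<Longrightarrow> z \<in> X \<Longrightarrow> y \<in> points_of e \<Longrightarrow>
       z \<in> points_of e \<Longrightarrow> f z - f y \<le> t e * l1norm (y - z)"
  shows "lip t b X f"
  unfolding lip_def
proof (intro ballI)
  fix y z assume yz: "y \<in> X" "z \<in> X"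
  show "f z - f y \<le> step_time t b y z"
    by (rule step_time_cases[of y z b]) (use assms yz in \<open>auto simp: on_edge_iff\<close>)
qed

lemma lip_add_const: "lip t b X f \<Longrightarrow> lip t b X (\<lambda>z. c + f z)"
  unfolding lip_def by auto

lemma INF_le_INF_plus:
  fixes f g :: "'i \<Rightarrow> real"
  assumes "I \<noteq> {}" "bdd_below (f ` I)" "\<And>i. i \<in> I \<Longrightarrow> f i \<le> g i + c"
  shows "(INF i\<in>I. f i) \<le> (INF i\<in>I. g i) + c"
proof -
  have "(INF i\<in>I. f i) - c \<le> (INF i\<in>I. g i)"
  proof (rule cINF_greatest[OF assms(1)])
    fix i assume "i \<in> I"
    then show "(INF i\<in>I. f i) - c \<le> g i"
      using cINF_lower[OF assms(2) \<open>i \<in> I\<close>] assms(3)[OF \<open>i \<in> I\<close>] by linarith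
  qed
  then show ?thesis by linarith
qed

lemma lip_INF:
  assumes "I \<noteq> {}" "\<And>z. z \<in> X \<Longrightarrow> bdd_below ((\<lambda>i. f i z) ` I)" "\<And>i. i \<in> I \<Longrightarrow> lip t b X (f i)"
  shows "lip t b X (\<lambda>z. INF i\<in>I. f i z)"
  unfolding lip_def
proof (intro ballI)
  fix y z assume "y \<in> X" "z \<in> X"
  then have "(INF i\<in>I. f i z) \<le> (INF i\<in>I. f i y) + step_time t b y z"
    using assms by (intro INF_le_INF_plus) (force simp: lip_def)+
  then show "(INF i\<in>I. f i z) - (INF i\<in>I. f i y) \<le> step_time t b y z" by simp
qed

text \<open>Bisect the segment until its pieces are short; the cube is convex, so the midpoints stay
  inside. This serves potentials whose increments are understood only at scale one.\<close>

lemma lipschitz_from_short_steps: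
  fixes f :: "real ^ 'n::finite \<Rightarrow> real"
  assumes "\<And>y z. y \<in> cube n \<Longrightarrow> z \<in> cube n \<Longrightarrow> l1norm (y - z) \<le> 1 \<Longrightarrow> f z - f y \<le> b * l1norm (y - z)"
    and "y \<in> cube n" "z \<in> cube n"
  shows "f z - f y \<le> b * l1norm (y - z)"
proof -
  obtain k :: nat where "l1norm (y - z) \<le> 2 ^ k"
    by (metis less_imp_le of_nat_less_two_power order_less_le_trans reals_Archimedean2)
  then show ?thesis using assms(2,3)
  proof (induction k arbitrary: y z)
    case 0
    then show ?case using assms(1) by simp
  next
    case (Suc k)
    define w where "w = y + (1/2) *\<^sub>R (z - y)"
    have w: "w \<in> cube n" unfolding w_def using cube_convex[OF Suc.prems(2,3)] by simp
    have "y - w = (1/2) *\<^sub>R (y - z)" "w - z = (1/2) *\<^sub>R (y - z)"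
      by (auto simp: w_def vec_eq_iff field_simps)
    then have half: "l1norm (y - w) = l1norm (y - z) / 2" "l1norm (w - z) = l1norm (y - z) / 2"
      using l1norm_scaleR[of "1/2" "y - z"] by simp_all
    have "f w - f y \<le> b * l1norm (y - w)" "f z - f w \<le> b * l1norm (w - z)"
      using Suc.prems w half by (auto intro!: Suc.IH)
    then show ?case by (simp add: half)
  qed
qed

section \<open>Paths, passage times and their lower bounds by potentials\<close>

definition cfg :: "real \<Rightarrow> real \<Rightarrow> ((int ^ 'n::finite) set \<Rightarrow> real) \<Rightarrow> bool" where
  "cfg a b t \<longleftrightarrow> (\<forall>e\<in>edges. a \<le> t e \<and> t e \<le> b)"

lemma paths_nonempty: "x \<in> X \<Longrightarrow> y \<in> X \<Longrightarrow> [x, y] \<in> paths X x y"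
  by (simp add: paths_def)

lemma path_time_singleton [simp]: "path_time t b [x] = 0"
  by (simp add: path_time_def)

lemma path_time_pair [simp]: "path_time t b [x, y] = step_time t b x y"
  by (simp add: path_time_def)

lemma path_time_snoc:
  assumes "xs \<noteq> []"
  shows "path_time t b (xs @ [y]) = path_time t b xs + step_time t b (last xs) y"
proof -
  obtain m where m: "length xs = Suc m" using assms by (cases xs) auto
  have "path_time t b (xs @ [y]) =
      (\<Sum>i<Suc m. step_time t b ((xs @ [y]) ! i) ((xs @ [y]) ! Suc i))"
    by (simp add: path_time_def m)
  also have "\<dots> = (\<Sum>i<m. step_time t b (xs ! i) (xs ! Suc i)) + step_time t b (xs ! m) y"
    by (simp add: m nth_append)
  also have "xs ! m = last xs" using assms m by (simp add: last_conv_nth)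
  finally show ?thesis by (simp add: path_time_def m)
qed

lemma lip_path_time:
  assumes "lip t b X f" "xs \<noteq> []" "set xs \<subseteq> X"
  shows "f (last xs) - f (hd xs) \<le> path_time t b xs"
  using assms(2,3)
proof (induction xs rule: rev_nonempty_induct)
  case (snoc y xs)
  have "f y - f (last xs) \<le> step_time t b (last xs) y"
    using snoc by (intro lipD[OF assms(1)]) (auto simp: last_in_set subset_iff)
  then show ?case using snoc by (simp add: path_time_snoc)
qed simp

lemma T_in_ge_lip:
  assumes "lip t b X f" "x \<in> X" "y \<in> X"
  shows "f y - f x \<le> T_in t b X x y"
  unfolding T_in_def
proof (rule cINF_greatest)
  show "paths X x y \<noteq> {}" using paths_nonempty assms by fastforce
  show "f y - f x \<le> path_time t b xs" if "xs \<in> paths X x y" for xs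
    using lip_path_time[OF assms(1), of xs] that by (auto simp: paths_def)
qed

section \<open>Passage times when the steps are only known to be nonnegative, as needed for
  measurability\<close>

context
  fixes b :: real and t :: "(int ^ 'n::finite) set \<Rightarrow> real" and X :: "(real ^ 'n) set"
  assumes step_nonneg: "\<And>y z. y \<in> X \<Longrightarrow> z \<in> X \<Longrightarrow> 0 \<le> step_time t b y z"
begin

lemma path_time_nonneg: "xs \<noteq> [] \<Longrightarrow> set xs \<subseteq> X \<Longrightarrow> 0 \<le> path_time t b xs"
  unfolding path_time_def by (intro sum_nonneg step_nonneg) (auto simp: subset_iff)

lemma T_in_le_path: "xs \<in> paths X x y \<Longrightarrow> T_in t b X x y \<le> path_time t b xs"
  unfolding T_in_def by (rule cINF_lower) (auto simp: paths_def intro!: path_time_nonneg bdd_belowI[of _ 0])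

lemma nonneg_T_in_le_step: "x \<in> X \<Longrightarrow> y \<in> X \<Longrightarrow> T_in t b X x y \<le> step_time t b x y"
  using T_in_le_path[OF paths_nonempty, of x y] by simp

lemma nonneg_T_in_nonneg: "x \<in> X \<Longrightarrow> y \<in> X \<Longrightarrow> 0 \<le> T_in t b X x y"
  using T_in_ge_lip[of t b X "\<lambda>_. 0" x y] by (simp add: lip_def step_nonneg)

lemma nonneg_T_in_refl: "x \<in> X \<Longrightarrow> T_in t b X x x = 0"
  using nonneg_T_in_le_step[of x x] nonneg_T_in_nonneg[of x x] by simp

lemma nonneg_T_in_append: "x \<in> X \<Longrightarrow> y \<in> X \<Longrightarrow> z \<in> X \<Longrightarrow> T_in t b X x z \<le> T_in t b X x y + step_time t b y z"
proof -
  assume X: "x \<in> X" "y \<in> X" "z \<in> X"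
  have "T_in t b X x z - step_time t b y z \<le> T_in t b X x y"
    unfolding T_in_def[of _ _ _ x y]
  proof (rule cINF_greatest)
    show "paths X x y \<noteq> {}" using paths_nonempty X by fastforce
    fix xs assume xs: "xs \<in> paths X x y"
    then have "xs @ [z] \<in> paths X x z" using X by (auto simp: paths_def)
    then have "T_in t b X x z \<le> path_time t b (xs @ [z])" by (rule T_in_le_path)
    then show "T_in t b X x z - step_time t b y z \<le> path_time t b xs"
      using xs by (auto simp: paths_def path_time_snoc)
  qed
  then show ?thesis by simp
qed

lemma nonneg_lip_T_in: "x \<in> X \<Longrightarrow> lip t b X (T_in t b X x)"
  unfolding lip_def using nonneg_T_in_append by (fastforce simp: algebra_simps)

lemma nonneg_T_in_triangle: "x \<in> X \<Longrightarrow> y \<in> X \<Longrightarrow> z \<in> X \<Longrightarrow> T_in t b X x z \<le> T_in t b X x y + T_in t b X y z"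
  using T_in_ge_lip[OF nonneg_lip_T_in, of x y z] by simp

lemma nonneg_T_in_commute: "x \<in> X \<Longrightarrow> y \<in> X \<Longrightarrow> T_in t b X x y = T_in t b X y x"
proof -
  have "T_in t b X y x \<le> T_in t b X x y" if "x \<in> X" "y \<in> X" for x y
  proof -
    \<comment> \<open>Instead of reversing paths: minus the passage time from y is again a
      potential.\<close>
    have "lip t b X (\<lambda>z. - T_in t b X y z)"
      unfolding lip_def
    proof (intro ballI)
      fix u v assume "u \<in> X" "v \<in> X"
      then show "- T_in t b X y v - - T_in t b X y u \<le> step_time t b u v"
        using nonneg_T_in_append[of y v u] \<open>y \<in> X\<close> step_time_commute[of t b u v] by simp
    qed
    from T_in_ge_lip[OF this that] show ?thesis using nonneg_T_in_refl that by simp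
  qed
  then show "x \<in> X \<Longrightarrow> y \<in> X \<Longrightarrow> T_in t b X x y = T_in t b X y x" by (simp add: order_antisym)
qed

text \<open>Two triangle inequalities at each endpoint. The constant c is kept apart from b because
  weights outside [a, b] also have to be covered in \<open>LD_weights_sets\<close>.\<close>

lemma nonneg_T_in_diff_le:
  assumes c: "\<And>y z. y \<in> X \<Longrightarrow> z \<in> X \<Longrightarrow> step_time t b y z \<le> c * l1norm (y - z)"
    and X: "x \<in> X" "y \<in> X" "x' \<in> X" "y' \<in> X"
  shows "\<bar>T_in t b X x y - T_in t b X x' y'\<bar> \<le> c * (l1norm (x - x') + l1norm (y - y'))"
proof -
  have "T_in t b X x x' \<le> c * l1norm (x - x')" "T_in t b X y y' \<le> c * l1norm (y - y')"
    using nonneg_T_in_le_step c X order_trans by blast+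
  then show ?thesis
    using X nonneg_T_in_triangle[of x x' y] nonneg_T_in_triangle[of x' y' y] nonneg_T_in_triangle[of x' x y']
      nonneg_T_in_triangle[of x y y'] nonneg_T_in_commute
    by (auto simp: algebra_simps abs_le_iff)
qed

end

context
  fixes a b :: real and t :: "(int ^ 'n::finite) set \<Rightarrow> real" and X :: "(real ^ 'n) set"
  assumes ab: "0 \<le> a" "a \<le> b" and cfg: "cfg a b t"
begin

lemma step_time_bounds: "a * l1norm (y - z) \<le> step_time t b y z" "step_time t b y z \<le> b * l1norm (y - z)"
  by (rule step_time_cases[of y z b]; use cfg ab in \<open>auto simp: cfg_def intro!: mult_right_mono l1norm_nonneg\<close>)+

lemma step_time_nonneg: "0 \<le> step_time t b y z"
  using step_time_bounds(1)[of y z] ab mult_nonneg_nonneg[OF ab(1) l1norm_nonneg[of "y - z"]] by linarith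

lemmas T_in_le_step = nonneg_T_in_le_step[of X t b, OF step_time_nonneg]
  and T_in_nonneg = nonneg_T_in_nonneg[of X t b, OF step_time_nonneg]
  and T_in_refl = nonneg_T_in_refl[of X t b, OF step_time_nonneg]
  and lip_T_in = nonneg_lip_T_in[of X t b, OF step_time_nonneg]
  and T_in_triangle = nonneg_T_in_triangle[of X t b, OF step_time_nonneg]
  and T_in_commute = nonneg_T_in_commute[of X t b, OF step_time_nonneg]
  and T_in_diff_le = nonneg_T_in_diff_le[of X t b, OF step_time_nonneg step_time_bounds(2)]

lemma T_in_bounds: "x \<in> X \<Longrightarrow> y \<in> X \<Longrightarrow> T_in t b X x y \<le> b * l1norm (x - y)"
  using T_in_le_step step_time_bounds(2) order_trans by blast

lemma lip_imp_lipschitz: "lip t b X f \<Longrightarrow> y \<in> X \<Longrightarrow> z \<in> X \<Longrightarrow> f z - f y \<le> b * l1norm (y - z)"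
  using lipD step_time_bounds(2) order_trans by blast

end

text \<open>The infimal convolution of a potential with the passage time: the largest potential
  below \<open>m\<close> compatible with the configuration.\<close>

definition conv :: "((int ^ 'n::finite) set \<Rightarrow> real) \<Rightarrow> real \<Rightarrow> (real ^ 'n) set
    \<Rightarrow> (real ^ 'n \<Rightarrow> real) \<Rightarrow> real ^ 'n \<Rightarrow> real" where
  "conv t b X m y = (INF z\<in>X. m z + T_in t b X z y)"

lemma conv:
  assumes "0 \<le> a" "a \<le> b" "cfg a b t"
    and m: "\<And>y z. y \<in> X \<Longrightarrow> z \<in> X \<Longrightarrow> m y - m z - \<epsilon> \<le> T_in t b X z y"
  shows "y \<in> X \<Longrightarrow> m y - \<epsilon> \<le> conv t b X m y" "y \<in> X \<Longrightarrow> conv t b X m y \<le> m y"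
    "X \<noteq> {} \<Longrightarrow> lip t b X (conv t b X m)"
proof -
  have bdd: "bdd_below ((\<lambda>z. m z + T_in t b X z y) ` X)" if "y \<in> X" for y
    by (rule bdd_belowI[of _ "m y - \<epsilon>"]) (use m that in force)
  show "m y - \<epsilon> \<le> conv t b X m y" if "y \<in> X"
    unfolding conv_def by (rule cINF_greatest) (use m that in force)+
  show "conv t b X m y \<le> m y" if "y \<in> X"
    unfolding conv_def using cINF_lower[OF bdd[OF that] that] T_in_refl[OF assms(1-3) that] by simp
  show "lip t b X (conv t b X m)" if "X \<noteq> {}"
    unfolding conv_def[abs_def] using bdd that
    by (intro lip_INF lip_add_const lip_T_in[OF assms(1-3)]) auto
qed

definition extend :: "real \<Rightarrow> (real ^ 'n::finite) set \<Rightarrow> (real ^ 'n \<Rightarrow> real) \<Rightarrow> real ^ 'n \<Rightarrow> real" where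
  "extend b A \<psi> y = (INF z\<in>A. \<psi> z + b * l1norm (y - z))"

text \<open>The minimum of a potential \<open>\<Phi>\<close> adapted to the old configuration and of a McShane
  extension \<open>\<psi>\<close> of a potential adapted to the new one: since \<open>m\<close> has slope at most \<open>b - \<theta>\<close>, the
  extension, lowered by \<open>H\<close>, wins on \<open>A\<close> and loses far away from \<open>A\<close>.\<close>

lemma glue:
  fixes m \<psi> \<Phi> :: "real ^ 'n::finite \<Rightarrow> real"
  assumes b: "0 \<le> b" and A: "A \<noteq> {}"
    and \<psi>: "\<And>y z. y \<in> A \<Longrightarrow> z \<in> A \<Longrightarrow> \<psi> z - \<psi> y \<le> b * l1norm (y - z)"
    and \<psi>m: "\<And>y. y \<in> A \<Longrightarrow> \<bar>\<psi> y - m y\<bar> \<le> \<sigma>"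
    and m: "\<And>y z. m z - m y \<le> (b - \<theta>) * l1norm (y - z)"
    and \<theta>: "0 \<le> \<theta>"
    and \<Phi>: "\<And>y. y \<in> X \<Longrightarrow> m y - \<epsilon> \<le> \<Phi> y" "\<And>y. y \<in> X \<Longrightarrow> \<Phi> y \<le> m y"
    and \<Phi>lip: "\<And>y z. y \<in> X \<Longrightarrow> z \<in> X \<Longrightarrow> \<Phi> z - \<Phi> y \<le> b * l1norm (y - z)"
    and H: "\<sigma> + \<epsilon> \<le> H" "0 \<le> \<sigma>" "0 \<le> \<epsilon>"
  defines "f \<equiv> \<lambda>y. min (\<Phi> y) (extend b A \<psi> y - H)"
  shows "\<And>y. y \<in> X \<Longrightarrow> y \<in> A \<Longrightarrow> f y = \<psi> y - H"
    and "\<And>y. y \<in> X \<Longrightarrow> (\<And>z. z \<in> A \<Longrightarrow> H + \<sigma> \<le> \<theta> * l1norm (y - z)) \<Longrightarrow> f y = \<Phi> y"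
    and "\<And>y z. y \<in> X \<Longrightarrow> z \<in> X \<Longrightarrow> f z - f y \<le> b * l1norm (y - z)"
    and "\<And>y. y \<in> X \<Longrightarrow> m y - 2 * H \<le> f y" and "\<And>y. y \<in> X \<Longrightarrow> f y \<le> m y"
proof -
  have low: "m y - \<sigma> + \<theta> * l1norm (y - z) \<le> \<psi> z + b * l1norm (y - z)" if "z \<in> A" for y z
    using \<psi>m[OF that] m[of y z] by (simp add: l1norm_minus_commute algebra_simps abs_le_iff)
  have low': "m y - \<sigma> \<le> \<psi> z + b * l1norm (y - z)" if "z \<in> A" for y z
    using low[OF that, of y] mult_nonneg_nonneg[OF \<theta> l1norm_nonneg[of "y - z"]] by linarith
  have bdd: "bdd_below ((\<lambda>z. \<psi> z + b * l1norm (y - z)) ` A)" for y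
    using low'[of _ y] by (intro bdd_belowI[of _ "m y - \<sigma>"]) auto
  have ext: "extend b A \<psi> y = \<psi> y" if "y \<in> A" for y
  proof (rule antisym)
    show "extend b A \<psi> y \<le> \<psi> y"
      unfolding extend_def using cINF_lower[OF bdd that, of y] by simp
    show "\<psi> y \<le> extend b A \<psi> y"
      unfolding extend_def using \<psi>[OF _ that] by (intro cINF_greatest A) (simp add: l1norm_minus_commute algebra_simps)
  qed
  have ext_low: "m y - \<sigma> \<le> extend b A \<psi> y" for y
    unfolding extend_def using low' by (intro cINF_greatest A)
  \<comment> \<open>On \<open>A\<close> the lowered extension is at most m + \<sigma> - H, hence at
    most m - \<epsilon>, which is a lower bound of \<Phi>.\<close>
  show "f y = \<psi> y - H" if "y \<in> X" "y \<in> A" for y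
    using \<Phi>(1)[OF that(1)] \<psi>m[OF that(2)] H by (simp add: f_def ext[OF that(2)] abs_le_iff min_def)
  \<comment> \<open>Far from \<open>A\<close> the slope gap \<theta>, accumulated over the distance,
    pays for both \<sigma> and H.\<close>
  show "f y = \<Phi> y" if "y \<in> X" and far: "\<And>z. z \<in> A \<Longrightarrow> H + \<sigma> \<le> \<theta> * l1norm (y - z)" for y
  proof -
    have "m y + H \<le> extend b A \<psi> y"
      unfolding extend_def
    proof (intro cINF_greatest A)
      fix z assume "z \<in> A"
      then show "m y + H \<le> \<psi> z + b * l1norm (y - z)" using low[of z y] far[of z] by linarith
    qed
    then show ?thesis using \<Phi>(2)[OF that(1)] by (simp add: f_def min_def)
  qed
  show "m y - 2 * H \<le> f y" if "y \<in> X" for y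
    using \<Phi>(1)[OF that] ext_low[of y] H by (simp add: f_def)
  show "f y \<le> m y" if "y \<in> X" for y
    using \<Phi>(2)[OF that] by (simp add: f_def)
  have "extend b A \<psi> z \<le> extend b A \<psi> y + b * l1norm (y - z)" for y z
    unfolding extend_def
  proof (rule INF_le_INF_plus[OF A bdd])
    fix w
    have "b * l1norm (z - w) \<le> b * (l1norm (y - w) + l1norm (y - z))"
      using l1norm_triangle3[of z w y] b by (intro mult_left_mono) (auto simp: l1norm_minus_commute)
    then show "\<psi> w + b * l1norm (z - w) \<le> \<psi> w + b * l1norm (y - w) + b * l1norm (y - z)"
      by (simp add: algebra_simps)
  qed
  then show "f z - f y \<le> b * l1norm (y - z)" if "y \<in> X" "z \<in> X" for y z
    using \<Phi>lip[OF that] unfolding f_def by (smt (verit) min_def)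
qed

section \<open>Edges and lattice points\<close>

lemma l1norm_axis [simp]: "l1norm (axis j c) = \<bar>c\<bar>"
proof -
  have "(\<Sum>i\<in>UNIV. \<bar>axis j c $ i\<bar>) = (\<Sum>i\<in>UNIV. if i = j then \<bar>c\<bar> else 0)"
    by (intro sum.cong) (auto simp: axis_def)
  then show ?thesis by (simp add: l1norm_def)
qed

lemma adjacent_axis: "adjacent v (v + axis j 1)"
proof -
  have "(\<Sum>i\<in>UNIV. \<bar>v $ i - (v + axis j 1) $ i\<bar>) = (\<Sum>i\<in>UNIV. if i = j then 1 else 0)"
    by (intro sum.cong) (auto simp: axis_def)
  then show ?thesis by (simp add: adjacent_def)
qed

lemma adjacent_axis_cases:
  fixes v w :: "int ^ 'n::finite"
  assumes "adjacent v w"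
  obtains j where "w = v + axis j 1 \<or> v = w + axis j 1"
proof -
  let ?f = "\<lambda>i. \<bar>v $ i - w $ i\<bar>"
  have s: "sum ?f UNIV = 1" using assms by (simp add: adjacent_def)
  then obtain j where j: "?f j \<noteq> 0" by (metis (mono_tags, lifting) sum.neutral zero_neq_one)
  have "?f j + sum ?f (UNIV - {j}) = 1" using s by (subst (asm) sum.remove[of _ j]) auto
  moreover have "0 \<le> sum ?f (UNIV - {j})" by (rule sum_nonneg) simp
  ultimately have j1: "?f j = 1" and "sum ?f (UNIV - {j}) = 0" using j by linarith+
  then have "\<forall>i\<in>UNIV - {j}. ?f i = 0" by (subst (asm) sum_nonneg_eq_0_iff) auto
  then have other: "\<And>i. i \<noteq> j \<Longrightarrow> v $ i = w $ i" by auto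
  have "w $ j = v $ j + 1 \<or> v $ j = w $ j + 1" using j1 by linarith
  then have "w = v + axis j 1 \<or> v = w + axis j 1"
    using other by (auto simp: vec_eq_iff axis_def)
  then show ?thesis by (rule that)
qed

lemma emb_add_axis: "emb (v + axis j k) = emb v + axis j (of_int k)"
  by (simp add: emb_def vec_eq_iff axis_def)

lemma emb_nth [simp]: "emb v $ i = of_int (v $ i)"
  by (simp add: emb_def)

lemma points_of_axis_edge: "points_of {v, v + axis j 1} = {emb v + axis j s |s. 0 \<le> s \<and> s \<le> 1}"
proof -
  have "(1 - s) *\<^sub>R emb v + s *\<^sub>R emb (v + axis j 1) = emb v + axis j s" for s
    by (simp add: emb_add_axis vec_eq_iff axis_def algebra_simps)
  then show ?thesis
    by (simp add: points_of_edge[OF adjacent_axis] closed_segment_def)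
qed

lemma edges_cases:
  assumes "e \<in> edges"
  obtains v j where "e = {v, v + axis j 1}"
proof -
  obtain v w where vw: "e = {v, w}" "adjacent v w" using assms by (auto simp: edges_def)
  from vw(2) obtain j where "w = v + axis j 1 \<or> v = w + axis j 1" by (rule adjacent_axis_cases)
  then have "e = {v, v + axis j 1} \<or> e = {w, w + axis j 1}" using vw(1) by blast
  then show ?thesis using that by blast
qed

lemma axis_edge_in_edges: "{v, v + axis j 1} \<in> edges"
  unfolding edges_def using adjacent_axis by blast

text \<open>The arbitrary choice in \<open>step_time\<close> is forced here: an edge containing both
  endpoints has the same direction and the same lower endpoint.\<close>

lemma step_time_lattice:
  "step_time t b (emb v) (emb (v + axis j 1)) = t {v, v + axis j 1}"
proof -
  let ?w = "v + axis j 1"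
  let ?e = "edge_through (emb v) (emb ?w)"
  have on: "on_edge {v, ?w} (emb v) (emb ?w)"
    by (simp add: on_edge_iff points_of_edge[OF adjacent_axis])
  have "on_edge ?e (emb v) (emb ?w)" by (rule edge_through[OF on])
  moreover from this obtain p i where pi: "?e = {p, p + axis i 1}" using edges_cases on_edge_edges by metis
  ultimately obtain c c' where c: "emb v = emb p + axis i c" "emb ?w = emb p + axis i c'"
      "0 \<le> c" "c \<le> 1" "0 \<le> c'" "c' \<le> 1"
    unfolding on_edge_iff pi points_of_axis_edge by blast
  have vk: "real_of_int (v $ k) = p $ k + axis i c $ k" "real_of_int (v $ k) + axis j 1 $ k = p $ k + axis i c' $ k" for k
    using arg_cong[OF c(1), of "\<lambda>z. z $ k"] arg_cong[OF c(2), of "\<lambda>z. z $ k"] by (simp_all add: emb_add_axis)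
  have ij: "i = j" using vk[of j] by (auto simp: axis_def split: if_splits)
  then have "p $ j = v $ j" "k \<noteq> j \<Longrightarrow> p $ k = v $ k" for k
    using vk[of j] vk[of k] c(3-6) by (auto simp: axis_def)
  then have "p = v" unfolding vec_eq_iff by metis
  then have "?e = {v, ?w}" using pi ij by simp
  moreover have "l1norm (emb v - emb ?w) = 1"
    using l1norm_axis[of j 1] by (simp add: emb_add_axis)
  ultimately show ?thesis using step_time_on_edge[OF on, of t b] by simp
qed

lemma points_of_coordinates:
  assumes "z \<in> points_of {v, v + axis j 1}"
  shows "real_of_int (v $ i) \<le> z $ i" "z $ i \<le> real_of_int (v $ i) + 1"
  using assms unfolding points_of_axis_edge by (auto simp: axis_def)

lemma points_of_l1_diff:
  assumes "e \<in> edges" "y \<in> points_of e" "z \<in> points_of e"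
  shows "l1norm (y - z) \<le> 1"
proof -
  obtain v j where "e = {v, v + axis j 1}" using edges_cases[OF assms(1)] .
  then obtain s s' where "y = emb v + axis j s" "z = emb v + axis j s'" "0 \<le> s" "s \<le> 1" "0 \<le> s'" "s' \<le> 1"
    using assms(2,3) by (auto simp: points_of_axis_edge)
  moreover from this have "y - z = axis j (s - s')" by (simp add: vec_eq_iff axis_def)
  ultimately show ?thesis by simp
qed

lemma
  fixes S :: "'n::finite \<Rightarrow> int set"
  shows card_lattice_box: "card {v. \<forall>i. v $ i \<in> S i} = (\<Prod>i\<in>UNIV. card (S i))"
    and finite_lattice_box: "(\<And>i. finite (S i)) \<Longrightarrow> finite {v. \<forall>i. v $ i \<in> S i}"
proof -
  have bij: "bij_betw (\<lambda>v i. v $ i) {v. \<forall>i. v $ i \<in> S i} (PiE UNIV S)"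
    by (rule bij_betwI[where g = "\<lambda>f. \<chi> i. f i"]) auto
  then show "card {v. \<forall>i. v $ i \<in> S i} = (\<Prod>i\<in>UNIV. card (S i))"
    by (simp add: bij_betw_same_card card_PiE)
  show "finite {v. \<forall>i. v $ i \<in> S i}" if "\<And>i. finite (S i)"
    using bij_betw_finite[OF bij] that by (simp add: finite_PiE)
qed

lemma card_int_interval_le:
  fixes l u :: real
  assumes "l \<le> u + 1"
  shows "finite {k::int. l \<le> k \<and> k \<le> u}" "real (card {k::int. l \<le> k \<and> k \<le> u}) \<le> u - l + 1"
proof -
  have eq: "{k::int. l \<le> k \<and> k \<le> u} = {\<lceil>l\<rceil>..\<lfloor>u\<rfloor>}"
    by (auto simp: ceiling_le_iff le_floor_iff)
  show "finite {k::int. l \<le> k \<and> k \<le> u}" unfolding eq by simp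
  show "real (card {k::int. l \<le> k \<and> k \<le> u}) \<le> u - l + 1" unfolding eq using assms by (auto simp: of_nat_nat) linarith
qed

lemma card_edges_from_vertices:
  fixes V :: "(int ^ 'n::finite) set"
  assumes "finite V" "\<And>e. e \<in> P \<Longrightarrow> \<exists>v\<in>V. \<exists>j. e = {v, v + axis j 1}"
  shows "finite P" "real (card P) \<le> real CARD('n) * real (card V)"
proof -
  have sub: "P \<subseteq> (\<lambda>(v, j). {v, v + axis j 1}) ` (V \<times> UNIV)" using assms(2) by fast
  have fin: "finite (V \<times> (UNIV :: 'n set))" using assms(1) by simp
  show "finite P" by (rule finite_subset[OF sub]) (use fin in blast)
  have "card P \<le> card (V \<times> (UNIV :: 'n set))"
    by (rule order_trans[OF card_mono[OF _ sub] card_image_le]) (use fin in auto)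
  then have "card P \<le> card V * CARD('n)" by (simp add: card_cartesian_product)
  then show "real (card P) \<le> real CARD('n) * real (card V)"
    by (metis mult.commute of_nat_le_iff of_nat_mult)
qed

text \<open>Cover the tube by boxes around equidistant points of its axis.\<close>

lemma card_edges_near_segment:
  fixes x u :: "real ^ 'n::finite"
  assumes "CARD('n) \<ge> 2" "\<And>i. \<bar>u $ i\<bar> \<le> 1" "0 < \<delta>" "\<delta> \<le> 1" "1 \<le> \<delta> * real n"
  defines "P \<equiv> {e\<in>edges. \<exists>z\<in>points_of e. \<exists>\<tau>. 0 \<le> \<tau> \<and> \<tau> \<le> real n \<and> l1norm (z - (x + \<tau> *\<^sub>R u)) \<le> \<delta> * real n}"
  shows "finite P" "real (card P) \<le> 3 * real CARD('n) * 7 ^ CARD('n) * \<delta> * real n ^ CARD('n)"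
proof -
  \<comment> \<open>The J + 1 centres below have spacing n / J, at most \<delta> n in the parameter
    of the segment.\<close>
  define J where "J = nat \<lceil>1 / \<delta>\<rceil>"
  have J: "1 / \<delta> \<le> real J" "real J \<le> 1 / \<delta> + 1" "0 < J"
    using assms(3) by (auto simp: J_def of_nat_nat)
  have n: "0 < real n" using assms(3,5) by (cases "n = 0") auto
  define c where "c j = x + (real n * real j / real J) *\<^sub>R u" for j
  \<comment> \<open>1 for the distance from the base vertex to a point of its edge, \<delta> n for
    the radius of the tube, \<delta> n for the nearest centre. Since 1 \<le> \<delta> n, the side 2
    R + 1 is at most 7 \<delta> n.\<close>
  define R where "R = 1 + 2 * \<delta> * real n"
  define V where "V j = {v :: int ^ 'n. \<forall>i. v $ i \<in> {k. c j $ i - R \<le> of_int k \<and> of_int k \<le> c j $ i + R}}" for j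
  have R0: "0 \<le> R" using assms(3) by (simp add: R_def)
  have R7: "2 * R + 1 \<le> 7 * (\<delta> * real n)" using assms(5) by (simp add: R_def)
  have fin: "finite (V j)" for j
    unfolding V_def by (rule finite_lattice_box) (use R0 in \<open>auto intro!: card_int_interval_le\<close>)
  have card: "real (card (V j)) \<le> (2 * R + 1) ^ CARD('n)" for j
  proof -
    let ?S = "\<lambda>i. {k::int. c j $ i - R \<le> of_int k \<and> of_int k \<le> c j $ i + R}"
    have "real (card (V j)) \<le> (\<Prod>i\<in>UNIV. real (card (?S i)))"
      unfolding V_def card_lattice_box by simp
    also have "\<dots> \<le> (\<Prod>i\<in>(UNIV::'n set). 2 * R + 1)"
      using R0 by (intro prod_mono conjI) (auto intro!: order_trans[OF card_int_interval_le(2)])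
    finally show ?thesis by simp
  qed
  have cov: "\<exists>v\<in>(\<Union>j\<in>{0..J}. V j). \<exists>j. e = {v, v + axis j 1}" if eP: "e \<in> P" for e
  proof -
    obtain z \<tau> where z: "e \<in> edges" "z \<in> points_of e" "0 \<le> \<tau>" "\<tau> \<le> real n" "l1norm (z - (x + \<tau> *\<^sub>R u)) \<le> \<delta> * real n"
      using eP by (auto simp: P_def)
    obtain v i where vi: "e = {v, v + axis i 1}" using edges_cases[OF z(1)] .
    define j where "j = nat \<lfloor>\<tau> * real J / real n\<rfloor>"
    have j0: "real j \<le> \<tau> * real J / real n" "\<tau> * real J / real n < real j + 1"
      using z n by (auto simp: j_def of_nat_nat)
    have "\<tau> * real J / real n \<le> real J" using z n J by (simp add: divide_simps mult.commute mult_left_mono)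
    then have j: "j \<le> J" using j0 by linarith
    have "0 \<le> \<tau> - real n * real j / real J" "\<tau> - real n * real j / real J \<le> real n / real J"
    proof -
      have J0: "0 < real J" using J by simp
      have "(\<tau> * real J / real n) * (real n / real J) = \<tau>" using n J0 by simp
      moreover have "real j * (real n / real J) \<le> (\<tau> * real J / real n) * (real n / real J)"
        "(\<tau> * real J / real n) * (real n / real J) \<le> (real j + 1) * (real n / real J)"
        using j0 n J0 by (intro mult_right_mono; simp)+
      ultimately have "real j * (real n / real J) \<le> \<tau>" "\<tau> \<le> (real j + 1) * (real n / real J)" by (simp_all only:)
      then show "0 \<le> \<tau> - real n * real j / real J" "\<tau> - real n * real j / real J \<le> real n / real J"
        by (simp_all add: algebra_simps add_divide_distrib)
    qed
    moreover have "real n / real J \<le> \<delta> * real n" using J n assms(3) by (simp add: field_simps)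
    ultimately have close: "\<bar>\<tau> - real n * real j / real J\<bar> \<le> \<delta> * real n" by linarith
    have "v \<in> V j"
      unfolding V_def
    proof safe
      fix k
      have 1: "\<bar>of_int (v $ k) - z $ k\<bar> \<le> 1" using points_of_coordinates[of z v i k] z vi by auto
      have 2: "\<bar>(z - (x + \<tau> *\<^sub>R u)) $ k\<bar> \<le> \<delta> * real n"
        using z(5) abs_component_le_l1norm order_trans by blast
      have 3: "\<bar>(\<tau> - real n * real j / real J) * u $ k\<bar> \<le> \<delta> * real n * 1"
        unfolding abs_mult using close assms by (intro mult_mono) auto
      have "(x + \<tau> *\<^sub>R u) $ k - c j $ k = (\<tau> - real n * real j / real J) * u $ k"
        by (simp add: c_def algebra_simps)
      then have "\<bar>(x + \<tau> *\<^sub>R u) $ k - c j $ k\<bar> \<le> \<delta> * real n" using 3 by (simp only: mult_1_right)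
      then have "\<bar>of_int (v $ k) - c j $ k\<bar> \<le> 1 + \<delta> * real n + \<delta> * real n"
        using 1 2 unfolding vector_minus_component by linarith
      then have "\<bar>of_int (v $ k) - c j $ k\<bar> \<le> R" by (simp add: R_def)
      then show "c j $ k - R \<le> of_int (v $ k)" "of_int (v $ k) \<le> c j $ k + R" by linarith+
    qed
    moreover have "j \<in> {0..J}" using j by simp
    ultimately show ?thesis unfolding vi by blast
  qed
  have finU: "finite (\<Union>j\<in>{0..J}. V j)" using fin by blast
  show "finite P" by (rule card_edges_from_vertices(1)[OF finU cov])
  have "real (card (\<Union>j\<in>{0..J}. V j)) \<le> (\<Sum>j\<in>{0..J}. real (card (V j)))"
    unfolding of_nat_sum[symmetric] of_nat_le_iff by (rule card_UN_le) simp
  also have "\<dots> \<le> (\<Sum>j\<in>{0..J}. (7 * (\<delta> * real n)) ^ CARD('n))"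
    using R0 R7 by (intro sum_mono order_trans[OF card] power_mono) auto
  also have "\<dots> = (real J + 1) * (7 * (\<delta> * real n)) ^ CARD('n)" by simp
  also have "\<dots> \<le> (3 / \<delta>) * (7 * (\<delta> * real n)) ^ CARD('n)"
  proof (rule mult_right_mono)
    have "1 \<le> 1 / \<delta>" using assms(3,4) by simp
    then show "real J + 1 \<le> 3 / \<delta>" using J by (simp add: field_simps)
  qed (use assms in auto)
  also have "\<dots> = 3 * 7 ^ CARD('n) * \<delta> ^ (CARD('n) - 1) * real n ^ CARD('n)"
    using assms(1,3) by (cases "CARD('n)") (auto simp: power_mult_distrib field_simps)
  \<comment> \<open>This is where dimension at least two enters: 1 / \<delta> boxes of volume
    \<delta> ^ d leave d - 1 \<ge> 1 powers of \<delta>.\<close>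
  also have "\<dots> \<le> 3 * 7 ^ CARD('n) * \<delta> * real n ^ CARD('n)"
    using assms(1,3,4) power_decreasing[of 1 "CARD('n) - 1" \<delta>] by (intro mult_mono) auto
  finally have "real (card (\<Union>j\<in>{0..J}. V j)) \<le> 3 * 7 ^ CARD('n) * \<delta> * real n ^ CARD('n)" .
  then have "real CARD('n) * real (card (\<Union>j\<in>{0..J}. V j)) \<le> real CARD('n) * (3 * 7 ^ CARD('n) * \<delta> * real n ^ CARD('n))"
    by (intro mult_left_mono) auto
  also have "\<dots> = 3 * real CARD('n) * 7 ^ CARD('n) * \<delta> * real n ^ CARD('n)" by simp
  finally show "real (card P) \<le> 3 * real CARD('n) * 7 ^ CARD('n) * \<delta> * real n ^ CARD('n)"
    using card_edges_from_vertices(2)[OF finU cov, of P] by linarith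
qed

section \<open>A piecewise linear function of prescribed mean slope\<close>

text \<open>A Sturmian pattern: the floor jumps with frequency (c - a) / (b - a), so the increments
  are a or b and their mean is c. Only a and b are used as weights because, being the ends of the
  support, they are approached with positive probability.\<close>

definition ramp_nat :: "real \<Rightarrow> real \<Rightarrow> real \<Rightarrow> int \<Rightarrow> real" where
  "ramp_nat a b c k = a * of_int k + (b - a) * of_int \<lfloor>of_int k * ((c - a) / (b - a))\<rfloor>"

definition ramp :: "real \<Rightarrow> real \<Rightarrow> real \<Rightarrow> real \<Rightarrow> real" where
  "ramp a b c s = ramp_nat a b c \<lfloor>s\<rfloor> + (s - of_int \<lfloor>s\<rfloor>) * (ramp_nat a b c (\<lfloor>s\<rfloor> + 1) - ramp_nat a b c \<lfloor>s\<rfloor>)"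

context
  fixes a b c :: real
  assumes abc: "0 < a" "a < b" "a \<le> c" "c \<le> b"
begin

lemma ramp_nat_step: "ramp_nat a b c (k + 1) - ramp_nat a b c k \<in> {a, b}"
proof -
  define q where "q = (c - a) / (b - a)"
  have q: "0 \<le> q" "q \<le> 1" using abc by (auto simp: q_def)
  have "\<lfloor>of_int (k + 1) * q\<rfloor> = \<lfloor>of_int k * q\<rfloor> \<or> \<lfloor>of_int (k + 1) * q\<rfloor> = \<lfloor>of_int k * q\<rfloor> + 1"
  proof -
    have "of_int (k + 1) * q = of_int k * q + q" by (simp add: algebra_simps)
    then show ?thesis using q by linarith
  qed
  then show ?thesis by (auto simp: ramp_nat_def q_def[symmetric] algebra_simps)
qed

lemma ramp_nat_approx: "\<bar>ramp_nat a b c k - c * of_int k\<bar> \<le> b - a"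
proof -
  define q where "q = (c - a) / (b - a)"
  have c: "c = a + (b - a) * q" using abc by (simp add: q_def)
  have "ramp_nat a b c k - c * of_int k = (b - a) * (of_int \<lfloor>of_int k * q\<rfloor> - of_int k * q)"
    by (subst (2) c) (simp add: ramp_nat_def q_def[symmetric] algebra_simps)
  moreover have "\<bar>of_int \<lfloor>of_int k * q\<rfloor> - of_int k * q\<bar> \<le> 1" by linarith
  then have "(b - a) * \<bar>of_int \<lfloor>of_int k * q\<rfloor> - of_int k * q\<bar> \<le> (b - a) * 1"
    using abc by (intro mult_left_mono) auto
  ultimately show ?thesis using abc by (simp add: abs_mult)
qed

lemma ramp_on_unit_interval:
  assumes "of_int k \<le> s" "s \<le> of_int k + 1"
  shows "ramp a b c s = ramp_nat a b c k + (s - of_int k) * (ramp_nat a b c (k + 1) - ramp_nat a b c k)"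
proof (cases "s = of_int k + 1")
  case True
  then have "\<lfloor>s\<rfloor> = k + 1" by linarith
  then show ?thesis using True by (simp add: ramp_def)
next
  case False
  then have "\<lfloor>s\<rfloor> = k" using assms by linarith
  then show ?thesis by (simp add: ramp_def)
qed

lemma ramp_of_int [simp]: "ramp a b c (of_int k) = ramp_nat a b c k"
  by (simp add: ramp_def)

lemma ramp_approx: "\<bar>ramp a b c s - c * s\<bar> \<le> b - a"
proof -
  let ?k = "\<lfloor>s\<rfloor>"
  define lam where "lam = s - of_int ?k"
  have lam: "0 \<le> lam" "lam \<le> 1" by (auto simp: lam_def) linarith
  define e0 e1 where "e0 = ramp_nat a b c ?k - c * of_int ?k" and "e1 = ramp_nat a b c (?k + 1) - c * of_int (?k + 1)"
  have e: "\<bar>e0\<bar> \<le> b - a" "\<bar>e1\<bar> \<le> b - a" unfolding e0_def e1_def by (rule ramp_nat_approx)+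
  have s: "s = of_int ?k + lam" by (simp add: lam_def)
  have "ramp a b c s = ramp_nat a b c ?k + lam * (ramp_nat a b c (?k + 1) - ramp_nat a b c ?k)"
    by (simp add: ramp_def lam_def)
  also have "\<dots> - c * (of_int ?k + lam) = (1 - lam) * e0 + lam * e1"
    by (simp add: e0_def e1_def algebra_simps)
  finally have "ramp a b c s - c * s = (1 - lam) * e0 + lam * e1" using s by simp
  also have "\<bar>\<dots>\<bar> \<le> (1 - lam) * (b - a) + lam * (b - a)"
    using lam e by (intro order_trans[OF abs_triangle_ineq] add_mono) (auto simp: abs_mult intro!: mult_left_mono)
  finally show ?thesis by (simp add: algebra_simps)
qed

lemma ramp_diff:
  assumes "s \<le> s'"
  shows "0 \<le> ramp a b c s' - ramp a b c s" "ramp a b c s' - ramp a b c s \<le> b * (s' - s)"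
proof -
  have loc: "0 \<le> ramp a b c s' - ramp a b c s \<and> ramp a b c s' - ramp a b c s \<le> b * (s' - s)"
    if "of_int k \<le> s" "s \<le> s'" "s' \<le> of_int k + 1" for k s s'
  proof -
    let ?d = "ramp_nat a b c (k + 1) - ramp_nat a b c k"
    have "ramp a b c s' - ramp a b c s = (s' - s) * ?d"
      using that by (simp add: ramp_on_unit_interval[of k s] ramp_on_unit_interval[of k s'] algebra_simps)
    moreover have "0 \<le> ?d" "?d \<le> b" using ramp_nat_step[of k] abc by auto
    then have "0 \<le> (s' - s) * ?d" "(s' - s) * ?d \<le> (s' - s) * b"
      using that by (auto intro!: mult_left_mono)
    ultimately show ?thesis by (simp add: mult.commute)
  qed
  have ints: "0 \<le> ramp a b c (of_int k + real m) - ramp a b c (of_int k) \<and>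
      ramp a b c (of_int k + real m) - ramp a b c (of_int k) \<le> b * real m" for k m
  proof (induction m)
    case (Suc m)
    have "of_int (k + int m) = of_int k + real m" by simp
    then show ?case using Suc loc[of "k + int m" "of_int k + real m" "of_int k + real (Suc m)"]
      by (simp add: algebra_simps)
  qed simp
  have "0 \<le> ramp a b c s' - ramp a b c s \<and> ramp a b c s' - ramp a b c s \<le> b * (s' - s)"
  proof (cases "\<lfloor>s\<rfloor> = \<lfloor>s'\<rfloor>")
    case True
    then show ?thesis using assms by (intro loc[of "\<lfloor>s\<rfloor>"]) linarith+
  next
    case False
    then have fl: "\<lfloor>s\<rfloor> + 1 \<le> \<lfloor>s'\<rfloor>" using assms floor_mono[OF assms] by linarith
    define m where "m = nat (\<lfloor>s'\<rfloor> - (\<lfloor>s\<rfloor> + 1))"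
    have m: "of_int (\<lfloor>s\<rfloor> + 1) + real m = of_int \<lfloor>s'\<rfloor>" using fl by (simp add: m_def of_nat_nat)
    define p q where "p = real_of_int (\<lfloor>s\<rfloor> + 1)" and "q = real_of_int \<lfloor>s'\<rfloor>"
    have "0 \<le> ramp a b c p - ramp a b c s \<and> ramp a b c p - ramp a b c s \<le> b * (p - s)"
      by (rule loc[of "\<lfloor>s\<rfloor>"]) (unfold p_def, linarith+)
    moreover have "0 \<le> ramp a b c s' - ramp a b c q \<and> ramp a b c s' - ramp a b c q \<le> b * (s' - q)"
      by (rule loc[of "\<lfloor>s'\<rfloor>"]) (unfold q_def, linarith+)
    moreover have "0 \<le> ramp a b c q - ramp a b c p \<and> ramp a b c q - ramp a b c p \<le> b * (q - p)"
    proof -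
      have "real m = q - p" using m by (simp add: p_def q_def)
      then show ?thesis using ints[of "\<lfloor>s\<rfloor> + 1" m] by (simp only: p_def[symmetric]) simp
    qed
    ultimately show ?thesis by (simp add: algebra_simps)
  qed
  then show "0 \<le> ramp a b c s' - ramp a b c s" "ramp a b c s' - ramp a b c s \<le> b * (s' - s)" by auto
qed

lemma ramp_lipschitz: "\<bar>ramp a b c s' - ramp a b c s\<bar> \<le> b * \<bar>s' - s\<bar>"
  using ramp_diff[of s s'] ramp_diff[of s' s] by (cases "s \<le> s'") auto

end

section \<open>Norms dominated by a multiple of the l1-norm\<close>

lemma normsD:
  assumes "g \<in> norms a b"
  shows "0 \<le> g x" "g (c *\<^sub>R x) = \<bar>c\<bar> * g x" "g (x + y) \<le> g x + g y" "g x = 0 \<longleftrightarrow> x = 0"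
    "a * l1norm x \<le> g x" "g x \<le> b * l1norm x"
  using assms by (auto simp: norms_def is_norm_def)

lemma norms_minus:
  assumes "g \<in> norms a b"
  shows "g (- x) = g x"
  using normsD(2)[OF assms, of "-1" x] by simp

lemma norms_minus_commute:
  assumes "g \<in> norms a b"
  shows "g (x - y) = g (y - x)"
  using norms_minus[OF assms, of "x - y"] by simp

lemma norms_triangle3:
  assumes "g \<in> norms a b"
  shows "g (x - z) \<le> g (x - y) + g (y - z)"
  using normsD(3)[OF assms, of "x - y" "y - z"] by simp

section \<open>Inserting one highway\<close>

definition override :: "'e set \<Rightarrow> ('e \<Rightarrow> real) \<Rightarrow> ('e \<Rightarrow> real) \<Rightarrow> 'e \<Rightarrow> real" where
  "override F s t = (\<lambda>e. if e \<in> F then s e else t e)"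

lemma cfg_override: "cfg a b t \<Longrightarrow> (\<And>e. e \<in> F \<Longrightarrow> a \<le> s e \<and> s e \<le> b) \<Longrightarrow> cfg a b (override F s t)"
  by (auto simp: cfg_def override_def)

text \<open>The highway follows the segment from \<open>x\<close> to \<open>x + n u\<close>. Inside the tube of radius \<open>r\<close> the
  weight of an edge depends only on its position in the direction of the signs of \<open>u\<close>, so that
  every monotone lattice path has mean weight \<open>h u / l1norm u\<close>; the shell up to radius \<open>R\<close> gets
  the maximal weight \<open>b\<close>.\<close>

locale tube =
  fixes a b :: real and h :: "real ^ 'n::finite \<Rightarrow> real" and n :: nat and x u :: "real ^ 'n" and r R :: real
  assumes ab: "0 < a" "a < b" and h: "h \<in> norms a b" and u: "u \<noteq> 0"
    and seg: "\<And>\<tau>. 0 \<le> \<tau> \<Longrightarrow> \<tau> \<le> real n \<Longrightarrow> x + \<tau> *\<^sub>R u \<in> cube n"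
    and rR: "0 < r" "r < R"
begin

definition sg :: "'n \<Rightarrow> int" where "sg i = (if u $ i \<ge> 0 then 1 else -1)"
text \<open>The linear form of norm one for \<open>l1norm\<close> that is attained at u. It changes
  by exactly one along every edge, so a function of \<open>pos\<close> can be realised by edge
  weights.\<close>

definition pos :: "real ^ 'n \<Rightarrow> real" where "pos z = (\<Sum>i\<in>UNIV. of_int (sg i) * z $ i)"
definition ipos :: "int ^ 'n \<Rightarrow> int" where "ipos v = (\<Sum>i\<in>UNIV. sg i * v $ i)"
definition slope :: real where "slope = h u / l1norm u"
definition inner_tube :: "(real ^ 'n) set" where
  "inner_tube = {z. \<exists>\<tau>. 0 \<le> \<tau> \<and> \<tau> \<le> real n \<and> l1norm (z - (x + \<tau> *\<^sub>R u)) \<le> r}"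
definition outer_tube :: "(real ^ 'n) set" where
  "outer_tube = {z. \<exists>\<tau>. 0 \<le> \<tau> \<and> \<tau> \<le> real n \<and> l1norm (z - (x + \<tau> *\<^sub>R u)) \<le> R}"
definition F :: "(int ^ 'n) set set" where
  "F = {e \<in> edges. points_of e \<inter> cube n \<inter> outer_tube \<noteq> {}}"
text \<open>Edges crossing the boundary of the inner tube are given b as well: the highway potential
  is available only inside, and for weight b the general Lipschitz bound suffices. Only the part of
  an edge in the cube counts, since paths stay there.\<close>

definition wt :: "(int ^ 'n) set \<Rightarrow> real" where
  "wt e = (if points_of e \<inter> cube n \<subseteq> inner_tube
    then ramp_nat a b slope (Min (ipos ` e) + 1) - ramp_nat a b slope (Min (ipos ` e)) else b)"

lemma b0: "0 \<le> b" using ab by simp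

lemma l1u: "0 < l1norm u"
  using u l1norm_nonneg[of u] l1norm_eq_0_iff[of u] by linarith

lemma hu: "0 < h u"
  using normsD(5)[OF h, of u] mult_pos_pos[OF ab(1) l1u] by linarith

lemma slope: "a \<le> slope" "slope \<le> b"
  using normsD(5,6)[OF h, of u] l1u by (auto simp: slope_def divide_simps)

lemmas ramp_slope = ab slope

lemma abs_sg [simp]: "\<bar>sg i\<bar> = 1" "\<bar>real_of_int (sg i)\<bar> = 1"
  by (auto simp: sg_def)

lemma pos_diff: "pos (y - z) = pos y - pos z" and pos_add: "pos (y + z) = pos y + pos z"
  and pos_scaleR: "pos (c *\<^sub>R z) = c * pos z"
  by (auto simp: pos_def algebra_simps sum_subtractf sum.distrib sum_distrib_left)

lemma abs_pos_le: "\<bar>pos z\<bar> \<le> l1norm z"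
  unfolding pos_def l1norm_def by (rule order_trans[OF sum_abs]) (simp add: abs_mult)

lemma pos_u: "pos u = l1norm u"
  unfolding pos_def l1norm_def by (intro sum.cong) (auto simp: sg_def)

lemma pos_emb: "pos (emb v) = of_int (ipos v)"
  by (simp add: pos_def ipos_def)

lemma pos_axis: "pos (axis j s) = of_int (sg j) * s"
proof -
  have "pos (axis j s) = (\<Sum>i\<in>UNIV. if i = j then of_int (sg j) * s else 0)"
    unfolding pos_def by (intro sum.cong) (auto simp: axis_def)
  then show ?thesis by simp
qed

lemma ipos_add_axis: "ipos (v + axis j 1) = ipos v + sg j"
proof -
  have "real_of_int (ipos (v + axis j 1)) = of_int (ipos v + sg j)"
    unfolding pos_emb[symmetric] emb_add_axis pos_add pos_axis by (simp add: pos_emb)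
  then show ?thesis by linarith
qed

lemma pos_on_edge:
  assumes "e \<in> edges" "z \<in> points_of e"
  shows "of_int (Min (ipos ` e)) \<le> pos z" "pos z \<le> of_int (Min (ipos ` e)) + 1"
proof -
  obtain v j where e: "e = {v, v + axis j 1}" using edges_cases[OF assms(1)] .
  then obtain s where s: "z = emb v + axis j s" "0 \<le> s" "s \<le> 1"
    using assms(2) unfolding e points_of_axis_edge by blast
  have "pos z = of_int (ipos v) + of_int (sg j) * s" by (simp add: s pos_add pos_emb pos_axis)
  moreover have "Min (ipos ` e) = min (ipos v) (ipos v + sg j)" by (simp add: e ipos_add_axis)
  ultimately show "of_int (Min (ipos ` e)) \<le> pos z" "pos z \<le> of_int (Min (ipos ` e)) + 1"
    using s by (auto simp: sg_def min_def)
qed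

lemma wt_cases: "wt e \<in> {a, b}"
  using ramp_nat_step[OF ramp_slope] unfolding wt_def by auto

lemma cfg_wt: "cfg a b t \<Longrightarrow> cfg a b (override F wt t)"
proof (rule cfg_override)
  show "a \<le> wt e \<and> wt e \<le> b" for e using wt_cases[of e] ab by auto
qed

text \<open>A retraction to the axis, parametrised so that h-distances on the axis are highway
  travel times. An h-Lipschitz function composed with \<open>warp\<close> is therefore a potential
  for the weights inside the tube.\<close>

definition warp :: "real ^ 'n \<Rightarrow> real ^ 'n" where
  "warp z = x + ((ramp a b slope (pos z) - slope * pos x) / h u) *\<^sub>R u"

lemma h_warp_diff: "h (warp y - warp z) = \<bar>ramp a b slope (pos y) - ramp a b slope (pos z)\<bar>"
proof -
  have "warp y - warp z = ((ramp a b slope (pos y) - ramp a b slope (pos z)) / h u) *\<^sub>R u"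
    by (simp add: warp_def diff_divide_distrib flip: scaleR_diff_left)
  then show ?thesis using hu by (simp only: normsD(2)[OF h]) simp
qed

text \<open>Three errors add up: the rounding of the ramp, at most b; the effect of the transversal
  displacement on \<open>pos\<close>, at most b r; and the displacement itself, at most b r in
  \<open>h\<close>.\<close>

lemma warp_close:
  assumes "z \<in> inner_tube"
  shows "h (warp z - z) \<le> b + 2 * b * r"
proof -
  obtain \<tau> where \<tau>: "0 \<le> \<tau>" "\<tau> \<le> real n" "l1norm (z - (x + \<tau> *\<^sub>R u)) \<le> r"
    using assms by (auto simp: inner_tube_def)
  define w where "w = z - (x + \<tau> *\<^sub>R u)"
  have z: "z = x + \<tau> *\<^sub>R u + w" by (simp add: w_def)
  define \<delta> where "\<delta> = ramp a b slope (pos z) - slope * pos z + slope * pos w"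
  have w: "l1norm w \<le> r" using \<tau> by (simp add: w_def)
  have "\<bar>slope * pos w\<bar> \<le> b * r"
    unfolding abs_mult using slope ab abs_pos_le[of w] w by (intro mult_mono) auto
  then have \<delta>: "\<bar>\<delta>\<bar> \<le> b + b * r"
    using ramp_approx[OF ramp_slope, of "pos z"] ab by (simp add: \<delta>_def)
  have "slope * pos z = slope * pos x + \<tau> * h u + slope * pos w"
    using l1u by (simp add: z pos_add pos_scaleR pos_u slope_def algebra_simps)
  then have "ramp a b slope (pos z) - slope * pos x = \<tau> * h u + \<delta>" by (simp add: \<delta>_def)
  then have "warp z - z = (\<delta> / h u) *\<^sub>R u + - w"
    using hu by (simp add: warp_def z add_divide_distrib scaleR_add_left)
  then have "h (warp z - z) \<le> h ((\<delta> / h u) *\<^sub>R u) + h (- w)" by (metis normsD(3)[OF h])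
  also have "h ((\<delta> / h u) *\<^sub>R u) = \<bar>\<delta>\<bar>" using hu by (simp only: normsD(2)[OF h]) simp
  also have "h (- w) \<le> b * r"
    using normsD(6)[OF h, of "- w"] mult_left_mono[OF w b0] by simp
  finally show ?thesis using \<delta> by simp
qed

text \<open>Shrinking \<open>h\<close> by the factor 1 - \<theta> creates the slope gap \<theta> b
  that \<open>glue\<close> requires, since \<open>h\<close> itself may have slope b. The insulation
  of width R - r gives the gap room to take effect, so the potential returns to one of the old
  configuration outside the outer tube.\<close>

lemma T_lower:
  assumes t: "cfg a b t" and T: "\<And>p q. p \<in> cube n \<Longrightarrow> q \<in> cube n \<Longrightarrow> h (p - q) - \<epsilon> \<le> T_in t b (cube n) p q"
    and \<theta>: "0 < \<theta>" "\<theta> \<le> 1" and \<epsilon>: "0 \<le> \<epsilon>"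
    and H: "b + 2 * b * r + \<epsilon> \<le> H" "H + (b + 2 * b * r) \<le> \<theta> * b * (R - r)"
    and pq: "p \<in> cube n" "q \<in> cube n"
  shows "(1 - \<theta>) * h (p - q) - 2 * H \<le> T_in (override F wt t) b (cube n) p q"
proof -
  let ?\<sigma> = "b + 2 * b * r"
  have ab': "0 \<le> a" "a \<le> b" using ab by auto
  define m where "m z = (1 - \<theta>) * h (z - p)" for z
  define \<psi> where "\<psi> z = m (warp z)" for z
  define \<Phi> where "\<Phi> = conv t b (cube n) m"
  have m_h: "m y - m z \<le> (1 - \<theta>) * h (y - z)" for y z
  proof -
    have "(1 - \<theta>) * h (y - p) \<le> (1 - \<theta>) * (h (y - z) + h (z - p))"
      using \<theta> norms_triangle3[OF h, of y p z] by (intro mult_left_mono) auto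
    then show ?thesis by (simp add: m_def algebra_simps)
  qed
  have m_h': "m y - m z \<le> h (y - z)" for y z
  proof -
    have "(1 - \<theta>) * h (y - z) \<le> 1 * h (y - z)"
      using \<theta> normsD(1)[OF h] by (intro mult_right_mono) auto
    then show ?thesis using m_h[of y z] by linarith
  qed
  have mT: "m y - m z - \<epsilon> \<le> T_in t b (cube n) z y" if "y \<in> cube n" "z \<in> cube n" for y z
    using T[OF that(2,1)] m_h'[of y z] norms_minus_commute[OF h, of y z] by linarith
  have \<Phi>: "y \<in> cube n \<Longrightarrow> m y - \<epsilon> \<le> \<Phi> y" "y \<in> cube n \<Longrightarrow> \<Phi> y \<le> m y" "lip t b (cube n) \<Phi>" for y
    unfolding \<Phi>_def using conv[OF ab' t, of "cube n" m \<epsilon>] mT pq by blast+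
  have \<psi>: "\<psi> z - \<psi> y \<le> \<bar>ramp a b slope (pos z) - ramp a b slope (pos y)\<bar>" for y z
    using m_h'[of "warp z" "warp y"] by (simp add: \<psi>_def h_warp_diff)
  have "x \<in> inner_tube" using rR by (auto simp: inner_tube_def intro!: exI[of _ 0])
  then have g1: "inner_tube \<noteq> {}" by blast
  have g2: "\<psi> z - \<psi> y \<le> b * l1norm (y - z)" for y z
  proof -
    have "b * \<bar>pos z - pos y\<bar> \<le> b * l1norm (y - z)"
      using abs_pos_le[of "z - y"] ab by (intro mult_left_mono) (auto simp: pos_diff l1norm_minus_commute)
    then show ?thesis
      using \<psi>[of z y] ramp_lipschitz[OF ramp_slope, of "pos z" "pos y"] by linarith
  qed
  have g3: "\<bar>\<psi> y - m y\<bar> \<le> ?\<sigma>" if "y \<in> inner_tube" for y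
    using m_h'[of "warp y" y] m_h'[of y "warp y"] warp_close[OF that] norms_minus_commute[OF h, of y "warp y"]
    by (simp add: \<psi>_def abs_le_iff)
  have g4: "m z - m y \<le> (b - \<theta> * b) * l1norm (y - z)" for y z
  proof -
    have "(1 - \<theta>) * h (z - y) \<le> (1 - \<theta>) * (b * l1norm (z - y))"
      using \<theta> normsD(6)[OF h] by (intro mult_left_mono) auto
    then show ?thesis using m_h[of z y] by (simp add: algebra_simps l1norm_minus_commute)
  qed
  have g5: "\<Phi> z - \<Phi> y \<le> b * l1norm (y - z)" if "y \<in> cube n" "z \<in> cube n" for y z
    using lip_imp_lipschitz[OF ab' t \<Phi>(3)] that by blast
  define f where "f y = min (\<Phi> y) (extend b inner_tube \<psi> y - H)" for y
  have glued: "\<And>y. y \<in> cube n \<Longrightarrow> y \<in> inner_tube \<Longrightarrow> f y = \<psi> y - H"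
    "\<And>y. y \<in> cube n \<Longrightarrow> (\<And>z. z \<in> inner_tube \<Longrightarrow> H + ?\<sigma> \<le> \<theta> * b * l1norm (y - z)) \<Longrightarrow> f y = \<Phi> y"
    "\<And>y z. y \<in> cube n \<Longrightarrow> z \<in> cube n \<Longrightarrow> f z - f y \<le> b * l1norm (y - z)"
    "\<And>y. y \<in> cube n \<Longrightarrow> m y - 2 * H \<le> f y" "\<And>y. y \<in> cube n \<Longrightarrow> f y \<le> m y"
    unfolding f_def
    by (rule glue[where m = m and \<psi> = \<psi> and \<Phi> = \<Phi> and \<theta> = "\<theta> * b" and \<sigma> = ?\<sigma> and \<epsilon> = \<epsilon> and X = "cube n" and A = inner_tube,
          OF b0 g1 g2 g3 g4 _ \<Phi>(1,2) g5 H(1)]; use \<theta> b0 rR \<epsilon> in simp)+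
  have far: "f y = \<Phi> y" if "y \<in> cube n" "y \<notin> outer_tube" for y
  proof (rule glued(2)[OF that(1)])
    fix z assume "z \<in> inner_tube"
    then obtain \<tau> where \<tau>: "0 \<le> \<tau>" "\<tau> \<le> real n" "l1norm (z - (x + \<tau> *\<^sub>R u)) \<le> r"
      by (auto simp: inner_tube_def)
    have "\<not> l1norm (y - (x + \<tau> *\<^sub>R u)) \<le> R" using that(2) \<tau>(1,2) unfolding outer_tube_def by blast
    then have "R - r \<le> l1norm (y - z)" using \<tau>(3) l1norm_triangle3[of y "x + \<tau> *\<^sub>R u" z] by linarith
    then have "\<theta> * b * (R - r) \<le> \<theta> * b * l1norm (y - z)" using \<theta> ab by (intro mult_left_mono) auto
    then show "H + ?\<sigma> \<le> \<theta> * b * l1norm (y - z)" using H by linarith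
  qed
  have "lip (override F wt t) b (cube n) f"
  proof (rule lipI)
    show "f z - f y \<le> b * l1norm (y - z)" if "y \<in> cube n" "z \<in> cube n" for y z
      using glued(3)[OF that] .
    fix e :: "(int ^ 'n) set" and y z :: "real ^ 'n"
    assume e: "e \<in> edges" "e = edge_through y z" and yz: "y \<in> cube n" "z \<in> cube n" "y \<in> points_of e" "z \<in> points_of e"
    show "f z - f y \<le> override F wt t e * l1norm (y - z)"
    proof (cases "e \<in> F")
      case False
      then have "f y = \<Phi> y" "f z = \<Phi> z" using far yz e by (auto simp: F_def)
      moreover have "\<Phi> z - \<Phi> y \<le> step_time t b y z" using \<Phi>(3) yz by (auto intro: lipD)
      moreover have "step_time t b y z = t e * l1norm (y - z)"
        using step_time_on_edge[of e y z t b] yz e by (simp add: on_edge_iff)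
      ultimately show ?thesis using False by (simp add: override_def)
    next
      case True
      show ?thesis
      proof (cases "points_of e \<inter> cube n \<subseteq> inner_tube")
        case False
        then show ?thesis using True glued(3)[OF yz(1,2)] by (simp add: override_def wt_def)
      next
        case inn: True
        define k where "k = Min (ipos ` e)"
        have k: "of_int k \<le> pos y" "pos y \<le> of_int k + 1" "of_int k \<le> pos z" "pos z \<le> of_int k + 1"
          using pos_on_edge[OF e(1)] yz by (auto simp: k_def)
        have "ramp a b slope (pos z) - ramp a b slope (pos y) = (pos z - pos y) * wt e"
          unfolding ramp_on_unit_interval[OF ramp_slope k(1,2)] ramp_on_unit_interval[OF ramp_slope k(3,4)]
          using inn by (simp add: wt_def k_def algebra_simps)
        moreover have "0 \<le> wt e" using wt_cases[of e] ab by auto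
        ultimately have "\<bar>ramp a b slope (pos z) - ramp a b slope (pos y)\<bar> \<le> wt e * l1norm (y - z)"
          using abs_pos_le[of "z - y"]
          by (simp add: abs_mult pos_diff mult.commute l1norm_minus_commute mult_right_mono)
        moreover have "y \<in> inner_tube" "z \<in> inner_tube" using yz inn by blast+
        then have "f z - f y = \<psi> z - \<psi> y" using glued(1)[OF yz(1)] glued(1)[OF yz(2)] by simp
        ultimately show ?thesis using \<psi>[of z y] True by (simp add: override_def)
      qed
    qed
  qed
  from T_in_ge_lip[OF this pq] have "f q - f p \<le> T_in (override F wt t) b (cube n) p q" .
  moreover have "f p \<le> 0" using glued(5)[OF pq(1)] normsD(4)[OF h, of 0] by (simp add: m_def)
  moreover have "m q - 2 * H \<le> f q" using glued(4)[OF pq(2)] .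
  ultimately show ?thesis by (simp add: m_def norms_minus_commute[OF h, of p])
qed

text \<open>Walk from v to w along the lattice, changing one coordinate at a time towards w. Each
  step raises \<open>ipos\<close> by one and stays in the box, hence in the tube, so the weights
  telescope. The induction is on the number of steps left.\<close>

lemma T_monotone_box:
  assumes t: "cfg a b t"
    and "\<And>i. 0 \<le> sg i * (w $ i - v $ i)"
    and "\<And>z. (\<And>i. min (v $ i) (w $ i) \<le> z $ i \<and> z $ i \<le> max (v $ i) (w $ i)) \<Longrightarrow> z \<in> inner_tube \<inter> cube n"
  shows "T_in (override F wt t) b (cube n) (emb v) (emb w) \<le> ramp_nat a b slope (ipos w) - ramp_nat a b slope (ipos v)"
  using assms(2,3)
proof (induction "nat (ipos w - ipos v)" arbitrary: v rule: less_induct)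
  case less
  have ab': "0 \<le> a" "a \<le> b" using ab by auto
  have sum: "ipos w - ipos v = (\<Sum>i\<in>UNIV. sg i * (w $ i - v $ i))"
    by (simp add: ipos_def algebra_simps sum_subtractf)
  have vc: "emb v \<in> cube n" "emb w \<in> cube n" using less.prems(2) by auto
  note cfg' = cfg_wt[OF t]
  show ?case
  proof (cases "v = w")
    case True
    then show ?thesis using T_in_refl[OF ab' cfg' vc(1)] by simp
  next
    case False
    then obtain j where j: "v $ j \<noteq> w $ j" by (auto simp: vec_eq_iff)
    have s: "sg j = 1 \<or> sg j = -1" by (simp add: sg_def)
    define v' where "v' = v + axis j (sg j)"
    have v'j: "v' $ j = v $ j + sg j" and v'i: "i \<noteq> j \<Longrightarrow> v' $ i = v $ i" for i
      by (auto simp: v'_def axis_def)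
    have ip: "ipos v' = ipos v + 1"
    proof -
      have "real_of_int (ipos v') = of_int (ipos v + sg j * sg j)"
        unfolding pos_emb[symmetric] v'_def emb_add_axis pos_add pos_axis by (simp add: pos_emb)
      then show ?thesis using s by auto
    qed
    have j': "v $ j < w $ j \<and> sg j = 1 \<or> w $ j < v $ j \<and> sg j = -1"
      using less.prems(1)[of j] j s by auto
    have mono: "0 \<le> sg i * (w $ i - v' $ i)" for i
      using less.prems(1)[of i] j' by (cases "i = j") (auto simp: v'j v'i)
    have btw: "min (v $ i) (w $ i) \<le> min (v' $ i) (w $ i) \<and> max (v' $ i) (w $ i) \<le> max (v $ i) (w $ i)" for i
      using j' by (cases "i = j") (auto simp: v'j v'i)
    have box: "z \<in> inner_tube \<inter> cube n"
      if "\<And>i. real_of_int (min (v' $ i) (w $ i)) \<le> z $ i \<and> z $ i \<le> real_of_int (max (v' $ i) (w $ i))" for z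
    proof (rule less.prems(2))
      fix i
      have "real_of_int (min (v $ i) (w $ i)) \<le> real_of_int (min (v' $ i) (w $ i))"
        "real_of_int (max (v' $ i) (w $ i)) \<le> real_of_int (max (v $ i) (w $ i))"
        unfolding of_int_le_iff using btw[of i] by auto
      then show "real_of_int (min (v $ i) (w $ i)) \<le> z $ i \<and> z $ i \<le> real_of_int (max (v $ i) (w $ i))"
        using that[of i] by linarith
    qed
    have pos1: "0 \<le> (\<Sum>i\<in>UNIV. sg i * (w $ i - v' $ i))" by (rule sum_nonneg) (rule mono)
    have sum': "ipos w - ipos v' = (\<Sum>i\<in>UNIV. sg i * (w $ i - v' $ i))"
      by (simp add: ipos_def algebra_simps sum_subtractf)
    have dec: "nat (ipos w - ipos v') < nat (ipos w - ipos v)" using pos1 sum' ip by linarith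
    have IH: "T_in (override F wt t) b (cube n) (emb v') (emb w) \<le> ramp_nat a b slope (ipos w) - ramp_nat a b slope (ipos v')"
      by (rule less.hyps[OF dec mono box]) blast
    define e where "e = {v, v'}"
    define v0 where "v0 = (if sg j = 1 then v else v')"
    have "sg j = -1 \<Longrightarrow> v' + axis j 1 = v" by (simp add: v'_def vec_eq_iff axis_def)
    then have e0: "e = {v0, v0 + axis j 1}"
      using s by (auto simp: e_def v0_def v'_def)
    have e: "e \<in> edges" unfolding e0 by (rule axis_edge_in_edges)
    have v0: "v0 $ j = min (v $ j) (v' $ j)" "v0 $ j + 1 = max (v $ j) (v' $ j)" "i \<noteq> j \<Longrightarrow> v0 $ i = v $ i" for i
      using s by (auto simp: v0_def v'j v'i)
    have pts: "points_of e \<subseteq> inner_tube \<inter> cube n"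
    proof
      fix z assume "z \<in> points_of e"
      then obtain c where c: "z = emb v0 + axis j c" "0 \<le> c" "c \<le> 1"
        unfolding e0 points_of_axis_edge by blast
      show "z \<in> inner_tube \<inter> cube n"
      proof (rule less.prems(2))
        fix i
        show "real_of_int (min (v $ i) (w $ i)) \<le> z $ i \<and> z $ i \<le> real_of_int (max (v $ i) (w $ i))"
        proof (cases "i = j")
          case True
          have "min (v $ j) (w $ j) \<le> v0 $ j" "v0 $ j + 1 \<le> max (v $ j) (w $ j)"
            unfolding v0(1,2) using j' by (auto simp: v'j)
          then have "real_of_int (min (v $ j) (w $ j)) \<le> real_of_int (v0 $ j)"
            "real_of_int (v0 $ j + 1) \<le> real_of_int (max (v $ j) (w $ j))"
            unfolding of_int_le_iff by auto
          then show ?thesis using True c by (simp add: axis_def)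
        next
          case False
          then show ?thesis using c v0(3)[of i] by (simp add: axis_def)
        qed
      qed
    qed
    have vv: "emb v \<in> points_of e" "emb v' \<in> points_of e"
    proof -
      have "emb w' \<in> points_of {w', w''}" "emb w'' \<in> points_of {w', w''}" if "adjacent w' w''" for w' w'' :: "int ^ 'n"
        by (simp_all add: points_of_edge[OF that])
      moreover have "adjacent v v' \<or> adjacent v' v"
        using adjacent_axis[of v0 j] e0 e_def by (auto simp: doubleton_eq_iff)
      ultimately show "emb v \<in> points_of e" "emb v' \<in> points_of e"
        unfolding e_def by (auto simp: adjacent_commute)
    qed
    have "step_time (override F wt t) b (emb v) (emb v') = override F wt t e"
    proof (cases "sg j = 1")
      case True
      then show ?thesis using step_time_lattice[of _ b v j] e0 by (simp add: v0_def v'_def)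
    next
      case False
      then have "v0 = v'" "v' + axis j 1 = v" using s by (simp_all add: v0_def v'_def vec_eq_iff axis_def)
      then show ?thesis using step_time_lattice[of _ b v' j] e0 step_time_commute by metis
    qed
    moreover have "override F wt t e = ramp_nat a b slope (ipos v') - ramp_nat a b slope (ipos v)"
    proof -
      have "Min (ipos ` e) = ipos v" by (simp add: e_def ip)
      moreover have "e \<in> F"
      proof -
        have "emb v \<in> outer_tube"
          using pts vv(1) rR(2) unfolding inner_tube_def outer_tube_def by fastforce
        then show ?thesis using e vv vc by (auto simp: F_def)
      qed
      ultimately show ?thesis using pts ip by (auto simp: override_def wt_def)
    qed
    ultimately have "step_time (override F wt t) b (emb v) (emb v') = ramp_nat a b slope (ipos v') - ramp_nat a b slope (ipos v)"
      by simp
    moreover have v'c: "emb v' \<in> cube n" using pts vv by auto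
    ultimately have "T_in (override F wt t) b (cube n) (emb v) (emb v') \<le> ramp_nat a b slope (ipos v') - ramp_nat a b slope (ipos v)"
      using T_in_le_step[OF ab' cfg' vc(1) v'c] by simp
    then show ?thesis using IH T_in_triangle[OF ab' cfg' vc(1) v'c vc(2)] by linarith
  qed
qed

end

text \<open>If the weights are changed only on \<open>F\<close>, an optimal path for the old weights can be cut at
  its first and last visits to \<open>F\<close>; the potential below performs the cut at the first visit.\<close>

lemma T_override_le:
  fixes t :: "(int ^ 'n::finite) set \<Rightarrow> real"
  assumes ab: "0 \<le> a" "a \<le> b" and t: "cfg a b t" and t': "cfg a b t'" and eq: "\<And>e. e \<notin> F \<Longrightarrow> t' e = t e"
    and pq: "p \<in> X" "q \<in> X" and E: "0 \<le> E"
    and *: "\<And>z e. z \<in> X \<Longrightarrow> e \<in> F \<Longrightarrow> z \<in> points_of e \<Longrightarrow>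
        T_in t' b X p q - E \<le> T_in t' b X p z + T_in t b X z q"
  shows "T_in t' b X p q \<le> T_in t b X p q + E"
proof -
  define B where "B = {z \<in> X. \<exists>e\<in>F. z \<in> points_of e}"
  define G where "G y = (INF z\<in>B. T_in t' b X p z + T_in t b X z y)" for y
  define f where "f y = (if B = {} then T_in t' b X p y else min (T_in t' b X p y) (G y))" for y
  have bdd: "bdd_below ((\<lambda>z. T_in t' b X p z + T_in t b X z y) ` B)" if "y \<in> X" for y
    using T_in_nonneg[OF ab t] T_in_nonneg[OF ab t'] pq that
    by (intro bdd_belowI[of _ 0]) (auto simp: B_def)
  have T': "T_in t' b X p z - T_in t' b X p y \<le> step_time t' b y z" if "y \<in> X" "z \<in> X" for y z
    using lipD[OF lip_T_in[OF ab t' pq(1)] that] .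
  have G: "lip t b X G" if "B \<noteq> {}"
    unfolding G_def[abs_def]
    by (intro lip_INF that bdd lip_add_const lip_T_in[OF ab t]) (auto simp: B_def)
  have GB: "G y \<le> T_in t' b X p y" if "y \<in> B" for y
    unfolding G_def using cINF_lower[OF bdd that, of y] that T_in_refl[OF ab t, of y X] by (auto simp: B_def)
  have "lip t b X f"
    unfolding lip_def
  proof (intro ballI)
    fix y z assume yz: "y \<in> X" "z \<in> X"
    show "f z - f y \<le> step_time t b y z"
    proof (cases "B \<noteq> {} \<and> y \<in> B \<and> z \<in> B")
      case True
      \<comment> \<open>On B the second branch is the minimum, as one sees from the choice of the
        point itself in the infimum.\<close>
      then have "f z = G z" "f y = G y" using GB by (auto simp: f_def min_absorb2)
      then show ?thesis using lipD[OF G yz] True by simp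
    next
      case False
      \<comment> \<open>A step with an endpoint outside B does not run along an edge of F, so both
        configurations charge the same for it.\<close>
      have "step_time t' b y z = step_time t b y z"
      proof (rule step_time_cases[of y z b])
        fix e assume e: "on_edge e y z" and st: "\<And>t. step_time t b y z = t e * l1norm (y - z)"
        then have "e \<notin> F" using False yz by (auto simp: B_def on_edge_iff)
        then show ?thesis using st eq by simp
      qed simp
      then have "T_in t' b X p z - T_in t' b X p y \<le> step_time t b y z" using T'[OF yz] by simp
      moreover have "B \<noteq> {} \<Longrightarrow> G z - G y \<le> step_time t b y z" using lipD[OF G yz] by simp
      ultimately show ?thesis unfolding f_def by (cases "B = {}") (auto simp: min_def)
    qed
  qed
  from T_in_ge_lip[OF this pq] have "f q - f p \<le> T_in t b X p q" .
  moreover have "f p \<le> 0" using T_in_refl[OF ab t' pq(1)] by (simp add: f_def)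
  moreover have "T_in t' b X p q - E \<le> f q"
  proof (cases "B = {}")
    case False
    then have "T_in t' b X p q - E \<le> G q"
      unfolding G_def using * by (intro cINF_greatest) (auto simp: B_def)
    then show ?thesis using E False by (simp add: f_def)
  qed (use E in \<open>simp add: f_def\<close>)
  ultimately show ?thesis by linarith
qed

definition lattice_floor :: "real ^ 'n::finite \<Rightarrow> int ^ 'n" where
  "lattice_floor z = (\<chi> i. \<lfloor>z $ i\<rfloor>)"

lemma l1norm_lattice_floor: "l1norm (z - emb (lattice_floor z)) \<le> real CARD('n)"
  for z :: "real ^ 'n::finite"
  using l1norm_le_card[of "z - emb (lattice_floor z)" 1] by (simp add: lattice_floor_def) linarith

lemma lattice_floor_in_cube: "z \<in> cube n \<Longrightarrow> emb (lattice_floor z) \<in> cube n"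
proof -
  assume z: "z \<in> cube n"
  have "real_of_int \<lfloor>z $ i\<rfloor> \<le> real n" for i
    using z of_int_floor_le[of "z $ i"] unfolding cube_def by (blast intro: order_trans)
  then show ?thesis using z by (simp add: cube_def lattice_floor_def)
qed

context tube
begin

text \<open>Cut the segment into pieces of l1-length at most r / 2 and round the division points
  down to the lattice; rounding preserves monotonicity in each coordinate. Consecutive points span a
  box within r / 2 + 3 d of the axis, which is inside the tube. In the constant, joining the ends to
  the lattice costs 2 b d, their rounding in \<open>pos\<close> another 2 b d, and the ramp at most
  2 b.\<close>

lemma T_along_axis_ordered:
  assumes t: "cfg a b t" and r: "6 * real CARD('n) \<le> r"
    and \<tau>: "0 \<le> \<tau>1" "\<tau>1 \<le> \<tau>2" "\<tau>2 \<le> real n"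
  shows "T_in (override F wt t) b (cube n) (x + \<tau>1 *\<^sub>R u) (x + \<tau>2 *\<^sub>R u)
    \<le> (\<tau>2 - \<tau>1) * h u + (4 * b * real CARD('n) + 2 * b)"
proof -
  let ?T = "T_in (override F wt t) b (cube n)"
  let ?d = "real CARD('n)"
  have ab': "0 \<le> a" "a \<le> b" using ab by auto
  note cfg' = cfg_wt[OF t]
  obtain N0 :: nat where N0: "2 * (\<tau>2 - \<tau>1) * l1norm u / r < real N0" using reals_Archimedean2 by blast
  define N where "N = Suc N0"
  have N: "(\<tau>2 - \<tau>1) * l1norm u \<le> real N * (r / 2)" "0 < real N"
    using N0 rR by (auto simp: N_def field_simps)
  define \<rho> where "\<rho> j = \<tau>1 + (\<tau>2 - \<tau>1) * real j / real N" for j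
  define w where "w j = lattice_floor (x + \<rho> j *\<^sub>R u)" for j
  have \<rho>_step: "\<rho> (Suc j) - \<rho> j = (\<tau>2 - \<tau>1) / real N" for j
    by (simp add: \<rho>_def add_divide_distrib algebra_simps flip: diff_divide_distrib)
  have \<rho>_range: "0 \<le> \<rho> j" "\<rho> j \<le> real n" if "j \<le> N" for j
  proof -
    have "(\<tau>2 - \<tau>1) * real j / real N \<le> (\<tau>2 - \<tau>1) * 1"
      using that \<tau> N by (simp add: divide_simps mult_left_mono)
    moreover have "0 \<le> (\<tau>2 - \<tau>1) * real j / real N" using \<tau> by simp
    ultimately show "0 \<le> \<rho> j" "\<rho> j \<le> real n" using \<tau> by (auto simp: \<rho>_def)
  qed
  have pt: "x + \<rho> j *\<^sub>R u \<in> cube n" if "j \<le> N" for j using seg \<rho>_range[OF that] by blast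
  have wc: "emb (w j) \<in> cube n" if "j \<le> N" for j
    unfolding w_def by (rule lattice_floor_in_cube[OF pt[OF that]])
  have chunk: "?T (emb (w j)) (emb (w (Suc j))) \<le> ramp_nat a b slope (ipos (w (Suc j))) - ramp_nat a b slope (ipos (w j))"
    if "Suc j \<le> N" for j
  proof (rule T_monotone_box[OF t])
    have inc: "\<rho> j \<le> \<rho> (Suc j)" using \<rho>_step[of j] \<tau> N by (metis diff_ge_0_iff_ge divide_nonneg_pos)
    fix i show "0 \<le> sg i * (w (Suc j) $ i - w j $ i)"
    proof (cases "0 \<le> u $ i")
      case True
      then have "w j $ i \<le> w (Suc j) $ i"
        using inc unfolding w_def lattice_floor_def by (auto intro!: floor_mono mult_right_mono)
      then show ?thesis using True by (simp add: sg_def)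
    next
      case False
      then have "w (Suc j) $ i \<le> w j $ i"
        using inc unfolding w_def lattice_floor_def by (auto intro!: floor_mono mult_right_mono_neg)
      then show ?thesis using False by (simp add: sg_def)
    qed
  next
    fix z :: "real ^ 'n" assume z: "\<And>i. real_of_int (min (w j $ i) (w (Suc j) $ i)) \<le> z $ i \<and> z $ i \<le> real_of_int (max (w j $ i) (w (Suc j) $ i))"
    have j: "j \<le> N" using that by simp
    have "z \<in> cube n"
      unfolding cube_def
    proof safe
      fix i
      have "0 \<le> emb (w j) $ i" "0 \<le> emb (w (Suc j)) $ i" "emb (w j) $ i \<le> real n" "emb (w (Suc j)) $ i \<le> real n"
        using wc[OF j] wc[OF that] unfolding cube_def by auto
      then show "0 \<le> z $ i" "z $ i \<le> real n" using z[of i] by (auto simp: min_def max_def split: if_splits)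
    qed
    moreover have "z \<in> inner_tube"
    proof -
      have "l1norm (z - emb (w j)) \<le> l1norm (emb (w (Suc j)) - emb (w j))"
        unfolding l1norm_def
      proof (rule sum_mono)
        fix i
        show "\<bar>(z - emb (w j)) $ i\<bar> \<le> \<bar>(emb (w (Suc j)) - emb (w j)) $ i\<bar>"
          using z[of i] by (cases "w j $ i \<le> w (Suc j) $ i") (auto simp: min_def max_def)
      qed
      also have "\<dots> \<le> l1norm (emb (w (Suc j)) - (x + \<rho> (Suc j) *\<^sub>R u))
          + (l1norm ((x + \<rho> (Suc j) *\<^sub>R u) - (x + \<rho> j *\<^sub>R u)) + l1norm ((x + \<rho> j *\<^sub>R u) - emb (w j)))"
        by (rule order_trans[OF l1norm_triangle3 add_left_mono[OF l1norm_triangle3]])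
      also have "\<dots> \<le> ?d + (r / 2 + ?d)"
      proof (intro add_mono)
        have "(x + \<rho> (Suc j) *\<^sub>R u) - (x + \<rho> j *\<^sub>R u) = ((\<tau>2 - \<tau>1) / real N) *\<^sub>R u"
          by (simp add: \<rho>_step flip: scaleR_diff_left)
        then have "l1norm ((x + \<rho> (Suc j) *\<^sub>R u) - (x + \<rho> j *\<^sub>R u)) = (\<tau>2 - \<tau>1) * l1norm u / real N"
          using \<tau> by (simp add: l1norm_scaleR)
        also have "\<dots> \<le> r / 2" using N by (simp add: divide_simps mult.commute)
        finally show "l1norm ((x + \<rho> (Suc j) *\<^sub>R u) - (x + \<rho> j *\<^sub>R u)) \<le> r / 2" .
      qed (auto simp: w_def l1norm_lattice_floor l1norm_minus_commute[of "emb _"])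
      finally have "l1norm (z - (x + \<rho> j *\<^sub>R u)) \<le> r / 2 + 3 * ?d"
        using l1norm_triangle3[of z "x + \<rho> j *\<^sub>R u" "emb (w j)"] l1norm_lattice_floor[of "x + \<rho> j *\<^sub>R u"]
        by (simp add: w_def l1norm_minus_commute[of "emb _"])
      then have "l1norm (z - (x + \<rho> j *\<^sub>R u)) \<le> r" using r by linarith
      then show ?thesis using \<rho>_range[OF j] unfolding inner_tube_def by blast
    qed
    ultimately show "z \<in> inner_tube \<inter> cube n" by simp
  qed
  have "?T (emb (w 0)) (emb (w j)) \<le> ramp_nat a b slope (ipos (w j)) - ramp_nat a b slope (ipos (w 0))" if "j \<le> N" for j
    using that
  proof (induction j)
    case 0
    then show ?case using T_in_refl[OF ab' cfg' wc] by simp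
  next
    case (Suc j)
    then show ?case
      using chunk[of j] T_in_triangle[OF ab' cfg' wc[of 0] wc[of j] wc[of "Suc j"]] by simp
  qed
  from this[of N] have "?T (emb (w 0)) (emb (w N)) \<le> ramp a b slope (pos (emb (w N))) - ramp a b slope (pos (emb (w 0)))"
    by (simp add: pos_emb ramp_of_int[OF ramp_slope])
  also have "\<dots> \<le> slope * (pos (emb (w N)) - pos (emb (w 0))) + 2 * (b - a)"
    using ramp_approx[OF ramp_slope, of "pos (emb (w N))"] ramp_approx[OF ramp_slope, of "pos (emb (w 0))"]
    by (simp add: algebra_simps abs_le_iff)
  also have "pos (emb (w N)) - pos (emb (w 0)) \<le> (\<tau>2 - \<tau>1) * l1norm u + 2 * ?d"
  proof -
    have "\<bar>pos (x + \<rho> j *\<^sub>R u) - pos (emb (w j))\<bar> \<le> ?d" for j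
      unfolding pos_diff[symmetric] w_def by (rule order_trans[OF abs_pos_le l1norm_lattice_floor])
    moreover have "pos (x + \<rho> N *\<^sub>R u) - pos (x + \<rho> 0 *\<^sub>R u) = (\<tau>2 - \<tau>1) * l1norm u"
    proof -
      have "\<rho> N - \<rho> 0 = \<tau>2 - \<tau>1" using N(2) by (simp add: \<rho>_def)
      then show ?thesis by (simp add: pos_add pos_scaleR pos_u flip: left_diff_distrib)
    qed
    ultimately show ?thesis by (smt (verit))
  qed
  also have "slope * ((\<tau>2 - \<tau>1) * l1norm u + 2 * ?d) = (\<tau>2 - \<tau>1) * h u + slope * (2 * ?d)"
    using l1u by (simp add: slope_def field_simps)
  also have "slope * (2 * ?d) \<le> b * (2 * ?d)" using slope by (intro mult_right_mono) auto
  finally have mid: "?T (emb (w 0)) (emb (w N)) \<le> (\<tau>2 - \<tau>1) * h u + b * (2 * ?d) + 2 * (b - a)"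
    using slope ab by (simp add: mult_left_mono)
  have ends: "x + \<rho> 0 *\<^sub>R u = x + \<tau>1 *\<^sub>R u" "x + \<rho> N *\<^sub>R u = x + \<tau>2 *\<^sub>R u"
    using N by (simp_all add: \<rho>_def)
  have close: "?T (x + \<rho> j *\<^sub>R u) (emb (w j)) \<le> b * ?d" if "j \<le> N" for j
  proof -
    have "b * l1norm (x + \<rho> j *\<^sub>R u - emb (w j)) \<le> b * ?d"
      unfolding w_def using b0 by (intro mult_left_mono l1norm_lattice_floor)
    then show ?thesis using T_in_bounds[OF ab' cfg' pt[OF that] wc[OF that]] by linarith
  qed
  have "?T (x + \<rho> 0 *\<^sub>R u) (x + \<rho> N *\<^sub>R u) \<le> b * ?d + ?T (emb (w 0)) (emb (w N)) + b * ?d"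
    using close[of 0] close[of N] T_in_commute[OF ab' cfg' pt[of N] wc[of N]]
      T_in_triangle[OF ab' cfg' pt[of 0] wc[of 0] pt[of N]] T_in_triangle[OF ab' cfg' wc[of 0] wc[of N] pt[of N]]
    by simp
  then show ?thesis using mid ab unfolding ends by (simp add: algebra_simps)
qed

lemma T_along_axis:
  assumes t: "cfg a b t" and r: "6 * real CARD('n) \<le> r"
    and \<tau>: "0 \<le> \<tau>1" "\<tau>1 \<le> real n" "0 \<le> \<tau>2" "\<tau>2 \<le> real n"
  shows "T_in (override F wt t) b (cube n) (x + \<tau>1 *\<^sub>R u) (x + \<tau>2 *\<^sub>R u)
    \<le> h ((x + \<tau>1 *\<^sub>R u) - (x + \<tau>2 *\<^sub>R u)) + (4 * b * real CARD('n) + 2 * b)"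
proof -
  have "(x + \<tau>1 *\<^sub>R u) - (x + \<tau>2 *\<^sub>R u) = (\<tau>1 - \<tau>2) *\<^sub>R u" by (simp add: scaleR_diff_left)
  then have h: "h ((x + \<tau>1 *\<^sub>R u) - (x + \<tau>2 *\<^sub>R u)) = \<bar>\<tau>1 - \<tau>2\<bar> * h u" by (simp only: normsD(2)[OF h])
  have ab': "0 \<le> a" "a \<le> b" using ab by auto
  show ?thesis
  proof (cases "\<tau>1 \<le> \<tau>2")
    case True
    then show ?thesis using T_along_axis_ordered[OF t r \<tau>(1) True \<tau>(4)] unfolding h by simp
  next
    case False
    then show ?thesis
      using T_along_axis_ordered[OF t r \<tau>(3) _ \<tau>(2)] T_in_commute[OF ab' cfg_wt[OF t] seg[OF \<tau>(1,2)] seg[OF \<tau>(3,4)]]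
      unfolding h by simp
  qed
qed

text \<open>The walls of a highway could obstruct other routes. Between its first and last visits to
  the tube an old path takes at least h - \<epsilon>, and the highway offers a replacement at h plus
  a term of order R; so no passage time grows by more than that.\<close>

lemma T_upper:
  assumes t: "cfg a b t" and r: "6 * real CARD('n) \<le> r" and \<epsilon>: "0 \<le> \<epsilon>"
    and T: "\<And>p q. p \<in> cube n \<Longrightarrow> q \<in> cube n \<Longrightarrow> h (p - q) - \<epsilon> \<le> T_in t b (cube n) p q"
    and pq: "p \<in> cube n" "q \<in> cube n"
  shows "T_in (override F wt t) b (cube n) p q \<le> T_in t b (cube n) p q
    + (4 * b * (R + 1) + (4 * b * real CARD('n) + 2 * b) + \<epsilon>)"
proof -
  let ?T = "T_in (override F wt t) b (cube n)"
  let ?S = "T_in t b (cube n)"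
  let ?E = "4 * b * (R + 1) + (4 * b * real CARD('n) + 2 * b) + \<epsilon>"
  have ab': "0 \<le> a" "a \<le> b" using ab by auto
  note cfg' = cfg_wt[OF t]
  have E0: "0 \<le> ?E" using ab rR \<epsilon> by simp
  have near: "\<exists>\<tau>. 0 \<le> \<tau> \<and> \<tau> \<le> real n \<and> l1norm (z - (x + \<tau> *\<^sub>R u)) \<le> R + 1"
    if ez: "e \<in> F" "z \<in> points_of e" for e z
  proof -
    obtain y where y: "e \<in> edges" "y \<in> points_of e" "y \<in> outer_tube" using ez by (auto simp: F_def)
    then obtain \<tau> where \<tau>: "0 \<le> \<tau>" "\<tau> \<le> real n" "l1norm (y - (x + \<tau> *\<^sub>R u)) \<le> R" by (auto simp: outer_tube_def)
    have "l1norm (z - (x + \<tau> *\<^sub>R u)) \<le> R + 1"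
      using points_of_l1_diff[OF y(1) ez(2) y(2)] \<tau>(3) l1norm_triangle3[of z "x + \<tau> *\<^sub>R u" y] by linarith
    then show ?thesis using \<tau> by blast
  qed
  have both: "?T y z \<le> h (y - z) + (?E - \<epsilon>)"
    if yz: "y \<in> cube n" "z \<in> cube n" "e \<in> F" "y \<in> points_of e" "e' \<in> F" "z \<in> points_of e'" for y z e e'
  proof -
    obtain \<tau> where \<tau>: "0 \<le> \<tau>" "\<tau> \<le> real n" "l1norm (y - (x + \<tau> *\<^sub>R u)) \<le> R + 1" using near[OF yz(3,4)] by blast
    obtain \<tau>' where \<tau>': "0 \<le> \<tau>'" "\<tau>' \<le> real n" "l1norm (z - (x + \<tau>' *\<^sub>R u)) \<le> R + 1" using near[OF yz(5,6)] by blast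
    define y' z' where "y' = x + \<tau> *\<^sub>R u" and "z' = x + \<tau>' *\<^sub>R u"
    have c: "y' \<in> cube n" "z' \<in> cube n" using seg \<tau> \<tau>' by (auto simp: y'_def z'_def)
    have by': "b * l1norm (y - y') \<le> b * (R + 1)" "b * l1norm (z - z') \<le> b * (R + 1)"
      using \<tau> \<tau>' b0 by (auto simp: y'_def z'_def intro!: mult_left_mono)
    have T1: "?T y y' \<le> b * (R + 1)" using T_in_bounds[OF ab' cfg' yz(1) c(1)] by' by linarith
    have T2: "?T z' z \<le> b * (R + 1)" using T_in_bounds[OF ab' cfg' c(2) yz(2)] by' by (simp add: l1norm_minus_commute)
    have T3: "?T y' z' \<le> h (y' - z') + (4 * b * real CARD('n) + 2 * b)"
      unfolding y'_def z'_def by (rule T_along_axis[OF t r \<tau>(1,2) \<tau>'(1,2)])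
    have "h (y' - z') \<le> h (y' - y) + (h (y - z) + h (z - z'))"
      using norms_triangle3[OF h, of y' z' y] norms_triangle3[OF h, of y z' z] by linarith
    also have "h (y' - y) \<le> b * (R + 1)"
      using normsD(6)[OF h, of "y - y'"] by' norms_minus_commute[OF h, of y' y] by linarith
    also have "h (z - z') \<le> b * (R + 1)"
      using normsD(6)[OF h, of "z - z'"] by' by linarith
    finally have "h (y' - z') \<le> h (y - z) + 2 * (b * (R + 1))" by simp
    moreover have "?T y z \<le> ?T y y' + ?T y' z' + ?T z' z"
      using T_in_triangle[OF ab' cfg' yz(1) c(1) yz(2)] T_in_triangle[OF ab' cfg' c yz(2)] by linarith
    ultimately show ?thesis using T1 T2 T3 by (simp add: algebra_simps)
  qed
  have eq: "override F wt t e = t e" if "e \<notin> F" for e using that by (simp add: override_def)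
  \<comment> \<open>The cut at one end, for a target lying on F. Combined with symmetry of passage
    times it supplies the hypothesis for the cut at the other end.\<close>
  have stage1: "?T p z \<le> ?S p z + ?E" if p: "p \<in> cube n" and z: "z \<in> cube n" "e \<in> F" "z \<in> points_of e" for p z e
  proof (rule T_override_le[OF ab' t cfg' eq p z(1) E0])
    fix y e' assume y: "y \<in> cube n" "e' \<in> F" "y \<in> points_of e'"
    have "?T y z \<le> h (y - z) + (?E - \<epsilon>)" by (rule both[OF y(1) z(1) y(2,3) z(2,3)])
    then show "?T p z - ?E \<le> ?T p y + ?S y z"
      using T[OF y(1) z(1)] T_in_triangle[OF ab' cfg' p y(1) z(1)] by linarith
  qed blast
  show ?thesis
  proof (rule T_override_le[OF ab' t cfg' eq pq E0])
    fix z e assume z: "z \<in> cube n" "e \<in> F" "z \<in> points_of e"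
    show "?T p q - ?E \<le> ?T p z + ?S z q"
      using stage1[OF pq(2) z] T_in_triangle[OF ab' cfg' pq(1) z(1) pq(2)]
        T_in_commute[OF ab' cfg' z(1) pq(2)] T_in_commute[OF ab' t z(1) pq(2)] by linarith
  qed blast
qed

end

section \<open>From one highway to a network\<close>

definition above :: "(real ^ 'n::finite \<Rightarrow> real) \<Rightarrow> real \<Rightarrow> nat \<Rightarrow> real \<Rightarrow> ((int ^ 'n) set \<Rightarrow> real) \<Rightarrow> bool" where
  "above h b n \<epsilon> t \<longleftrightarrow> (\<forall>p\<in>cube n. \<forall>q\<in>cube n. h (p - q) - \<epsilon> * real n \<le> T_in t b (cube n) p q)"

lemma above_mono: "above h b n \<epsilon> t \<Longrightarrow> \<epsilon> \<le> \<epsilon>' \<Longrightarrow> above h b n \<epsilon>' t"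
  unfolding above_def by (meson diff_left_mono mult_right_mono of_nat_0_le_iff order_trans)

lemma override_empty [simp]: "override {} s t = t"
  by (simp add: override_def)

lemma override_override:
  "override F2 s2 (override F1 s1 t) = override (F1 \<union> F2) (\<lambda>e. if e \<in> F2 then s2 e else s1 e) t"
  by (auto simp: override_def)

lemma eventually_le_real: "\<forall>\<^sub>F n in sequentially. c \<le> real n"
  by (rule eventually_mono[OF eventually_ge_at_top[of "nat \<lceil>c\<rceil>"]]) linarith

text \<open>F and s are chosen before t, as \<open>resample\<close> requires one pattern for all
  configurations. The last conclusion keeps highways built earlier usable, and the control of
  \<open>above\<close> allows the construction to be iterated.\<close>

lemma single_highway:
  fixes h :: "real ^ 'n::finite \<Rightarrow> real"
  assumes d2: "CARD('n) \<ge> 2" and ab: "0 < a" "a < b" and h: "h \<in> norms a b"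
    and xy: "x \<in> unit_cube" "y \<in> unit_cube" and \<epsilon>: "0 < \<epsilon>" and \<eta>: "0 < \<eta>"
  shows "\<exists>\<epsilon>'>0. \<forall>\<^sub>F n in sequentially. \<exists>F s. finite F \<and> F \<subseteq> edges \<and> real (card F) \<le> \<eta> * real n ^ CARD('n)
    \<and> (\<forall>e. s e \<in> {a, b}) \<and> (\<forall>t. cfg a b t \<longrightarrow> above h b n \<epsilon>' t \<longrightarrow> above h b n \<epsilon> (override F s t)
      \<and> T_in (override F s t) b (cube n) (real n *\<^sub>R x) (real n *\<^sub>R y) \<le> real n * h (x - y) + \<epsilon> * real n
      \<and> (\<forall>p\<in>cube n. \<forall>q\<in>cube n. T_in (override F s t) b (cube n) p q \<le> T_in t b (cube n) p q + \<epsilon> * real n))"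
    (is "\<exists>\<epsilon>'>0. eventually (?Q \<epsilon>') _")
proof (cases "x = y")
  case True
  \<comment> \<open>There is no direction to build along, and nothing has to be changed.\<close>
  show ?thesis
  proof (intro exI[of _ \<epsilon>] conjI always_eventually allI exI[of _ "{}"] exI[of _ "\<lambda>_. a"] impI)
    fix n and t :: "(int ^ 'n) set \<Rightarrow> real" assume t: "cfg a b t" "above h b n \<epsilon> t"
    show "T_in (override {} (\<lambda>_. a) t) b (cube n) (real n *\<^sub>R x) (real n *\<^sub>R y) \<le> real n * h (x - y) + \<epsilon> * real n"
      using T_in_refl[OF _ _ t(1) scaleR_in_cube[OF xy(2)]] True normsD(1)[OF h, of 0] \<epsilon> ab by simp
  qed (use \<epsilon> \<eta> in auto)
next
  case False
  define d where "d = real CARD('n)"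
  define u where "u = y - x"
  have d: "2 \<le> d" using d2 by (simp add: d_def)
  have b: "0 < b" using ab by simp
  \<comment> \<open>On the cube h is at most b d n, so shrinking it by 1 - \<theta> loses at most
    \<epsilon> n / 4.\<close>
  define \<theta> where "\<theta> = min 1 (\<epsilon> / (4 * b * d))"
  have \<theta>: "0 < \<theta>" "\<theta> \<le> 1" "\<theta> * b * d \<le> \<epsilon> / 4"
    using \<epsilon> b d by (auto simp: \<theta>_def min_def field_simps)
  define c0 where "c0 = 3 * d * 7 ^ CARD('n)"
  have c0: "0 < c0" using d by (simp add: c0_def)
  \<comment> \<open>The radius of the outer tube is \<delta> n. The bound by \<eta> / c0 limits the
    number of edges, with c0 from \<open>card_edges_near_segment\<close>; the bound by \<epsilon> /
    (16 b) keeps the detour term 4 b \<delta> n below \<epsilon> n / 4.\<close>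
  define \<delta> where "\<delta> = min 1 (min (\<eta> / c0) (\<epsilon> / (16 * b)))"
  have \<delta>: "0 < \<delta>" "\<delta> \<le> 1" "c0 * \<delta> \<le> \<eta>" "b * \<delta> \<le> \<epsilon> / 16"
  proof -
    have "\<delta> \<le> \<eta> / c0" "\<delta> \<le> \<epsilon> / (16 * b)" by (simp_all add: \<delta>_def)
    then show "c0 * \<delta> \<le> \<eta>" "b * \<delta> \<le> \<epsilon> / 16" using b c0 by (simp_all add: field_simps)
  qed (use \<epsilon> \<eta> b c0 in \<open>auto simp: \<delta>_def\<close>)
  define \<rho> where "\<rho> = \<theta> * \<delta> / 16"
  have \<rho>: "0 < \<rho>" "\<rho> < \<delta>" using \<theta> \<delta> by (auto simp: \<rho>_def)
  define \<epsilon>' where "\<epsilon>' = min (\<epsilon> / 4) (\<theta> * b * \<delta> / 16)"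
  have \<epsilon>': "0 < \<epsilon>'" "\<epsilon>' \<le> \<epsilon> / 4" "\<epsilon>' \<le> \<theta> * b * \<delta> / 16" using \<epsilon> \<theta> \<delta> b by (auto simp: \<epsilon>'_def)
  have ui: "\<bar>u $ i\<bar> \<le> 1" for i
  proof -
    have "0 \<le> x $ i" "x $ i \<le> 1" "0 \<le> y $ i" "y $ i \<le> 1" using xy by (auto simp: unit_cube_def)
    then show ?thesis by (simp add: u_def)
  qed
  have "\<forall>\<^sub>F n in sequentially. 1 / \<delta> \<le> real n \<and> 16 / (\<theta> * \<delta>) \<le> real n \<and> 6 * d / \<rho> \<le> real n
      \<and> 4 * (6 * b + 4 * b * d) / \<epsilon> \<le> real n"
    by (intro eventually_conj eventually_le_real)
  then show ?thesis
  proof (intro exI[of _ \<epsilon>'] conjI \<epsilon>'(1), elim eventually_mono)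
    fix n assume n: "1 / \<delta> \<le> real n \<and> 16 / (\<theta> * \<delta>) \<le> real n \<and> 6 * d / \<rho> \<le> real n
      \<and> 4 * (6 * b + 4 * b * d) / \<epsilon> \<le> real n"
    have n1: "1 \<le> \<delta> * real n" and n2: "16 \<le> \<theta> * \<delta> * real n" and n3: "6 * d \<le> \<rho> * real n"
      and n4: "4 * (6 * b + 4 * b * d) \<le> \<epsilon> * real n"
      using n \<delta> \<theta> \<rho> \<epsilon> by (auto simp: field_simps)
    have n0: "0 < real n" using n1 \<delta> by (cases "n = 0") auto
    interpret tube a b h n "real n *\<^sub>R x" u "\<rho> * real n" "\<delta> * real n"
    proof
      fix \<tau> assume \<tau>: "0 \<le> \<tau>" "\<tau> \<le> real n"
      have "real n *\<^sub>R x + (\<tau> / real n) *\<^sub>R (real n *\<^sub>R y - real n *\<^sub>R x) \<in> cube n"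
        using \<tau> n0 by (intro cube_convex scaleR_in_cube xy) auto
      then show "real n *\<^sub>R x + \<tau> *\<^sub>R u \<in> cube n"
        using n0 by (simp add: u_def flip: scaleR_diff_right)
    qed (use ab h False \<rho> n0 in \<open>auto simp: u_def\<close>)
    let ?P = "{e\<in>edges. \<exists>z\<in>points_of e. \<exists>\<tau>. 0 \<le> \<tau> \<and> \<tau> \<le> real n \<and> l1norm (z - (real n *\<^sub>R x + \<tau> *\<^sub>R u)) \<le> \<delta> * real n}"
    have FP: "F \<subseteq> ?P" unfolding F_def outer_tube_def by blast
    have P: "finite ?P" "real (card ?P) \<le> c0 * \<delta> * real n ^ CARD('n)"
      using card_edges_near_segment[OF d2 ui \<delta>(1,2) n1, of "real n *\<^sub>R x"] by (simp_all add: c0_def d_def)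
    have "real (card F) \<le> real (card ?P)" using card_mono[OF P(1) FP] by simp
    also have "\<dots> \<le> \<eta> * real n ^ CARD('n)"
      using P(2) mult_right_mono[OF \<delta>(3), of "real n ^ CARD('n)"] by simp
    finally have card: "real (card F) \<le> \<eta> * real n ^ CARD('n)" .
    \<comment> \<open>In units of \<theta> b \<delta> n the terms b, 2 b \<rho> n and \<epsilon>' n
      take at most 1/16, 1/8 and 1/16, which add up to H. The insulation offers at least 15/16, more
      than the 7/16 that H plus the tube error requires.\<close>
    define H where "H = \<theta> * b * \<delta> * real n / 4"
    have b16: "16 * b \<le> \<theta> * b * \<delta> * real n" using mult_left_mono[OF n2, of b] b by (simp add: mult_ac)
    have br: "2 * b * (\<rho> * real n) = \<theta> * b * \<delta> * real n / 8" by (simp add: \<rho>_def)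
    have \<epsilon>'n: "\<epsilon>' * real n \<le> \<theta> * b * \<delta> * real n / 16" "\<epsilon>' * real n \<le> \<epsilon> * real n / 4" "0 \<le> \<epsilon>' * real n"
      using mult_right_mono[OF \<epsilon>'(3), of "real n"] mult_right_mono[OF \<epsilon>'(2), of "real n"] \<epsilon>'(1) by auto
    have H1: "b + 2 * b * (\<rho> * real n) + \<epsilon>' * real n \<le> H" using b16 br \<epsilon>'n unfolding H_def by linarith
    have "\<theta> * b * (\<rho> * real n) \<le> b * (\<rho> * real n)" using \<theta> b \<rho> by (simp add: mult_left_le_one_le)
    moreover have "0 \<le> \<theta> * (b * (\<delta> * real n))" using \<theta> b \<delta> by simp
    ultimately have H2: "H + (b + 2 * b * (\<rho> * real n)) \<le> \<theta> * b * (\<delta> * real n - \<rho> * real n)"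
      using b16 br unfolding H_def right_diff_distrib mult.assoc[of \<theta> b "\<delta> * real n", symmetric] mult.assoc[of \<theta> b "\<rho> * real n", symmetric]
    by (simp only: mult.assoc)
    have "\<theta> * (b * \<delta>) \<le> 1 * (\<epsilon> / 16)" using \<theta> \<delta> b by (intro mult_mono) auto
    then have "\<theta> * (b * \<delta>) * real n \<le> \<epsilon> / 16 * real n" by (intro mult_right_mono) auto
    moreover have "0 \<le> \<epsilon> * real n" using \<epsilon> by simp
    ultimately have H3: "2 * H \<le> \<epsilon> * real n / 4" using \<epsilon> n0 unfolding H_def by (simp only: mult.assoc)
    have E: "4 * b * (\<delta> * real n + 1) + (4 * b * real CARD('n) + 2 * b) + \<epsilon>' * real n \<le> \<epsilon> * real n"
      using n4 \<epsilon>'n mult_right_mono[OF \<delta>(4), of "real n"] by (simp add: d_def algebra_simps)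
    have axis: "4 * b * real CARD('n) + 2 * b \<le> \<epsilon> * real n"
    proof -
      define \<beta> where "\<beta> = b * d"
      have "0 \<le> \<beta>" "24 * b + 16 * \<beta> \<le> \<epsilon> * real n" using n4 b d by (simp_all add: \<beta>_def algebra_simps)
      then have "4 * \<beta> + 2 * b \<le> \<epsilon> * real n" using b by linarith
      then show ?thesis by (simp add: \<beta>_def d_def mult.assoc)
    qed
    show "?Q \<epsilon>' n"
    proof (intro exI[of _ F] exI[of _ wt] conjI card allI impI)
      show "finite F" using finite_subset[OF FP P(1)] .
      show "F \<subseteq> edges" by (auto simp: F_def)
      show "wt e \<in> {a, b}" for e by (rule wt_cases)
      fix t :: "(int ^ 'n) set \<Rightarrow> real" assume t: "cfg a b t" "above h b n \<epsilon>' t"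
      have T: "h (p - q) - \<epsilon>' * real n \<le> T_in t b (cube n) p q" if "p \<in> cube n" "q \<in> cube n" for p q
        using t(2) that by (auto simp: above_def)
      show "above h b n \<epsilon> (override F wt t)"
        unfolding above_def
      proof (intro ballI)
        fix p q :: "real ^ 'n" assume pq: "p \<in> cube n" "q \<in> cube n"
        have "b * l1norm (p - q) \<le> b * (d * real n)"
          unfolding d_def using b by (intro mult_left_mono l1norm_cube_diff_le pq) auto
        then have "h (p - q) \<le> b * (d * real n)" using normsD(6)[OF h, of "p - q"] by linarith
        then have "\<theta> * h (p - q) \<le> \<theta> * (b * (d * real n))" using \<theta> by (intro mult_left_mono) auto
        also have "\<dots> \<le> \<epsilon> / 4 * real n" using mult_right_mono[OF \<theta>(3), of "real n"] by (simp add: mult_ac)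
        finally have *: "\<theta> * h (p - q) \<le> \<epsilon> / 4 * real n" .
        show "h (p - q) - \<epsilon> * real n \<le> T_in (override F wt t) b (cube n) p q"
        proof -
          define \<beta> where "\<beta> = \<epsilon> * real n"
          have "0 \<le> \<beta>" using \<epsilon> by (simp add: \<beta>_def)
          moreover have "\<theta> * h (p - q) \<le> \<beta> / 4" "2 * H \<le> \<beta> / 4" using * H3 by (simp_all add: \<beta>_def)
          moreover have "h (p - q) - \<theta> * h (p - q) - 2 * H \<le> T_in (override F wt t) b (cube n) p q"
            using T_lower[OF t(1) T \<theta>(1,2) \<epsilon>'n(3) H1 H2 pq] by (simp add: left_diff_distrib)
          ultimately show ?thesis unfolding \<beta>_def[symmetric] by linarith
        qed
      qed
      show "T_in (override F wt t) b (cube n) (real n *\<^sub>R x) (real n *\<^sub>R y) \<le> real n * h (x - y) + \<epsilon> * real n"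
      proof -
        have "real n *\<^sub>R x + real n *\<^sub>R u = real n *\<^sub>R y" "real n *\<^sub>R x - real n *\<^sub>R y = real n *\<^sub>R (x - y)"
          by (simp_all add: u_def algebra_simps)
        moreover have "6 * real CARD('n) \<le> \<rho> * real n" using n3 by (simp add: d_def)
        note T_along_axis[OF t(1) this, of 0 "real n"]
        ultimately show ?thesis using axis by (simp add: normsD(2)[OF h])
      qed
      show "\<forall>p\<in>cube n. \<forall>q\<in>cube n. T_in (override F wt t) b (cube n) p q \<le> T_in t b (cube n) p q + \<epsilon> * real n"
      proof (intro ballI)
        fix p q :: "real ^ 'n" assume pq: "p \<in> cube n" "q \<in> cube n"
        have "6 * real CARD('n) \<le> \<rho> * real n" using n3 by (simp add: d_def)
        from T_upper[OF t(1) this \<epsilon>'n(3) T pq] E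
        show "T_in (override F wt t) b (cube n) p q \<le> T_in t b (cube n) p q + \<epsilon> * real n" by linarith
      qed
    qed
  qed
qed

text \<open>Tolerances are chosen backwards: the highway for z is built last, and those for Z are
  built with an output tolerance below what it accepts. It then adds at most \<epsilon> n / 2 to the
  passage times already achieved.\<close>

lemma many_highways:
  fixes h :: "real ^ 'n::finite \<Rightarrow> real"
  assumes d2: "CARD('n) \<ge> 2" and ab: "0 < a" "a < b" and h: "h \<in> norms a b"
    and Z: "finite Z" "Z \<subseteq> unit_cube \<times> unit_cube" and "0 < \<epsilon>" "0 < \<eta>"
  shows "\<exists>\<epsilon>'>0. \<forall>\<^sub>F n in sequentially. \<exists>F s. finite F \<and> F \<subseteq> edges \<and> real (card F) \<le> \<eta> * real n ^ CARD('n)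
    \<and> (\<forall>e. s e \<in> {a, b}) \<and> (\<forall>t. cfg a b t \<longrightarrow> above h b n \<epsilon>' t \<longrightarrow> above h b n \<epsilon> (override F s t)
      \<and> (\<forall>(x, y)\<in>Z. T_in (override F s t) b (cube n) (real n *\<^sub>R x) (real n *\<^sub>R y) \<le> real n * h (x - y) + \<epsilon> * real n))"
  using Z assms(7,8)
proof (induction Z arbitrary: \<epsilon> \<eta> rule: finite_induct)
  case empty
  then show ?case
    by (intro exI[of _ \<epsilon>] conjI always_eventually allI exI[of _ "{}"] exI[of _ "\<lambda>_. a"]) auto
next
  case (insert z Z)
  obtain x y where z: "z = (x, y)" "x \<in> unit_cube" "y \<in> unit_cube" using insert.prems by (cases z) auto
  obtain \<epsilon>1 where \<epsilon>1: "0 < \<epsilon>1" and ev1: "\<forall>\<^sub>F n in sequentially. \<exists>F s. finite F \<and> F \<subseteq> edges \<and> real (card F) \<le> (\<eta> / 2) * real n ^ CARD('n)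
    \<and> (\<forall>e. s e \<in> {a, b}) \<and> (\<forall>t. cfg a b t \<longrightarrow> above h b n \<epsilon>1 t \<longrightarrow> above h b n (\<epsilon> / 2) (override F s t)
      \<and> T_in (override F s t) b (cube n) (real n *\<^sub>R x) (real n *\<^sub>R y) \<le> real n * h (x - y) + (\<epsilon> / 2) * real n
      \<and> (\<forall>p\<in>cube n. \<forall>q\<in>cube n. T_in (override F s t) b (cube n) p q \<le> T_in t b (cube n) p q + (\<epsilon> / 2) * real n))"
    using single_highway[OF d2 ab h z(2,3), of "\<epsilon> / 2" "\<eta> / 2"] insert.prems by auto
  obtain \<epsilon>2 where \<epsilon>2: "0 < \<epsilon>2" and ev2: "\<forall>\<^sub>F n in sequentially. \<exists>F s. finite F \<and> F \<subseteq> edges \<and> real (card F) \<le> (\<eta> / 2) * real n ^ CARD('n)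
    \<and> (\<forall>e. s e \<in> {a, b}) \<and> (\<forall>t. cfg a b t \<longrightarrow> above h b n \<epsilon>2 t \<longrightarrow> above h b n (min \<epsilon>1 (\<epsilon> / 2)) (override F s t)
      \<and> (\<forall>(x, y)\<in>Z. T_in (override F s t) b (cube n) (real n *\<^sub>R x) (real n *\<^sub>R y) \<le> real n * h (x - y) + (min \<epsilon>1 (\<epsilon> / 2)) * real n))"
    using insert.IH[of "min \<epsilon>1 (\<epsilon> / 2)" "\<eta> / 2"] insert.prems \<epsilon>1 by auto
  show ?case
  proof (intro exI[of _ \<epsilon>2] conjI \<epsilon>2, rule eventually_mono[OF eventually_conj[OF ev1 ev2]], elim conjE exE)
    fix n F1 s1 F2 s2
    assume F1: "finite F1" "F1 \<subseteq> edges" "real (card F1) \<le> (\<eta> / 2) * real n ^ CARD('n)" "\<forall>e. s1 e \<in> {a, b}"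
      and t1: "\<forall>t. cfg a b t \<longrightarrow> above h b n \<epsilon>1 t \<longrightarrow> above h b n (\<epsilon> / 2) (override F1 s1 t)
      \<and> T_in (override F1 s1 t) b (cube n) (real n *\<^sub>R x) (real n *\<^sub>R y) \<le> real n * h (x - y) + (\<epsilon> / 2) * real n
      \<and> (\<forall>p\<in>cube n. \<forall>q\<in>cube n. T_in (override F1 s1 t) b (cube n) p q \<le> T_in t b (cube n) p q + (\<epsilon> / 2) * real n)"
      and F2: "finite F2" "F2 \<subseteq> edges" "real (card F2) \<le> (\<eta> / 2) * real n ^ CARD('n)" "\<forall>e. s2 e \<in> {a, b}"
      and t2: "\<forall>t. cfg a b t \<longrightarrow> above h b n \<epsilon>2 t \<longrightarrow> above h b n (min \<epsilon>1 (\<epsilon> / 2)) (override F2 s2 t)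
      \<and> (\<forall>(x, y)\<in>Z. T_in (override F2 s2 t) b (cube n) (real n *\<^sub>R x) (real n *\<^sub>R y) \<le> real n * h (x - y) + (min \<epsilon>1 (\<epsilon> / 2)) * real n)"
    \<comment> \<open>Where two highways overlap, the one built last prevails.\<close>
    let ?s = "\<lambda>e. if e \<in> F1 then s1 e else s2 e"
    have card: "real (card (F2 \<union> F1)) \<le> \<eta> * real n ^ CARD('n)"
      using card_Un_le[of F2 F1] F1(3) F2(3) by simp
    show "\<exists>F s. finite F \<and> F \<subseteq> edges \<and> real (card F) \<le> \<eta> * real n ^ CARD('n)
    \<and> (\<forall>e. s e \<in> {a, b}) \<and> (\<forall>t. cfg a b t \<longrightarrow> above h b n \<epsilon>2 t \<longrightarrow> above h b n \<epsilon> (override F s t)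
      \<and> (\<forall>(x, y)\<in>insert z Z. T_in (override F s t) b (cube n) (real n *\<^sub>R x) (real n *\<^sub>R y) \<le> real n * h (x - y) + \<epsilon> * real n))"
    proof (intro exI[of _ "F2 \<union> F1"] exI[of _ ?s] conjI card allI impI)
      fix t :: "(int ^ 'n) set \<Rightarrow> real" assume t: "cfg a b t" "above h b n \<epsilon>2 t"
      let ?t = "override F2 s2 t"
      have eq: "override (F2 \<union> F1) ?s t = override F1 s1 ?t" by (simp add: override_override)
      have "a \<le> s2 e \<and> s2 e \<le> b" for e using F2(4)[rule_format, of e] ab by auto
      then have c: "cfg a b ?t" using cfg_override[OF t(1)] by blast
      have ab2: "above h b n \<epsilon>1 ?t" using t2 t by (blast intro: above_mono min.cobounded1)
      note t1' = t1[rule_format, OF c ab2]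
      show "above h b n \<epsilon> (override (F2 \<union> F1) ?s t)"
        unfolding eq using t1' insert.prems by (auto elim: above_mono)
      show "\<forall>(x, y)\<in>insert z Z. T_in (override (F2 \<union> F1) ?s t) b (cube n) (real n *\<^sub>R x) (real n *\<^sub>R y) \<le> real n * h (x - y) + \<epsilon> * real n"
      proof (rule ballI, rule case_prodI2)
        fix zz p q assume zz: "zz \<in> insert z Z" "zz = (p, q)"
        then have pqz: "(p, q) \<in> insert z Z" by simp
        show "T_in (override (F2 \<union> F1) ?s t) b (cube n) (real n *\<^sub>R p) (real n *\<^sub>R q) \<le> real n * h (p - q) + \<epsilon> * real n"
        proof (cases "(p, q) = z")
          case True
          have "0 \<le> \<epsilon> * real n" using insert.prems by simp
          then show ?thesis unfolding eq using t1' True z by simp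
        next
          case False
          then have pq: "(p, q) \<in> Z" using pqz by simp
          then have cu: "real n *\<^sub>R p \<in> cube n" "real n *\<^sub>R q \<in> cube n"
            using insert.prems by (auto intro!: scaleR_in_cube)
          have "T_in ?t b (cube n) (real n *\<^sub>R p) (real n *\<^sub>R q) \<le> real n * h (p - q) + min \<epsilon>1 (\<epsilon> / 2) * real n"
            using t2 t pq by fastforce
          also have "min \<epsilon>1 (\<epsilon> / 2) * real n \<le> (\<epsilon> / 2) * real n" by (intro mult_right_mono) auto
          finally show ?thesis unfolding eq using t1' cu by fastforce
        qed
      qed
    qed (use F1 F2 in auto)
  qed
qed

lemma finite_net:
  assumes "0 < \<kappa>"
  obtains Z :: "(real ^ 'n::finite) set" where "finite Z" "Z \<subseteq> unit_cube" "\<And>x. x \<in> unit_cube \<Longrightarrow> \<exists>z\<in>Z. l1norm (x - z) \<le> \<kappa>"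
proof -
  obtain N0 :: nat where N0: "real CARD('n) / \<kappa> < real N0" using reals_Archimedean2 by blast
  define N where "N = Suc N0"
  have N: "real CARD('n) \<le> \<kappa> * real N" "0 < real N" using N0 assms by (auto simp: N_def field_simps)
  define Z where "Z = (\<lambda>v::int ^ 'n. (1 / real N) *\<^sub>R emb v) ` {v. \<forall>i. v $ i \<in> {0..int N}}"
  show thesis
  proof
    show "finite Z" unfolding Z_def by (intro finite_imageI finite_lattice_box) simp
    have "real_of_int k / real N \<le> 1" if "k \<le> int N" for k using that N by (simp add: divide_le_eq_1)
    then show "Z \<subseteq> unit_cube" by (auto simp: Z_def unit_cube_def)
    fix x :: "real ^ 'n" assume x: "x \<in> unit_cube"
    let ?v = "lattice_floor (real N *\<^sub>R x)"
    have ev: "emb ?v \<in> cube N" by (intro lattice_floor_in_cube scaleR_in_cube x)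
    have "?v $ i \<in> {0..int N}" for i
    proof -
      have "0 \<le> real_of_int (?v $ i)" "real_of_int (?v $ i) \<le> real_of_int (int N)"
        using ev unfolding cube_def by auto
      then show ?thesis unfolding of_int_le_iff by simp
    qed
    then have 1: "(1 / real N) *\<^sub>R emb ?v \<in> Z" by (auto simp: Z_def)
    have "x - (1 / real N) *\<^sub>R emb ?v = (1 / real N) *\<^sub>R (real N *\<^sub>R x - emb ?v)"
      using N by (simp add: scaleR_diff_right)
    then have "l1norm (x - (1 / real N) *\<^sub>R emb ?v) \<le> (1 / real N) * real CARD('n)"
      using l1norm_lattice_floor[of "real N *\<^sub>R x"] N by (simp add: l1norm_scaleR divide_right_mono)
    also have "\<dots> \<le> \<kappa>" using N by (simp add: field_simps)
    finally show "\<exists>z\<in>Z. l1norm (x - z) \<le> \<kappa>" using 1 by blast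
  qed
qed

lemma highway_network:
  fixes h :: "real ^ 'n::finite \<Rightarrow> real"
  assumes d2: "CARD('n) \<ge> 2" and ab: "0 < a" "a < b" and h: "h \<in> norms a b" and \<epsilon>: "0 < \<epsilon>" and \<eta>: "0 < \<eta>"
  shows "\<exists>\<epsilon>'>0. \<forall>\<^sub>F n in sequentially. \<exists>F s. finite F \<and> F \<subseteq> edges \<and> real (card F) \<le> \<eta> * real n ^ CARD('n)
    \<and> (\<forall>e. s e \<in> {a, b}) \<and> (\<forall>t. cfg a b t \<longrightarrow> above h b n \<epsilon>' t \<longrightarrow>
      (\<forall>p\<in>cube n. \<forall>q\<in>cube n. \<bar>T_in (override F s t) b (cube n) p q - h (p - q)\<bar> \<le> \<epsilon> * real n))"
proof -
  have b: "0 < b" using ab by simp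
  \<comment> \<open>Moving both endpoints to the net changes the passage time and \<open>h\<close>
    by at most 2 b \<kappa> n = \<epsilon> n / 4 each; the highways themselves are allowed
    \<epsilon> n / 2.\<close>
  define \<kappa> where "\<kappa> = \<epsilon> / (8 * b)"
  have \<kappa>: "0 < \<kappa>" "b * \<kappa> = \<epsilon> / 8" using b \<epsilon> by (auto simp: \<kappa>_def)
  obtain Z :: "(real ^ 'n) set" where Z: "finite Z" "Z \<subseteq> unit_cube" "\<And>x. x \<in> unit_cube \<Longrightarrow> \<exists>z\<in>Z. l1norm (x - z) \<le> \<kappa>"
    using finite_net[OF \<kappa>(1)] by metis
  have e2: "0 < \<epsilon> / 2" using \<epsilon> by simp
  have ZZ: "finite (Z \<times> Z)" "Z \<times> Z \<subseteq> unit_cube \<times> unit_cube" using Z by auto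
  obtain \<epsilon>' where \<epsilon>': "0 < \<epsilon>'" and ev: "\<forall>\<^sub>F n in sequentially. \<exists>F s. finite F \<and> F \<subseteq> edges \<and> real (card F) \<le> \<eta> * real n ^ CARD('n)
    \<and> (\<forall>e. s e \<in> {a, b}) \<and> (\<forall>t. cfg a b t \<longrightarrow> above h b n \<epsilon>' t \<longrightarrow> above h b n (\<epsilon> / 2) (override F s t)
      \<and> (\<forall>(x, y)\<in>Z \<times> Z. T_in (override F s t) b (cube n) (real n *\<^sub>R x) (real n *\<^sub>R y) \<le> real n * h (x - y) + (\<epsilon> / 2) * real n))"
    using many_highways[OF d2 ab h ZZ e2 \<eta>] by blast
  have close: "\<bar>T_in (override F s t) b (cube n) p q - h (p - q)\<bar> \<le> \<epsilon> * real n"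
    if n: "0 < n" and s: "\<forall>e. s e \<in> {a, b}" and t: "cfg a b t"
      and ab2: "above h b n (\<epsilon> / 2) (override F s t)"
      and T: "\<forall>(x, y)\<in>Z \<times> Z. T_in (override F s t) b (cube n) (real n *\<^sub>R x) (real n *\<^sub>R y) \<le> real n * h (x - y) + (\<epsilon> / 2) * real n"
      and pq: "p \<in> cube n" "q \<in> cube n" for n F s t p q
  proof -
    have "a \<le> s e \<and> s e \<le> b" for e using s[rule_format, of e] ab by auto
    then have c: "cfg a b (override F s t)" by (intro cfg_override[OF t])
    have near: "\<exists>z\<in>Z. l1norm (p - real n *\<^sub>R z) \<le> real n * \<kappa>" if pc: "p \<in> cube n" for p
    proof -
      obtain x where x: "x \<in> unit_cube" "p = real n *\<^sub>R x" using pc unfolding scaled_unit_cube[OF n, symmetric] by blast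
      obtain z where z: "z \<in> Z" "l1norm (x - z) \<le> \<kappa>" using Z(3)[OF x(1)] by blast
      have "p - real n *\<^sub>R z = real n *\<^sub>R (x - z)" by (simp add: x scaleR_diff_right)
      then show ?thesis using z by (auto simp: l1norm_scaleR intro!: bexI[of _ z] mult_left_mono)
    qed
    obtain z where z: "z \<in> Z" "l1norm (p - real n *\<^sub>R z) \<le> real n * \<kappa>" using near[OF pq(1)] by blast
    obtain w where w: "w \<in> Z" "l1norm (q - real n *\<^sub>R w) \<le> real n * \<kappa>" using near[OF pq(2)] by blast
    have zw: "real n *\<^sub>R z \<in> cube n" "real n *\<^sub>R w \<in> cube n" using z w Z(2) by (auto intro!: scaleR_in_cube)
    have bz: "b * l1norm (p - real n *\<^sub>R z) \<le> \<epsilon> / 8 * real n" "b * l1norm (q - real n *\<^sub>R w) \<le> \<epsilon> / 8 * real n"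
      using mult_left_mono[OF z(2), of b] mult_left_mono[OF w(2), of b] b \<kappa>(2) by (auto simp: algebra_simps)
    have "\<bar>T_in (override F s t) b (cube n) p q - T_in (override F s t) b (cube n) (real n *\<^sub>R z) (real n *\<^sub>R w)\<bar>
        \<le> b * (l1norm (p - real n *\<^sub>R z) + l1norm (q - real n *\<^sub>R w))"
      using ab by (intro T_in_diff_le[OF _ _ c pq zw]) auto
    moreover have "T_in (override F s t) b (cube n) (real n *\<^sub>R z) (real n *\<^sub>R w) \<le> real n * h (z - w) + (\<epsilon> / 2) * real n"
      using T z w by fastforce
    moreover have "real n * h (z - w) = h (real n *\<^sub>R z - real n *\<^sub>R w)"
      by (simp add: normsD(2)[OF h] flip: scaleR_diff_right)
    moreover have "h (real n *\<^sub>R z - real n *\<^sub>R w) \<le> h (real n *\<^sub>R z - p) + (h (p - q) + h (q - real n *\<^sub>R w))"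
      using norms_triangle3[OF h, of "real n *\<^sub>R z" "real n *\<^sub>R w" p] norms_triangle3[OF h, of p "real n *\<^sub>R w" q] by linarith
    moreover have "h (real n *\<^sub>R z - p) \<le> b * l1norm (p - real n *\<^sub>R z)" "h (q - real n *\<^sub>R w) \<le> b * l1norm (q - real n *\<^sub>R w)"
      using normsD(6)[OF h] by (auto simp: norms_minus_commute[OF h, of _ p])
    ultimately have "T_in (override F s t) b (cube n) p q \<le> h (p - q) + \<epsilon> * real n"
      using bz by (simp add: distrib_left)
    moreover have "h (p - q) - \<epsilon> / 2 * real n \<le> T_in (override F s t) b (cube n) p q"
      using ab2 pq by (auto simp: above_def)
    moreover have "0 \<le> \<epsilon> * real n" using \<epsilon> by simp
    ultimately show ?thesis by (simp add: abs_le_iff)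
  qed
  show ?thesis
  proof (intro exI[of _ \<epsilon>'] conjI \<epsilon>', rule eventually_mono[OF eventually_conj[OF ev eventually_gt_at_top[of 0]]], elim conjE exE)
    fix n F s
    assume n: "0 < n" and F: "finite F" "F \<subseteq> edges" "real (card F) \<le> \<eta> * real n ^ CARD('n)" and s: "\<forall>e. s e \<in> {a, b}"
      and t: "\<forall>t. cfg a b t \<longrightarrow> above h b n \<epsilon>' t \<longrightarrow> above h b n (\<epsilon> / 2) (override F s t)
      \<and> (\<forall>(x, y)\<in>Z \<times> Z. T_in (override F s t) b (cube n) (real n *\<^sub>R x) (real n *\<^sub>R y) \<le> real n * h (x - y) + (\<epsilon> / 2) * real n)"
    show "\<exists>F s. finite F \<and> F \<subseteq> edges \<and> real (card F) \<le> \<eta> * real n ^ CARD('n)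
    \<and> (\<forall>e. s e \<in> {a, b}) \<and> (\<forall>t. cfg a b t \<longrightarrow> above h b n \<epsilon>' t \<longrightarrow>
      (\<forall>p\<in>cube n. \<forall>q\<in>cube n. \<bar>T_in (override F s t) b (cube n) p q - h (p - q)\<bar> \<le> \<epsilon> * real n))"
      using t by (intro exI[of _ F] exI[of _ s] conjI F s) (blast intro: close[OF n s])
  qed
qed

section \<open>Raising the metric by slabs of slow edges\<close>

text \<open>The signed length of the part of [0, s] covered by the intervals [p k, p k + q]. Its
  slope is one on these intervals and zero between them, so its mean slope is q / p.\<close>

definition ladder :: "real \<Rightarrow> real \<Rightarrow> real \<Rightarrow> real" where
  "ladder p q s = q * of_int \<lfloor>s / p\<rfloor> + min q (s - p * of_int \<lfloor>s / p\<rfloor>)"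

context
  fixes p q :: real
  assumes pq: "0 < q" "q < p"
begin

lemma floor_rem: "0 \<le> s - p * of_int \<lfloor>s / p\<rfloor>" "s - p * of_int \<lfloor>s / p\<rfloor> < p"
proof -
  have p: "0 < p" using pq by simp
  have "of_int \<lfloor>s / p\<rfloor> \<le> s / p" "s / p < of_int \<lfloor>s / p\<rfloor> + 1" by linarith+
  then have "of_int \<lfloor>s / p\<rfloor> * p \<le> s" "s < (of_int \<lfloor>s / p\<rfloor> + 1) * p"
    unfolding pos_le_divide_eq[OF p] pos_divide_less_eq[OF p] .
  then show "0 \<le> s - p * of_int \<lfloor>s / p\<rfloor>" "s - p * of_int \<lfloor>s / p\<rfloor> < p"
    by (simp_all add: algebra_simps)
qed

lemma ladder_diff:
  assumes "s \<le> s'"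
  shows "0 \<le> ladder p q s' - ladder p q s" "ladder p q s' - ladder p q s \<le> s' - s"
proof -
  define k k' where "k = \<lfloor>s / p\<rfloor>" and "k' = \<lfloor>s' / p\<rfloor>"
  define r r' where "r = s - p * of_int k" and "r' = s' - p * of_int k'"
  have r: "0 \<le> r" "r < p" "0 \<le> r'" "r' < p" unfolding r_def r'_def k_def k'_def using floor_rem by blast+
  have lad: "ladder p q s = q * of_int k + min q r" "ladder p q s' = q * of_int k' + min q r'"
    by (simp_all add: ladder_def k_def k'_def r_def r'_def)
  define j where "j = real_of_int (k' - k)"
  have diffs: "ladder p q s' - ladder p q s = q * j + min q r' - min q r" "s' - s = p * j + r' - r"
    unfolding lad by (simp_all add: r_def r'_def j_def algebra_simps)
  have "k \<le> k'" unfolding k_def k'_def using assms pq by (intro floor_mono divide_right_mono) auto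
  then consider "k = k'" | "k + 1 \<le> k'" by linarith
  then have "0 \<le> ladder p q s' - ladder p q s \<and> ladder p q s' - ladder p q s \<le> s' - s"
  proof cases
    case 1
    then have "j = 0" by (simp add: j_def)
    then show ?thesis using diffs assms by (simp add: min_def)
  next
    case 2
    have j: "1 \<le> j" using 2 by (simp add: j_def)
    have "q \<le> q * j" "p - q \<le> (p - q) * j"
      using mult_left_mono[OF j, of q] mult_left_mono[OF j, of "p - q"] pq by simp_all
    then have "q \<le> q * j" "p - q \<le> p * j - q * j" by (simp_all add: left_diff_distrib)
    moreover have "min q r \<le> q" "0 \<le> min q r'" "min q r' \<le> r'" "r - min q r \<le> p - q" using r pq by (auto simp: min_def)
    ultimately show ?thesis using diffs by linarith
  qed
  then show "0 \<le> ladder p q s' - ladder p q s" "ladder p q s' - ladder p q s \<le> s' - s" by auto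
qed

lemma ladder_lipschitz: "\<bar>ladder p q s' - ladder p q s\<bar> \<le> \<bar>s' - s\<bar>"
  using ladder_diff[of s s'] ladder_diff[of s' s] by (cases "s \<le> s'") auto

lemma ladder_approx: "\<bar>ladder p q s - q / p * s\<bar> \<le> q"
proof -
  define k where "k = \<lfloor>s / p\<rfloor>"
  define r where "r = s - p * of_int k"
  have r: "0 \<le> r" "r < p" unfolding r_def k_def using floor_rem by blast+
  have "q / p * s = q * of_int k + q / p * r" using pq by (simp add: r_def field_simps)
  then have eq: "ladder p q s - q / p * s = min q r - q / p * r"
    by (simp add: ladder_def k_def r_def)
  have "0 \<le> q / p" using pq by simp
  from mult_nonneg_nonneg[OF this r(1)] mult_left_mono[OF less_imp_le[OF r(2)] this]
  have "0 \<le> q / p * r" "q / p * r \<le> q / p * p" .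
  moreover have "q / p * p = q" using pq by simp
  ultimately have "0 \<le> q / p * r" "q / p * r \<le> q" by linarith+
  moreover have "0 \<le> min q r" "min q r \<le> q" using pq r by auto
  ultimately show ?thesis unfolding eq by linarith
qed

text \<open>Two gaps are separated by an interval of length q, so points of gaps at distance less
  than q lie in the same gap, where the ladder is constant.\<close>

lemma ladder_eq:
  assumes s: "\<And>k::int. \<not> (p * of_int k \<le> s \<and> s \<le> p * of_int k + q)"
    and s': "\<And>k::int. \<not> (p * of_int k \<le> s' \<and> s' \<le> p * of_int k + q)"
    and "s \<le> s'" "s' - s < q"
  shows "ladder p q s = ladder p q s'"
proof -
  define k k' where "k = \<lfloor>s / p\<rfloor>" and "k' = \<lfloor>s' / p\<rfloor>"
  have r: "0 \<le> s - p * of_int k" "0 \<le> s' - p * of_int k'" "s - p * of_int k < p"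
    unfolding k_def k'_def using floor_rem by blast+
  have big: "q < s - p * of_int k" "q < s' - p * of_int k'" using s[of k] s'[of k'] r by linarith+
  have "k \<le> k'" unfolding k_def k'_def using assms pq by (intro floor_mono divide_right_mono) auto
  moreover have "\<not> k + 1 \<le> k'"
  proof
    assume "k + 1 \<le> k'"
    then have "p * (real_of_int k + 1) \<le> p * of_int k'" using pq by (intro mult_left_mono) linarith+
    then show False using big r assms(4) by (simp add: distrib_left)
  qed
  ultimately have "k = k'" by linarith
  then show ?thesis using big by (simp add: ladder_def k_def[symmetric] k'_def[symmetric])
qed

end

text \<open>The parameter w fattens the slabs. Three values occur: 0 for the core, 1 for everything
  within unit distance of it and hence on an edge meeting it, and a macroscopic one for the
  insulation.\<close>

definition slab :: "real \<Rightarrow> real \<Rightarrow> real \<Rightarrow> (real ^ 'n::finite) set" where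
  "slab p q w = {z. \<exists>i. \<exists>k::int. p * of_int k - w \<le> z $ i \<and> z $ i \<le> p * of_int k + q + w}"

lemma slab_mono_dist:
  assumes "z \<in> slab p q w" "l1norm (y - z) \<le> w' - w"
  shows "y \<in> slab p q w'"
proof -
  obtain i k where ik: "p * of_int k - w \<le> z $ i" "z $ i \<le> p * of_int k + q + w" using assms(1) by (auto simp: slab_def)
  have "\<bar>(y - z) $ i\<bar> \<le> w' - w" using abs_component_le_l1norm assms(2) order_trans by blast
  then have "p * of_int k - w' \<le> y $ i \<and> y $ i \<le> p * of_int k + q + w'" using ik by auto
  then show ?thesis unfolding slab_def by blast
qed

definition core_edges :: "nat \<Rightarrow> real \<Rightarrow> real \<Rightarrow> (int ^ 'n::finite) set set" where
  "core_edges n p q = {e\<in>edges. points_of e \<inter> cube n \<inter> slab p q 0 \<noteq> {}}"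

definition slab_edges :: "nat \<Rightarrow> real \<Rightarrow> real \<Rightarrow> real \<Rightarrow> (int ^ 'n::finite) set set" where
  "slab_edges n p q w = {e\<in>edges. points_of e \<inter> cube n \<inter> slab p q w \<noteq> {}}"

text \<open>Near the core the potential coincides with g up to a constant and has slope at most b -
  2 \<kappa>, so \<kappa> times a 1-Lipschitz function can be added without exceeding the weights b
  - \<kappa>. The added function is built from ladders and is locally constant off the core, so
  nothing has to be paid there. Gluing across the insulation returns to the old potential.\<close>

lemma T_slabs_lower:
  fixes g :: "real ^ 'n::finite \<Rightarrow> real"
  assumes ab: "0 < a" "a < b" and g: "g \<in> norms a b" and \<kappa>: "0 < \<kappa>" "\<And>x. g x \<le> (b - 2 * \<kappa>) * l1norm x"
    and pq: "1 < q" "q < p" and w: "1 < w" and \<epsilon>: "0 \<le> \<epsilon>" and H: "\<epsilon> \<le> H" "H \<le> 2 * \<kappa> * (w - 1)"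
    and t: "cfg a b t" and T: "\<And>x y. x \<in> cube n \<Longrightarrow> y \<in> cube n \<Longrightarrow> g (x - y) - \<epsilon> \<le> T_in t b (cube n) x y"
    and t': "\<And>e. e \<notin> slab_edges n p q w \<Longrightarrow> t' e = t e" "\<And>e. e \<in> core_edges n p q \<Longrightarrow> b - \<kappa> \<le> t' e"
      "\<And>e. e \<in> slab_edges n p q w \<Longrightarrow> e \<notin> core_edges n p q \<Longrightarrow> t' e = b"
    and xy: "x \<in> cube n" "y \<in> cube n"
  shows "g (x - y) + \<kappa> * (\<Sum>i\<in>UNIV. \<bar>ladder p q (x $ i) - ladder p q (y $ i)\<bar>) - 2 * H \<le> T_in t' b (cube n) x y"
proof -
  have ab': "0 \<le> a" "a \<le> b" "0 \<le> b" using ab by auto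
  have pq': "0 < q" "q < p" using pq by auto
  let ?A = "slab p q 1 :: (real ^ 'n) set"
  define m where "m z = g (z - x)" for z
  define \<Phi> where "\<Phi> = conv t b (cube n) m"
  define f where "f z = min (\<Phi> z) (extend b ?A m z - H)" for z
  have mg: "m u - m v \<le> g (u - v)" for u v
    using norms_triangle3[OF g, of u x v] by (simp add: m_def)
  have mlip: "m v - m u \<le> (b - 2 * \<kappa>) * l1norm (u - v)" for u v
    using mg[of v u] \<kappa>(2)[of "v - u"] by (simp add: l1norm_minus_commute)
  have mlip': "m v - m u \<le> b * l1norm (u - v)" for u v
  proof -
    have "(b - 2 * \<kappa>) * l1norm (u - v) \<le> b * l1norm (u - v)" using \<kappa> by (intro mult_right_mono l1norm_nonneg) auto
    then show ?thesis using mlip[of v u] by linarith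
  qed
  have mT: "m u - m v - \<epsilon> \<le> T_in t b (cube n) v u" if "u \<in> cube n" "v \<in> cube n" for u v
    using T[OF that(2,1)] mg[of u v] norms_minus_commute[OF g, of u v] by linarith
  have \<Phi>: "u \<in> cube n \<Longrightarrow> m u - \<epsilon> \<le> \<Phi> u" "u \<in> cube n \<Longrightarrow> \<Phi> u \<le> m u" "lip t b (cube n) \<Phi>" for u
    unfolding \<Phi>_def using conv[OF ab'(1,2) t, of "cube n" m \<epsilon>] mT xy by blast+
  have \<Phi>lip: "\<Phi> v - \<Phi> u \<le> b * l1norm (u - v)" if "u \<in> cube n" "v \<in> cube n" for u v
    using lip_imp_lipschitz[OF ab'(1,2) t \<Phi>(3)] that by blast
  have "0 \<in> ?A" using pq by (auto simp: slab_def intro!: exI[of _ 0])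
  then have A: "?A \<noteq> {}" by blast
  have glued: "\<And>u. u \<in> cube n \<Longrightarrow> u \<in> ?A \<Longrightarrow> f u = m u - H"
    "\<And>u. u \<in> cube n \<Longrightarrow> (\<And>v. v \<in> ?A \<Longrightarrow> H + 0 \<le> 2 * \<kappa> * l1norm (u - v)) \<Longrightarrow> f u = \<Phi> u"
    "\<And>u v. u \<in> cube n \<Longrightarrow> v \<in> cube n \<Longrightarrow> f v - f u \<le> b * l1norm (u - v)"
    "\<And>u. u \<in> cube n \<Longrightarrow> m u - 2 * H \<le> f u" "\<And>u. u \<in> cube n \<Longrightarrow> f u \<le> m u"
    unfolding f_def
    by (rule glue[where m = m and \<psi> = m and \<Phi> = \<Phi> and \<theta> = "2 * \<kappa>" and \<sigma> = 0 and \<epsilon> = \<epsilon> and X = "cube n" and A = ?A,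
          OF ab'(3) A mlip' _ mlip _ \<Phi>(1,2) \<Phi>lip]; use \<kappa> \<epsilon> H in simp)+
  have far: "f u = \<Phi> u" if "u \<in> cube n" "u \<notin> slab p q w" for u
  proof (rule glued(2)[OF that(1)])
    fix v :: "real ^ 'n" assume "v \<in> ?A"
    then have "\<not> l1norm (u - v) \<le> w - 1" using slab_mono_dist[of v p q 1 u w] that(2) by blast
    then have "2 * \<kappa> * (w - 1) \<le> 2 * \<kappa> * l1norm (u - v)" using \<kappa> by (intro mult_left_mono) auto
    then show "H + 0 \<le> 2 * \<kappa> * l1norm (u - v)" using H by linarith
  qed
  \<comment> \<open>The signs make the contributions of all coordinates between x and y nonnegative,
    so that they add up instead of cancelling.\<close>
  define \<phi> where "\<phi> z = (\<Sum>i\<in>UNIV. sgn (y $ i - x $ i) * ladder p q (z $ i))" for z :: "real ^ 'n"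
  have \<phi>_lip: "\<phi> v - \<phi> u \<le> l1norm (u - v)" for u v
  proof -
    have "\<phi> v - \<phi> u = (\<Sum>i\<in>UNIV. sgn (y $ i - x $ i) * (ladder p q (v $ i) - ladder p q (u $ i)))"
      by (simp add: \<phi>_def sum_subtractf algebra_simps)
    also have "\<dots> \<le> (\<Sum>i\<in>UNIV. \<bar>(u - v) $ i\<bar>)"
    proof (rule sum_mono)
      fix i
      have "sgn (y $ i - x $ i) * (ladder p q (v $ i) - ladder p q (u $ i)) \<le> \<bar>ladder p q (v $ i) - ladder p q (u $ i)\<bar>"
        by (auto simp: sgn_if)
      then show "sgn (y $ i - x $ i) * (ladder p q (v $ i) - ladder p q (u $ i)) \<le> \<bar>(u - v) $ i\<bar>"
        using ladder_lipschitz[OF pq', of "v $ i" "u $ i"] by simp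
    qed
    finally show ?thesis by (simp add: l1norm_def)
  qed
  have \<phi>_eq: "\<phi> u = \<phi> v" if uv: "u \<notin> slab p q 0" "v \<notin> slab p q 0" "l1norm (u - v) \<le> 1" for u v
    unfolding \<phi>_def
  proof (rule sum.cong[OF refl])
    fix i
    have c: "\<not> (p * of_int k \<le> u $ i \<and> u $ i \<le> p * of_int k + q)" "\<not> (p * of_int k \<le> v $ i \<and> v $ i \<le> p * of_int k + q)" for k
      using uv by (auto simp: slab_def)
    have "\<bar>(u - v) $ i\<bar> \<le> 1" using abs_component_le_l1norm uv(3) order_trans by blast
    then have "\<bar>u $ i - v $ i\<bar> < q" using pq by simp
    then have "ladder p q (u $ i) = ladder p q (v $ i)"
    proof (cases "u $ i \<le> v $ i")
      case True
      show ?thesis by (rule ladder_eq[OF pq' c True]) (use \<open>\<bar>u $ i - v $ i\<bar> < q\<close> in linarith)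
    next
      case False
      then have le: "v $ i \<le> u $ i" by simp
      show ?thesis by (rule ladder_eq[OF pq' c(2,1) le, symmetric]) (use \<open>\<bar>u $ i - v $ i\<bar> < q\<close> in linarith)
    qed
    then show "sgn (y $ i - x $ i) * ladder p q (u $ i) = sgn (y $ i - x $ i) * ladder p q (v $ i)" by simp
  qed
  define G where "G z = f z + \<kappa> * \<phi> z" for z
  have G_core: "G v - G u \<le> (b - \<kappa>) * l1norm (u - v)"
    if "u \<in> cube n" "v \<in> cube n" "u \<in> ?A" "v \<in> ?A" for u v
  proof -
    have "\<kappa> * (\<phi> v - \<phi> u) \<le> \<kappa> * l1norm (u - v)" using \<kappa> \<phi>_lip by (intro mult_left_mono) auto
    moreover have "f u = m u - H" "f v = m v - H" using glued(1) that by blast+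
    ultimately show ?thesis using mlip[of v u] by (simp add: G_def algebra_simps)
  qed
  have "lip t' b (cube n) G"
  proof (rule lipI)
    fix u v :: "real ^ 'n" assume "u \<in> cube n" "v \<in> cube n"
    then show "G v - G u \<le> b * l1norm (u - v)"
    \<comment> \<open>Short steps are needed because \<phi> is constant off the core only between
      points in the same gaps; unit steps cannot jump over a core slab, as q > 1.\<close>
    proof (rule lipschitz_from_short_steps[rotated])
      fix u v :: "real ^ 'n" assume uv: "u \<in> cube n" "v \<in> cube n" "l1norm (u - v) \<le> 1"
      show "G v - G u \<le> b * l1norm (u - v)"
      proof (cases "u \<in> slab p q 0 \<or> v \<in> slab p q 0")
        case True
        then have "u \<in> ?A" "v \<in> ?A"
          using slab_mono_dist[of u p q 0 v 1] slab_mono_dist[of v p q 0 u 1] slab_mono_dist[of u p q 0 u 1]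
            slab_mono_dist[of v p q 0 v 1] uv by (auto simp: l1norm_minus_commute)
        moreover have "(b - \<kappa>) * l1norm (u - v) \<le> b * l1norm (u - v)"
          using \<kappa> by (intro mult_right_mono l1norm_nonneg) auto
        ultimately show ?thesis using G_core[of u v] uv by simp
      next
        case False
        then show ?thesis using \<phi>_eq[of u v] uv glued(3)[OF uv(1,2)] by (simp add: G_def)
      qed
    qed
  next
    fix e :: "(int ^ 'n) set" and u v :: "real ^ 'n"
    assume e: "e \<in> edges" "e = edge_through u v" and uv: "u \<in> cube n" "v \<in> cube n" "u \<in> points_of e" "v \<in> points_of e"
    have uv1: "l1norm (u - v) \<le> 1" using points_of_l1_diff[OF e(1) uv(3,4)] .
    consider "e \<in> core_edges n p q" | "e \<in> slab_edges n p q w" "e \<notin> core_edges n p q" | "e \<notin> slab_edges n p q w" "e \<notin> core_edges n p q"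
    proof -
      have "core_edges n p q \<subseteq> slab_edges n p q w"
        using slab_mono_dist[of _ p q 0 _ w] w unfolding core_edges_def slab_edges_def by force
      then show ?thesis using that by blast
    qed
    then show "G v - G u \<le> t' e * l1norm (u - v)"
    proof cases
      case 1
      then obtain z where z: "z \<in> points_of e" "z \<in> slab p q 0" by (auto simp: core_edges_def)
      have "u \<in> ?A" "v \<in> ?A"
        using points_of_l1_diff[OF e(1) uv(3) z(1)] points_of_l1_diff[OF e(1) uv(4) z(1)]
          slab_mono_dist[OF z(2)] by auto
      then have "G v - G u \<le> (b - \<kappa>) * l1norm (u - v)" using G_core uv by blast
      also have "\<dots> \<le> t' e * l1norm (u - v)" using t'(2)[OF 1] by (intro mult_right_mono l1norm_nonneg)
      finally show ?thesis .
    next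
      case 2
      then have "u \<notin> slab p q 0" "v \<notin> slab p q 0" using uv e by (auto simp: core_edges_def)
      then show ?thesis using \<phi>_eq[of u v] uv1 t'(3)[OF 2] glued(3)[OF uv(1,2)] by (simp add: G_def)
    next
      case 3
      then have "u \<notin> slab p q 0" "v \<notin> slab p q 0" "u \<notin> slab p q w" "v \<notin> slab p q w"
        using uv e by (auto simp: core_edges_def slab_edges_def)
      then have "G v - G u = \<Phi> v - \<Phi> u" using \<phi>_eq[of u v] uv1 far uv by (simp add: G_def)
      moreover have "\<Phi> v - \<Phi> u \<le> step_time t b u v" using lipD[OF \<Phi>(3) uv(1,2)] .
      moreover have "step_time t b u v = t e * l1norm (u - v)"
        using step_time_on_edge[of e u v t b] uv e by (simp add: on_edge_iff)
      ultimately show ?thesis using t'(1)[OF 3(1)] by simp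
    qed
  qed
  from T_in_ge_lip[OF this xy] have "G y - G x \<le> T_in t' b (cube n) x y" .
  moreover have "m y - 2 * H \<le> f y" "f x \<le> m x" using glued(4)[OF xy(2)] glued(5)[OF xy(1)] by auto
  moreover have "m x = 0" "m y = g (x - y)" using normsD(4)[OF g, of 0] by (auto simp: m_def norms_minus_commute[OF g, of x])
  moreover have "\<phi> y - \<phi> x = (\<Sum>i\<in>UNIV. \<bar>ladder p q (x $ i) - ladder p q (y $ i)\<bar>)"
  proof -
    have "sgn (y $ i - x $ i) * (ladder p q (y $ i) - ladder p q (x $ i)) = \<bar>ladder p q (x $ i) - ladder p q (y $ i)\<bar>" for i
      using ladder_diff[OF pq', of "x $ i" "y $ i"] ladder_diff[OF pq', of "y $ i" "x $ i"] by (auto simp: sgn_if)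
    then show ?thesis by (simp add: \<phi>_def algebra_simps flip: sum_subtractf)
  qed
  ultimately show ?thesis by (simp add: G_def algebra_simps)
qed

lemma card_edges_near_hyperplanes:
  fixes P :: "(int ^ 'n::finite) set set" and l :: "int \<Rightarrow> real"
  assumes P: "P \<subseteq> edges" and w: "0 \<le> w"
    and near: "\<And>e. e \<in> P \<Longrightarrow> \<exists>z\<in>points_of e \<inter> cube n. \<exists>i. \<exists>k\<in>{k1..k2}. l k \<le> z $ i \<and> z $ i \<le> l k + w"
  shows "finite P" "real (card P) \<le> real CARD('n) ^ 2 * (real (card {k1..k2}) * ((w + 2) * (real n + 2) ^ (CARD('n) - 1)))"
proof -
  \<comment> \<open>The base vertex of an edge may lie one unit below the given point of the edge in
    any coordinate, hence the margins of 1.\<close>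
  define S where "S i k j = (if j = i then {m::int. l k - 1 \<le> m \<and> m \<le> l k + w} else {m::int. - 1 \<le> real_of_int m \<and> m \<le> real n})" for i j :: 'n and k :: int
  define V where "V i k = {v :: int ^ 'n. \<forall>j. v $ j \<in> S i k j}" for i k
  have finS: "finite (S i k j)" for i k j using w by (auto simp: S_def intro!: card_int_interval_le)
  have finV: "finite (V i k)" for i k unfolding V_def by (rule finite_lattice_box[OF finS])
  have cardS: "real (card (S i k j)) \<le> (if j = i then w + 2 else real n + 2)" for i k j
    unfolding S_def using card_int_interval_le(2)[of "l k - 1" "l k + w"] card_int_interval_le(2)[of "-1" "real n"] w by auto
  have cardV: "real (card (V i k)) \<le> (w + 2) * (real n + 2) ^ (CARD('n) - 1)" for i k
  proof -
    have "real (card (V i k)) \<le> (\<Prod>j\<in>UNIV. real (card (S i k j)))"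
      unfolding V_def card_lattice_box by simp
    also have "\<dots> \<le> (\<Prod>j\<in>UNIV. if j = i then w + 2 else real n + 2)"
      by (intro prod_mono conjI cardS) auto
    also have "\<dots> = (w + 2) * (real n + 2) ^ (CARD('n) - 1)"
      by (subst prod.remove[of _ i]) (auto simp: card_Diff_singleton)
    finally show ?thesis .
  qed
  let ?I = "(UNIV :: 'n set) \<times> {k1..k2}"
  let ?V = "\<Union>(i, k)\<in>?I. V i k"
  have fin: "finite ?V" using finV by auto
  have cov: "\<exists>v\<in>?V. \<exists>j. e = {v, v + axis j 1}" if eP: "e \<in> P" for e
  proof -
    obtain z i k where z: "z \<in> points_of e" "z \<in> cube n" "k \<in> {k1..k2}" "l k \<le> z $ i" "z $ i \<le> l k + w"
      using near[OF eP] by blast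
    obtain v j where vj: "e = {v, v + axis j 1}" using edges_cases P eP by blast
    have co: "real_of_int (v $ m) \<le> z $ m" "z $ m \<le> real_of_int (v $ m) + 1" "0 \<le> z $ m" "z $ m \<le> real n" for m
      using points_of_coordinates[of z v j m] z vj by (auto simp: cube_def)
    have "v $ m \<in> S i k m" for m
    proof (cases "m = i")
      case True
      then show ?thesis using co(1,2)[of i] z(4,5) by (auto simp: S_def)
    next
      case False
      then show ?thesis using co[of m] by (auto simp: S_def)
    qed
    then have "v \<in> V i k" by (simp add: V_def)
    then have "v \<in> ?V" using z(3) by blast
    then show ?thesis using vj by blast
  qed
  show "finite P" by (rule card_edges_from_vertices(1)[OF fin cov])
  have "real (card ?V) \<le> (\<Sum>ik\<in>?I. real (card (case ik of (i, k) \<Rightarrow> V i k)))"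
    unfolding of_nat_sum[symmetric] of_nat_le_iff by (rule card_UN_le) simp
  also have "\<dots> \<le> (\<Sum>ik\<in>?I. (w + 2) * (real n + 2) ^ (CARD('n) - 1))"
    using cardV by (intro sum_mono) auto
  also have "\<dots> = real CARD('n) * real (card {k1..k2}) * ((w + 2) * (real n + 2) ^ (CARD('n) - 1))"
    by (simp add: card_cartesian_product)
  finally have "real CARD('n) * real (card ?V) \<le> real CARD('n) * (real CARD('n) * real (card {k1..k2}) * ((w + 2) * (real n + 2) ^ (CARD('n) - 1)))"
    by (intro mult_left_mono) auto
  also have "\<dots> = real CARD('n) ^ 2 * (real (card {k1..k2}) * ((w + 2) * (real n + 2) ^ (CARD('n) - 1)))"
    by (simp only: power2_eq_square mult.assoc)
  finally show "real (card P) \<le> real CARD('n) ^ 2 * (real (card {k1..k2}) * ((w + 2) * (real n + 2) ^ (CARD('n) - 1)))"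
    using card_edges_from_vertices(2)[OF fin cov, of P] by linarith
qed

text \<open>The slabs are macroscopic: their number depends on K but not on n. The core F1 has
  proportion of order \<delta> and only needs weights at least b - \<kappa>; the insulation F2 needs
  weight b but can be made arbitrarily thin.\<close>

lemma slow_slabs:
  fixes g :: "real ^ 'n::finite \<Rightarrow> real"
  assumes ab: "0 < a" "a < b" and g: "g \<in> norms a b" and \<kappa>: "0 < \<kappa>" "\<And>x. g x \<le> (b - 2 * \<kappa>) * l1norm x"
    and \<delta>: "0 < \<delta>" "\<delta> < 1" and \<epsilon>: "0 < \<epsilon>" and \<eta>: "0 < \<eta>"
  shows "\<exists>\<epsilon>'>0. \<forall>\<^sub>F n in sequentially. \<exists>F1 F2. finite F1 \<and> finite F2 \<and> F1 \<subseteq> edges \<and> F2 \<subseteq> edges \<and> F1 \<inter> F2 = {}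
    \<and> real (card F1) \<le> 2 * real CARD('n) ^ 2 * 2 ^ CARD('n) * \<delta> * real n ^ CARD('n)
    \<and> real (card F2) \<le> \<eta> * real n ^ CARD('n)
    \<and> (\<forall>t t'. cfg a b t \<longrightarrow> above g b n \<epsilon>' t \<longrightarrow> (\<forall>e. e \<notin> F1 \<union> F2 \<longrightarrow> t' e = t e)
      \<longrightarrow> (\<forall>e\<in>F1. b - \<kappa> \<le> t' e) \<longrightarrow> (\<forall>e\<in>F2. t' e = b)
      \<longrightarrow> (\<forall>x\<in>cube n. \<forall>y\<in>cube n. g (x - y) + \<kappa> * \<delta> * l1norm (x - y) - \<epsilon> * real n \<le> T_in t' b (cube n) x y))"
    (is "\<exists>\<epsilon>'>0. eventually (?Q \<epsilon>') _")
proof -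
  define d where "d = real CARD('n)"
  define D where "D = 2 ^ CARD('n) * d ^ 2"
  have d: "1 \<le> d" by (simp add: d_def Suc_leI)
  have D: "0 < D" using d by (simp add: D_def)
  \<comment> \<open>The period n / K must be fine enough that the rounding error 2 d q of the
    ladders, multiplied by \<kappa>, is at most \<epsilon> n / 2.\<close>
  obtain K0 :: nat where K0: "4 * d * \<kappa> / \<epsilon> < real K0" using reals_Archimedean2 by blast
  define K where "K = Suc K0"
  have K: "1 \<le> real K" "4 * d * \<kappa> \<le> \<epsilon> * real K" using K0 \<epsilon> by (auto simp: K_def field_simps)
  \<comment> \<open>The first bound keeps the insulation width w = \<omega> n below the period p;
    the second limits the number of insulating edges.\<close>
  define \<omega> where "\<omega> = min (1 / real K) (\<eta> / (10 * real K * D))"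
  have \<omega>: "0 < \<omega>" "\<omega> \<le> 1 / real K" "\<omega> \<le> \<eta> / (10 * real K * D)" using K D \<eta> by (auto simp: \<omega>_def)
  have \<omega>\<eta>: "10 * real K * D * \<omega> \<le> \<eta>" using \<omega>(3) K D by (simp add: field_simps)
  \<comment> \<open>The second bound gives H = \<epsilon>' n \<le> \<kappa> w \<le> 2 \<kappa> (w -
    1), using w \<ge> 2, so the insulation is wide enough for gluing.\<close>
  define \<epsilon>' where "\<epsilon>' = min (\<epsilon> / 4) (\<kappa> * \<omega>)"
  have \<epsilon>': "0 < \<epsilon>'" "\<epsilon>' \<le> \<epsilon> / 4" "\<epsilon>' \<le> \<kappa> * \<omega>" using \<epsilon> \<kappa> \<omega> by (auto simp: \<epsilon>'_def)
  have "\<forall>\<^sub>F n in sequentially. 2 * real K / \<delta> \<le> real n \<and> 2 / \<omega> \<le> real n \<and> 2 \<le> real n"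
    by (intro eventually_conj eventually_le_real)
  then show ?thesis
  proof (intro exI[of _ \<epsilon>'] conjI \<epsilon>'(1), elim eventually_mono)
    fix n assume n: "2 * real K / \<delta> \<le> real n \<and> 2 / \<omega> \<le> real n \<and> 2 \<le> real n"
    define p where "p = real n / real K"
    define q where "q = \<delta> * p"
    define w where "w = \<omega> * real n"
    have n2: "2 \<le> real n" using n by simp
    have p: "0 < p" "p * real K = real n" using n2 K by (auto simp: p_def)
    have q: "2 \<le> q" "q < p" "q \<le> p"
      using n \<delta> K p by (auto simp: q_def p_def field_simps)
    have w: "2 \<le> w" using n \<omega> by (auto simp: w_def field_simps)
    have wp: "w \<le> p" using mult_right_mono[OF \<omega>(2), of "real n"] by (simp add: w_def p_def)
    define F1 where "F1 = (core_edges n p q :: (int ^ 'n) set set)"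
    define F2 where "F2 = (slab_edges n p q w :: (int ^ 'n) set set) - F1"
    have sub: "F1 \<subseteq> edges" "F2 \<subseteq> edges" "F1 \<inter> F2 = {}" by (auto simp: F1_def F2_def core_edges_def slab_edges_def)
    have kle: "k \<le> j" if "p * real_of_int k \<le> p * real_of_int j" for k j using that p by simp
    have klt: "k < j" if "p * real_of_int k < p * real_of_int j" for k j using that p by simp
    define N where "N = (real n + 2) ^ (CARD('n) - 1)"
    have "N \<le> (2 * real n) ^ (CARD('n) - 1)" unfolding N_def using n2 by (intro power_mono) auto
    then have N: "2 * real n * N \<le> 2 ^ CARD('n) * real n ^ CARD('n)"
      using n2 by (cases "CARD('n)") (auto simp: power_mult_distrib)
    have N0: "0 \<le> N" by (simp add: N_def)
    have card1: "finite F1 \<and> real (card F1) \<le> 2 * real CARD('n) ^ 2 * 2 ^ CARD('n) * \<delta> * real n ^ CARD('n)"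
    proof
      have near: "\<exists>z\<in>points_of e \<inter> cube n. \<exists>i. \<exists>k\<in>{0..int K}. p * of_int k \<le> z $ i \<and> z $ i \<le> p * of_int k + q" if eF: "e \<in> F1" for e
      proof -
        obtain z i k where z: "z \<in> points_of e" "z \<in> cube n" "p * of_int k \<le> z $ i" "z $ i \<le> p * of_int k + q"
          using eF by (auto simp: F1_def core_edges_def slab_def)
        have zi: "0 \<le> z $ i" "z $ i \<le> real n" using z by (auto simp: cube_def)
        have "k \<le> int K" by (rule kle) (use z zi p in simp)
        moreover have "-1 < k" by (rule klt) (use z zi q in simp)
        ultimately have "k \<in> {0..int K}" by simp
        then show ?thesis using z by blast
      qed
      have q0: "0 \<le> q" using q by simp
      note c = card_edges_near_hyperplanes[OF sub(1) q0 near]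
      show "finite F1" by (rule c)
      have "real (card F1) \<le> d ^ 2 * ((real K + 1) * ((q + 2) * N))"
        using c(2) by (simp add: d_def N_def add.commute)
      also have "\<dots> \<le> d ^ 2 * ((2 * real K) * ((2 * q) * N))"
        using K q N0 by (intro mult_left_mono mult_mono) auto
      also have "\<dots> = d ^ 2 * 2 * \<delta> * (2 * real n * N)" using p by (simp add: q_def mult_ac)
      also have "\<dots> \<le> d ^ 2 * 2 * \<delta> * (2 ^ CARD('n) * real n ^ CARD('n))" using N \<delta> by (intro mult_left_mono) auto
      finally show "real (card F1) \<le> 2 * real CARD('n) ^ 2 * 2 ^ CARD('n) * \<delta> * real n ^ CARD('n)"
        by (simp add: d_def mult_ac)
    qed
    have card2: "finite F2 \<and> real (card F2) \<le> \<eta> * real n ^ CARD('n)"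
    proof
      \<comment> \<open>The insulation is split into its layers below and above the core slabs.
        Since w \<le> p, slabs with an index outside this range do not reach the cube.\<close>
      define F2a where "F2a = {e\<in>F2. \<exists>z\<in>points_of e \<inter> cube n. \<exists>i. \<exists>k\<in>{-2..int K + 1}. p * of_int k - w \<le> z $ i \<and> z $ i \<le> p * of_int k - w + w}"
      define F2b where "F2b = {e\<in>F2. \<exists>z\<in>points_of e \<inter> cube n. \<exists>i. \<exists>k\<in>{-2..int K + 1}. p * of_int k + q \<le> z $ i \<and> z $ i \<le> p * of_int k + q + w}"
      have cov: "F2 \<subseteq> F2a \<union> F2b"
      proof
        fix e assume eF: "e \<in> F2"
        obtain z i k where z: "z \<in> points_of e" "z \<in> cube n" "p * of_int k - w \<le> z $ i" "z $ i \<le> p * of_int k + q + w"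
          using eF by (auto simp: F2_def slab_edges_def slab_def)
        have zi: "0 \<le> z $ i" "z $ i \<le> real n" using z by (auto simp: cube_def)
        have "\<not> (p * of_int k \<le> z $ i \<and> z $ i \<le> p * of_int k + q)"
          using eF z(1,2) by (auto simp: F2_def F1_def core_edges_def slab_edges_def slab_def)
        then consider "z $ i \<le> p * of_int k - w + w" | "p * of_int k + q \<le> z $ i" by linarith
        moreover have "k \<le> int K + 1" by (rule kle) (use z zi p wp in \<open>simp add: algebra_simps\<close>)
        moreover have "-2 < k" by (rule klt) (use z zi q wp in simp)
        then have "-2 \<le> k" by simp
        ultimately show "e \<in> F2a \<union> F2b"
          using z(1-4) eF unfolding F2a_def F2b_def by (cases) (auto intro!: bexI[of _ z] exI[of _ i] bexI[of _ k])
      qed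
      have w0: "0 \<le> w" using w by simp
      have suba: "F2a \<subseteq> edges" and subb: "F2b \<subseteq> edges" using sub by (auto simp: F2a_def F2b_def)
      have ca: "finite F2a" "real (card F2a) \<le> real CARD('n) ^ 2 * (real (card {-2..int K + 1}) * ((w + 2) * (real n + 2) ^ (CARD('n) - 1)))"
        by (rule card_edges_near_hyperplanes[OF suba w0, where l = "\<lambda>k. p * of_int k - w"]; unfold F2a_def; blast)+
      have cb: "finite F2b" "real (card F2b) \<le> real CARD('n) ^ 2 * (real (card {-2..int K + 1}) * ((w + 2) * (real n + 2) ^ (CARD('n) - 1)))"
        by (rule card_edges_near_hyperplanes[OF subb w0, where l = "\<lambda>k. p * of_int k + q"]; unfold F2b_def; blast)+
      show "finite F2" by (rule finite_subset[OF cov]) (use ca cb in simp)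
      have "card F2 \<le> card F2a + card F2b"
        by (rule order_trans[OF card_mono[OF _ cov] card_Un_le]) (use ca cb in simp)
      then have "real (card F2) \<le> 2 * (d ^ 2 * ((real K + 4) * ((w + 2) * N)))"
        using ca(2) cb(2) by (simp add: d_def N_def add.commute)
      also have "\<dots> \<le> 2 * (d ^ 2 * ((5 * real K) * ((2 * w) * N)))"
        using K w N0 by (intro mult_left_mono mult_mono) auto
      also have "\<dots> = 10 * real K * d ^ 2 * \<omega> * (2 * real n * N)" by (simp add: w_def mult_ac)
      also have "\<dots> \<le> 10 * real K * d ^ 2 * \<omega> * (2 ^ CARD('n) * real n ^ CARD('n))" using N \<omega> by (intro mult_left_mono) auto
      also have "\<dots> = (10 * real K * D * \<omega>) * real n ^ CARD('n)" by (simp add: D_def mult_ac)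
      also have "\<dots> \<le> \<eta> * real n ^ CARD('n)" using \<omega>\<eta> by (intro mult_right_mono) auto
      finally show "real (card F2) \<le> \<eta> * real n ^ CARD('n)" .
    qed
    define H where "H = \<epsilon>' * real n"
    have H: "0 \<le> H" "2 * H \<le> \<epsilon> / 2 * real n" "H \<le> 2 * \<kappa> * (w - 1)"
    proof -
      show "0 \<le> H" using \<epsilon>' by (simp add: H_def)
      show "2 * H \<le> \<epsilon> / 2 * real n" using mult_right_mono[OF \<epsilon>'(2), of "real n"] by (simp add: H_def)
      have "H \<le> \<kappa> * w" using mult_right_mono[OF \<epsilon>'(3), of "real n"] by (simp add: H_def w_def)
      moreover have "\<kappa> * 2 \<le> \<kappa> * w" using w \<kappa> by (intro mult_left_mono) auto
      ultimately show "H \<le> 2 * \<kappa> * (w - 1)" by (simp add: algebra_simps)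
    qed
    show "?Q \<epsilon>' n"
    proof (rule exI[of _ F1], rule exI[of _ F2], intro conjI sub card1[THEN conjunct1] card1[THEN conjunct2] card2[THEN conjunct1] card2[THEN conjunct2] allI impI ballI)
      fix t t' :: "(int ^ 'n) set \<Rightarrow> real" and x y :: "real ^ 'n"
      assume t: "cfg a b t" "above g b n \<epsilon>' t" and t': "\<forall>e. e \<notin> F1 \<union> F2 \<longrightarrow> t' e = t e" "\<forall>e\<in>F1. b - \<kappa> \<le> t' e" "\<forall>e\<in>F2. t' e = b"
        and xy: "x \<in> cube n" "y \<in> cube n"
      have "F1 \<subseteq> slab_edges n p q w"
        using slab_mono_dist[of _ p q 0 _ w] w unfolding F1_def core_edges_def slab_edges_def by force
      then have un: "F1 \<union> F2 = slab_edges n p q w" by (auto simp: F2_def)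
      have "g (x - y) + \<kappa> * (\<Sum>i\<in>UNIV. \<bar>ladder p q (x $ i) - ladder p q (y $ i)\<bar>) - 2 * H \<le> T_in t' b (cube n) x y"
      proof (rule T_slabs_lower[OF ab g \<kappa> _ q(2) _ H(1) order_refl H(3) t(1) _ _ _ _ xy])
        show "g (u - v) - H \<le> T_in t b (cube n) u v" if "u \<in> cube n" "v \<in> cube n" for u v
          using t(2) that by (auto simp: above_def H_def)
      qed (use q w t' un in \<open>auto simp: F1_def F2_def\<close>)
      moreover have "\<delta> * l1norm (x - y) - 2 * d * q \<le> (\<Sum>i\<in>UNIV. \<bar>ladder p q (x $ i) - ladder p q (y $ i)\<bar>)"
      proof -
        have "\<delta> * \<bar>(x - y) $ i\<bar> - 2 * q \<le> \<bar>ladder p q (x $ i) - ladder p q (y $ i)\<bar>" for i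
        proof -
          have "q / p = \<delta>" using p by (simp add: q_def)
          then have "\<bar>ladder p q s - \<delta> * s\<bar> \<le> q" for s using ladder_approx[of q p s] q by simp
          from this[of "x $ i"] this[of "y $ i"]
          have "\<bar>\<delta> * x $ i - \<delta> * y $ i\<bar> - 2 * q \<le> \<bar>ladder p q (x $ i) - ladder p q (y $ i)\<bar>" by linarith
          moreover have "\<bar>\<delta> * x $ i - \<delta> * y $ i\<bar> = \<delta> * \<bar>(x - y) $ i\<bar>"
            using \<delta> by (simp add: abs_mult flip: right_diff_distrib)
          ultimately show ?thesis by linarith
        qed
        then have "(\<Sum>i\<in>UNIV. \<delta> * \<bar>(x - y) $ i\<bar> - 2 * q) \<le> (\<Sum>i\<in>UNIV. \<bar>ladder p q (x $ i) - ladder p q (y $ i)\<bar>)"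
          by (intro sum_mono)
        then show ?thesis by (simp add: sum_subtractf l1norm_def d_def sum_distrib_left)
      qed
      then have "\<kappa> * (\<delta> * l1norm (x - y) - 2 * d * q) \<le> \<kappa> * (\<Sum>i\<in>UNIV. \<bar>ladder p q (x $ i) - ladder p q (y $ i)\<bar>)"
        using \<kappa> by (intro mult_left_mono) auto
      moreover have "\<kappa> * (2 * d * q) \<le> \<epsilon> / 2 * real n"
      proof -
        have "\<kappa> * (2 * d * q) \<le> \<kappa> * (2 * d * p)" using q \<kappa> d by (intro mult_left_mono) auto
        also have "\<dots> = (4 * d * \<kappa>) / real K * real n / 2" by (simp add: p_def)
        also have "\<dots> \<le> \<epsilon> * real n / 2" using K by (intro divide_right_mono mult_right_mono) (auto simp: field_simps)
        finally show ?thesis by simp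
      qed
      ultimately show "g (x - y) + \<kappa> * \<delta> * l1norm (x - y) - \<epsilon> * real n \<le> T_in t' b (cube n) x y"
        using H(2) by (simp add: right_diff_distrib mult.assoc)
    qed
  qed
qed

section \<open>Modifying a configuration close to one norm into one close to another\<close>

text \<open>As weights are at least a > 0, an additive error \<rho> is a relative error \<rho> / a;
  steps off the edges only profit from the factor. Hence the new passage time divided by 1 + \<rho>
  / a is a potential for the old weights.\<close>

lemma T_in_perturb:
  assumes ab: "0 < a" "a \<le> b" and t: "cfg a b t" and t': "cfg a b t'" and \<rho>: "0 \<le> \<rho>"
    and close: "\<And>e. e \<in> edges \<Longrightarrow> t' e \<le> t e + \<rho>" and xy: "x \<in> X" "y \<in> X"
  shows "T_in t' b X x y \<le> (1 + \<rho> / a) * T_in t b X x y"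
proof -
  have ab': "0 \<le> a" "a \<le> b" using ab by auto
  let ?c = "1 + \<rho> / a"
  have c: "1 \<le> ?c" "0 < ?c" using ab \<rho> by (auto intro: add_pos_nonneg)
  have "lip t b X (\<lambda>z. T_in t' b X x z / ?c)"
    unfolding lip_def
  proof (intro ballI)
    fix u v assume uv: "u \<in> X" "v \<in> X"
    have "step_time t' b u v \<le> ?c * step_time t b u v"
    proof (rule step_time_cases[of u v b])
      fix e assume e: "e \<in> edges" and st: "\<And>t. step_time t b u v = t e * l1norm (u - v)"
      have "a \<le> t e" using t e by (auto simp: cfg_def)
      then have "\<rho> \<le> \<rho> / a * t e" using ab \<rho> by (simp add: field_simps mult_left_mono)
      then have "t' e \<le> ?c * t e" using close[OF e] by (simp add: algebra_simps)
      then show ?thesis using st mult_right_mono[OF _ l1norm_nonneg] by (metis mult.assoc)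
    next
      assume st: "\<And>t. step_time t b u v = b * l1norm (u - v)"
      have "1 * (b * l1norm (u - v)) \<le> ?c * (b * l1norm (u - v))"
        using c ab by (intro mult_right_mono) (auto intro: mult_nonneg_nonneg l1norm_nonneg)
      then show ?thesis using st by simp
    qed
    then have "T_in t' b X x v - T_in t' b X x u \<le> ?c * step_time t b u v"
      using lipD[OF lip_T_in[OF ab' t' xy(1)] uv] by linarith
    then show "T_in t' b X x v / ?c - T_in t' b X x u / ?c \<le> step_time t b u v"
      using c(2) by (simp only: diff_divide_distrib[symmetric] pos_divide_le_eq mult.commute)
  qed
  from T_in_ge_lip[OF this xy] have "T_in t' b X x y / ?c \<le> T_in t b X x y"
    using T_in_refl[OF ab' t' xy(1)] by simp
  then show ?thesis using c(2) by (simp only: pos_divide_le_eq mult.commute)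
qed

text \<open>The tolerance \<rho> is there because a and b need not be atoms of the law: the
  prescribed weights are only hit approximately. The slabs gain \<kappa> \<delta>
  \<open>l1norm\<close>, which lifts the metric from g above h, and the network then brings it down
  to h.\<close>

lemma modify_configuration:
  fixes g h :: "real ^ 'n::finite \<Rightarrow> real"
  assumes d2: "CARD('n) \<ge> 2" and ab: "0 < a" "a < b" and g: "g \<in> norms a b" and h: "h \<in> norms a b"
    and \<kappa>: "0 < \<kappa>" "\<And>x. g x \<le> (b - 2 * \<kappa>) * l1norm x"
    and \<delta>: "0 < \<delta>" "\<delta> < 1" and gh: "\<And>x. h x \<le> g x + \<kappa> * \<delta> * l1norm x"
    and \<epsilon>: "0 < \<epsilon>" and \<rho>: "0 < \<rho>" "\<rho> * (b * real CARD('n)) \<le> a * \<epsilon> / 4" "\<rho> \<le> a" and \<eta>: "0 < \<eta>"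
  shows "\<exists>\<epsilon>'>0. \<forall>\<^sub>F n in sequentially. \<exists>F1 F2 s. finite F1 \<and> finite F2 \<and> F1 \<subseteq> edges \<and> F2 \<subseteq> edges \<and> F1 \<inter> F2 = {}
    \<and> real (card F1) \<le> 2 * real CARD('n) ^ 2 * 2 ^ CARD('n) * \<delta> * real n ^ CARD('n)
    \<and> real (card F2) \<le> \<eta> * real n ^ CARD('n) \<and> (\<forall>e. s e \<in> {a, b})
    \<and> (\<forall>t t'. cfg a b t \<longrightarrow> cfg a b t' \<longrightarrow> above g b n \<epsilon>' t \<longrightarrow> (\<forall>e. e \<notin> F1 \<union> F2 \<longrightarrow> t' e = t e)
      \<longrightarrow> (\<forall>e\<in>F1. b - \<kappa> \<le> t' e) \<longrightarrow> (\<forall>e\<in>F2. \<bar>t' e - s e\<bar> \<le> \<rho>)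
      \<longrightarrow> (\<forall>x\<in>cube n. \<forall>y\<in>cube n. \<bar>T_in t' b (cube n) x y - h (x - y)\<bar> \<le> \<epsilon> * real n))"
    (is "\<exists>\<epsilon>'>0. eventually (?Q \<epsilon>') _")
proof -
  have ab': "0 \<le> a" "a \<le> b" "0 \<le> b" using ab by auto
  have e2: "0 < \<epsilon> / 2" "0 < \<eta> / 2" using \<epsilon> \<eta> by auto
  obtain \<epsilon>1 where \<epsilon>1: "0 < \<epsilon>1" and ev1: "\<forall>\<^sub>F n in sequentially. \<exists>F s. finite F \<and> F \<subseteq> edges \<and> real (card F) \<le> \<eta> / 2 * real n ^ CARD('n)
    \<and> (\<forall>e. s e \<in> {a, b}) \<and> (\<forall>t. cfg a b t \<longrightarrow> above h b n \<epsilon>1 t \<longrightarrow>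
      (\<forall>p\<in>cube n. \<forall>q\<in>cube n. \<bar>T_in (override F s t) b (cube n) p q - h (p - q)\<bar> \<le> \<epsilon> / 2 * real n))"
    using highway_network[OF d2 ab h e2] by blast
  obtain \<epsilon>' where \<epsilon>': "0 < \<epsilon>'" and ev2: "\<forall>\<^sub>F n in sequentially. \<exists>F1 F2. finite F1 \<and> finite F2 \<and> F1 \<subseteq> edges \<and> F2 \<subseteq> edges \<and> F1 \<inter> F2 = {}
    \<and> real (card F1) \<le> 2 * real CARD('n) ^ 2 * 2 ^ CARD('n) * \<delta> * real n ^ CARD('n)
    \<and> real (card F2) \<le> \<eta> / 2 * real n ^ CARD('n)
    \<and> (\<forall>t t'. cfg a b t \<longrightarrow> above g b n \<epsilon>' t \<longrightarrow> (\<forall>e. e \<notin> F1 \<union> F2 \<longrightarrow> t' e = t e)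
      \<longrightarrow> (\<forall>e\<in>F1. b - \<kappa> \<le> t' e) \<longrightarrow> (\<forall>e\<in>F2. t' e = b)
      \<longrightarrow> (\<forall>x\<in>cube n. \<forall>y\<in>cube n. g (x - y) + \<kappa> * \<delta> * l1norm (x - y) - \<epsilon>1 * real n \<le> T_in t' b (cube n) x y))"
    using slow_slabs[OF ab g \<kappa> \<delta> \<epsilon>1 e2(2)] by blast
  show ?thesis
  proof (intro exI[of _ \<epsilon>'] conjI \<epsilon>', rule eventually_mono[OF eventually_conj[OF ev1 ev2]], elim conjE exE)
    fix n F s G1 G2
    assume F: "finite F" "F \<subseteq> edges" "real (card F) \<le> \<eta> / 2 * real n ^ CARD('n)" and s: "\<forall>e. s e \<in> {a, b}"
      and hw: "\<forall>t. cfg a b t \<longrightarrow> above h b n \<epsilon>1 t \<longrightarrow>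
        (\<forall>p\<in>cube n. \<forall>q\<in>cube n. \<bar>T_in (override F s t) b (cube n) p q - h (p - q)\<bar> \<le> \<epsilon> / 2 * real n)"
      and G: "finite G1" "finite G2" "G1 \<subseteq> edges" "G2 \<subseteq> edges" "G1 \<inter> G2 = {}"
        "real (card G1) \<le> 2 * real CARD('n) ^ 2 * 2 ^ CARD('n) * \<delta> * real n ^ CARD('n)"
        "real (card G2) \<le> \<eta> / 2 * real n ^ CARD('n)"
      and sl: "\<forall>t t'. cfg a b t \<longrightarrow> above g b n \<epsilon>' t \<longrightarrow> (\<forall>e. e \<notin> G1 \<union> G2 \<longrightarrow> t' e = t e)
      \<longrightarrow> (\<forall>e\<in>G1. b - \<kappa> \<le> t' e) \<longrightarrow> (\<forall>e\<in>G2. t' e = b)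
      \<longrightarrow> (\<forall>x\<in>cube n. \<forall>y\<in>cube n. g (x - y) + \<kappa> * \<delta> * l1norm (x - y) - \<epsilon>1 * real n \<le> T_in t' b (cube n) x y)"
    let ?s = "\<lambda>e. if e \<in> F then s e else b"
    show "?Q \<epsilon>' n"
    proof (rule exI[of _ "G1 - F"], rule exI[of _ "F \<union> G2"], rule exI[of _ ?s], intro conjI allI impI ballI)
      show "real (card (G1 - F)) \<le> 2 * real CARD('n) ^ 2 * 2 ^ CARD('n) * \<delta> * real n ^ CARD('n)"
        using card_mono[OF G(1) Diff_subset[of G1 F]] G(6) by linarith
      show "real (card (F \<union> G2)) \<le> \<eta> * real n ^ CARD('n)"
        using card_Un_le[of F G2] F(3) G(7) by linarith
      show "?s e \<in> {a, b}" for e using s by simp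
      fix t t' :: "(int ^ 'n) set \<Rightarrow> real" and x y :: "real ^ 'n"
      assume t: "cfg a b t" "cfg a b t'" "above g b n \<epsilon>' t" and off: "\<forall>e. e \<notin> G1 - F \<union> (F \<union> G2) \<longrightarrow> t' e = t e"
        and on1: "\<forall>e\<in>G1 - F. b - \<kappa> \<le> t' e" and on2: "\<forall>e\<in>F \<union> G2. \<bar>t' e - ?s e\<bar> \<le> \<rho>"
        and xy: "x \<in> cube n" "y \<in> cube n"
      \<comment> \<open>The intermediate configuration, with the slabs but without the highways.
        Core edges to be covered by a highway temporarily get b, the others already have their final
        weight; thus \<open>override F s u\<close> differs from t' by at most \<rho> on every
        edge.\<close>
      define u where "u e = (if e \<in> G2 then b else if e \<in> G1 then if e \<in> F then b else t' e else t e)" for e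
      have cu: "cfg a b u" using t ab by (auto simp: cfg_def u_def)
      have "above h b n \<epsilon>1 u"
        unfolding above_def
      proof (intro ballI)
        fix p q :: "real ^ 'n" assume pq: "p \<in> cube n" "q \<in> cube n"
        have "g (p - q) + \<kappa> * \<delta> * l1norm (p - q) - \<epsilon>1 * real n \<le> T_in u b (cube n) p q"
          by (rule sl[rule_format, OF t(1,3) _ _ _ pq]) (use G(5) on1 \<kappa> in \<open>auto simp: u_def\<close>)
        then show "h (p - q) - \<epsilon>1 * real n \<le> T_in u b (cube n) p q" using gh[of "p - q"] by linarith
      qed
      then have Tv: "\<bar>T_in (override F s u) b (cube n) x y - h (x - y)\<bar> \<le> \<epsilon> / 2 * real n"
        using hw cu xy by blast
      let ?v = "override F s u"
      have "a \<le> s e \<and> s e \<le> b" for e using s[rule_format, of e] ab by auto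
      then have cv: "cfg a b ?v" by (intro cfg_override[OF cu])
      have diff: "\<bar>t' e - ?v e\<bar> \<le> \<rho>" for e
        using on2[rule_format, of e] off[rule_format, of e] \<rho> by (auto simp: override_def u_def)
      have bound: "T_in z b (cube n) x y \<le> b * (real CARD('n) * real n)" if "cfg a b z" for z
        using T_in_bounds[OF ab'(1,2) that xy] mult_left_mono[OF l1norm_cube_diff_le[OF xy] ab'(3)] by linarith
      have small: "\<rho> / a * T_in z b (cube n) x y \<le> \<epsilon> / 2 * real n" if "cfg a b z" for z
      proof -
        have "\<rho> / a * T_in z b (cube n) x y \<le> \<rho> / a * (b * (real CARD('n) * real n))"
          using \<rho> ab bound[OF that] by (intro mult_left_mono) auto
        also have "\<dots> = (\<rho> * (b * real CARD('n))) / a * real n" by simp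
        also have "(\<rho> * (b * real CARD('n))) / a \<le> (a * \<epsilon> / 4) / a" using \<rho> ab by (intro divide_right_mono) auto
        also have "\<dots> \<le> \<epsilon> / 2" using ab \<epsilon> by simp
        finally show ?thesis by (simp add: mult_right_mono)
      qed
      have "t' e \<le> ?v e + \<rho>" "?v e \<le> t' e + \<rho>" for e using diff[of e] by linarith+
      then have "T_in t' b (cube n) x y \<le> (1 + \<rho> / a) * T_in ?v b (cube n) x y"
        "T_in ?v b (cube n) x y \<le> (1 + \<rho> / a) * T_in t' b (cube n) x y"
        using T_in_perturb[OF ab(1) ab'(2) cv t(2) _ _ xy, of \<rho>] T_in_perturb[OF ab(1) ab'(2) t(2) cv _ _ xy, of \<rho>] \<rho> by auto
      then show "\<bar>T_in t' b (cube n) x y - h (x - y)\<bar> \<le> \<epsilon> * real n"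
        using Tv small[OF cv] small[OF t(2)] unfolding distrib_right mult_1_left abs_le_iff by linarith
    qed (use F G in auto)
  qed
qed

section \<open>Measurability\<close>

lemma countable_edges: "countable (edges :: (int ^ 'n::finite) set set)"
proof -
  have "edges \<subseteq> (\<lambda>(v, w). {v, w}) ` (UNIV :: ((int ^ 'n) \<times> (int ^ 'n)) set)" by (auto simp: edges_def)
  moreover have "countable (UNIV :: ((int ^ 'n) \<times> (int ^ 'n)) set)" by simp
  ultimately show ?thesis by (metis countable_image countable_subset)
qed

abbreviation weights_algebra :: "((int ^ 'n::finite) set \<Rightarrow> real) measure" where
  "weights_algebra \<equiv> PiM edges (\<lambda>_. borel)"

text \<open>The edges that the choice in \<open>step_time\<close> assigns to some pair of distinct
  points of X. Their signs decide whether all steps are nonnegative, a condition on countably many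
  weights.\<close>

definition used_edges :: "(real ^ 'n::finite) set \<Rightarrow> (int ^ 'n) set set" where
  "used_edges X = {e\<in>edges. \<exists>y\<in>X. \<exists>z\<in>X. y \<noteq> z \<and> on_edge e y z \<and> e = edge_through y z}"

lemma l1norm_pos: "y \<noteq> z \<Longrightarrow> 0 < l1norm (y - z)"
  using l1norm_nonneg[of "y - z"] l1norm_eq_0_iff[of "y - z"] by simp

lemma step_nonneg_iff:
  assumes "0 \<le> b"
  shows "(\<forall>y\<in>X. \<forall>z\<in>X. 0 \<le> step_time t b y z) \<longleftrightarrow> (\<forall>e\<in>used_edges X. 0 \<le> t e)"
proof safe
  fix e assume st: "\<forall>y\<in>X. \<forall>z\<in>X. 0 \<le> step_time t b y z" and "e \<in> used_edges X"
  then obtain y z where yz: "y \<in> X" "z \<in> X" "y \<noteq> z" "on_edge e y z" "e = edge_through y z"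
    by (auto simp: used_edges_def)
  have "0 \<le> t e * l1norm (y - z)" using st yz step_time_on_edge[OF yz(4), of t b] by (metis)
  then show "0 \<le> t e" using l1norm_pos[OF yz(3)] by (simp add: zero_le_mult_iff)
next
  fix y z assume t: "\<forall>e\<in>used_edges X. 0 \<le> t e" and yz: "y \<in> X" "z \<in> X"
  show "0 \<le> step_time t b y z"
  proof (cases "y = z")
    case False
    show ?thesis
    proof (rule step_time_cases[of y z b])
      fix e assume e: "on_edge e y z" "e = edge_through y z" "e \<in> edges" "\<And>t. step_time t b y z = t e * l1norm (y - z)"
      then have "e \<in> used_edges X" using yz False by (auto simp: used_edges_def)
      then show ?thesis unfolding e(4) using t by (intro mult_nonneg_nonneg l1norm_nonneg) auto
    qed (use assms in \<open>simp add: l1norm_nonneg\<close>)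
  qed simp
qed

text \<open>The real infimum unfolds to a least upper bound of the negated set. If the set is
  unbounded below, this is a choice under a predicate that is false everywhere, so the value does
  not depend on the set.\<close>

lemma Inf_not_bdd_below:
  fixes A :: "real set"
  assumes "\<not> bdd_below A"
  shows "Inf A = Inf UNIV"
proof -
  have "\<not> (\<forall>x\<in>uminus ` A. x \<le> z)" for z
  proof
    assume "\<forall>x\<in>uminus ` A. x \<le> z"
    then have "\<forall>x\<in>A. -z \<le> x" by force
    then show False using assms by (meson bdd_belowI)
  qed
  moreover have "\<not> (\<forall>x\<in>uminus ` (UNIV::real set). x \<le> z)" for z
  proof
    assume "\<forall>x\<in>uminus ` (UNIV::real set). x \<le> z"
    then have "- (- z - 1) \<le> z" by blast
    then show False by simp
  qed
  ultimately have "(\<lambda>z. \<forall>x\<in>uminus ` A. x \<le> z) = (\<lambda>z. \<forall>x\<in>uminus ` (UNIV::real set). x \<le> z)"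
    by (intro ext) (simp only:)
  then show ?thesis by (simp only: Inf_real_def Sup_real_def)
qed

text \<open>Walking back and forth along an edge of negative weight makes the passage time the infimum
  of an unbounded set, which is an unspecified constant.\<close>

lemma T_in_unbounded:
  assumes neg: "\<not> (\<forall>y\<in>X. \<forall>z\<in>X. 0 \<le> step_time t b y z)" and xy: "x \<in> X" "y \<in> X"
  shows "T_in t b X x y = Inf UNIV"
  unfolding T_in_def
proof (rule Inf_not_bdd_below)
  obtain u v where uv: "u \<in> X" "v \<in> X" "step_time t b u v < 0" using neg by (auto simp: not_le)
  define L where "L k = [x, u] @ concat (replicate k [v, u])" for k
  have L0: "L k \<noteq> []" for k by (simp add: L_def)
  have L: "hd (L k) = x \<and> last (L k) = u \<and> set (L k) \<subseteq> X \<and> path_time t b (L k) = step_time t b x u + 2 * real k * step_time t b u v" for k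
  proof (induction k)
    case (Suc k)
    have "concat (replicate (Suc k) [v, u]) = concat (replicate k [v, u]) @ [v, u]"
      by (induction k) auto
    then have "L (Suc k) = (L k @ [v]) @ [u]" by (simp add: L_def)
    moreover have "path_time t b ((L k @ [v]) @ [u]) = path_time t b (L k) + step_time t b u v + step_time t b v u"
      using Suc L0[of k] by (subst path_time_snoc) (simp_all add: path_time_snoc)
    ultimately show ?case
      using Suc uv L0[of k] step_time_commute[of t b v u]
      by (simp add: algebra_simps)
  qed (use uv xy in \<open>simp add: L_def\<close>)
  show "\<not> bdd_below (path_time t b ` paths X x y)"
  proof
    assume "bdd_below (path_time t b ` paths X x y)"
    then obtain c where c: "\<And>xs. xs \<in> paths X x y \<Longrightarrow> c \<le> path_time t b xs" by (auto simp: bdd_below_def)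
    have low: "c \<le> step_time t b x u + 2 * real k * step_time t b u v + step_time t b u y" for k
    proof -
      have "L k @ [y] \<in> paths X x y" using L[of k] L0[of k] xy by (auto simp: paths_def)
      from c[OF this] show ?thesis using L[of k] L0[of k] by (simp add: path_time_snoc)
    qed
    obtain k :: nat where "(step_time t b x u + step_time t b u y - c) / (- 2 * step_time t b u v) < real k"
      using reals_Archimedean2 by blast
    then have "step_time t b x u + step_time t b u y - c < real k * (- 2 * step_time t b u v)"
      using uv by (subst (asm) pos_divide_less_eq) auto
    moreover have "real k * (- 2 * step_time t b u v) = - (2 * real k * step_time t b u v)" by simp
    ultimately show False using low[of k] by linarith
  qed
qed

definition path_edges :: "(real ^ 'n::finite) list \<Rightarrow> (int ^ 'n) set set" where
  "path_edges xs = {edge_through (xs ! i) (xs ! Suc i) |i. i < length xs - 1} \<inter> edges"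

lemma finite_path_edges: "finite (path_edges xs)"
proof -
  have "path_edges xs \<subseteq> (\<lambda>i. edge_through (xs ! i) (xs ! Suc i)) ` {..<length xs - 1}" by (auto simp: path_edges_def)
  then show ?thesis by (rule finite_subset) simp
qed

definition l1_length :: "(real ^ 'n::finite) list \<Rightarrow> real" where
  "l1_length xs = (\<Sum>i<length xs - 1. l1norm (xs ! i - xs ! Suc i))"

lemma path_time_le:
  assumes \<gamma>: "0 \<le> \<gamma>" and le: "\<And>e. e \<in> path_edges xs \<Longrightarrow> t' e \<le> t e + \<gamma>"
  shows "path_time t' b xs \<le> path_time t b xs + \<gamma> * l1_length xs"
  unfolding path_time_def l1_length_def sum_distrib_left sum.distrib[symmetric]
proof (rule sum_mono)
  fix i assume i: "i \<in> {..<length xs - 1}"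
  let ?y = "xs ! i" and ?z = "xs ! Suc i"
  show "step_time t' b ?y ?z \<le> step_time t b ?y ?z + \<gamma> * l1norm (?y - ?z)"
  proof (rule step_time_cases[of ?y ?z b])
    fix e assume e: "e = edge_through ?y ?z" "e \<in> edges" "\<And>t. step_time t b ?y ?z = t e * l1norm (?y - ?z)"
    then have "e \<in> path_edges xs" using i by (auto simp: path_edges_def)
    then have "t' e * l1norm (?y - ?z) \<le> (t e + \<gamma>) * l1norm (?y - ?z)" by (intro mult_right_mono le l1norm_nonneg)
    then show ?thesis unfolding e(3) by (simp add: algebra_simps)
  qed (use \<gamma> in \<open>simp add: l1norm_nonneg\<close>)
qed

lemma Rats_dense_in_interval:
  fixes r :: real
  assumes "0 < \<gamma>"
  shows "\<exists>q\<in>\<rat>. r \<le> q \<and> q \<le> r + \<gamma>"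
  using Rats_dense_in_real[of r "r + \<gamma>"] assms by (auto intro: less_imp_le)

text \<open>If some path beats \<open>c\<close> under \<open>t\<close>, then it does so under a rational majorant of \<open>t\<close> on the
  finitely many edges of the path, and there are only countably many such majorants.\<close>

lemma T_in_measurable:
  fixes X :: "(real ^ 'n::finite) set"
  assumes b: "0 \<le> b" and xy: "x \<in> X" "y \<in> X"
  shows "(\<lambda>t. T_in t b X x y) \<in> borel_measurable weights_algebra"
proof (rule borel_measurable_iff_less[THEN iffD2], rule allI)
  fix c
  let ?\<Omega> = "weights_algebra :: ((int ^ 'n) set \<Rightarrow> real) measure"
  define good where "good = {t \<in> space ?\<Omega>. \<forall>e\<in>used_edges X. 0 \<le> t e}"
  have cu: "countable (used_edges X)"
    by (rule countable_subset[OF _ countable_edges]) (auto simp: used_edges_def)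
  have m[measurable]: "(\<lambda>t. t e) \<in> borel_measurable ?\<Omega>" if "e \<in> edges" for e
    using that by (rule measurable_component_singleton)
  have good_sets: "good \<in> sets ?\<Omega>"
    unfolding good_def
  proof (rule sets.sets_Collect_countable_All'[OF _ cu])
    fix e assume "e \<in> used_edges X"
    then have [measurable]: "(\<lambda>t. t e) \<in> borel_measurable ?\<Omega>" using m by (auto simp: used_edges_def)
    show "{t \<in> space ?\<Omega>. 0 \<le> t e} \<in> sets ?\<Omega>" by measurable
  qed
  define Q where "Q = {(D, q). (D, q) \<in> (SIGMA D:{D. finite D \<and> D \<subseteq> edges}. PiE D (\<lambda>_. \<rat>))
    \<and> (\<exists>xs\<in>paths X x y. \<forall>t. (\<forall>e\<in>D. t e \<le> q e) \<longrightarrow> path_time t b xs < c)}"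
  define O' where "O' Dq = {t \<in> space ?\<Omega>. \<forall>e\<in>fst Dq. t e \<le> snd Dq e}" for Dq
  have "countable (SIGMA D:{D. finite D \<and> D \<subseteq> (edges :: (int ^ 'n) set set)}. PiE D (\<lambda>_. \<rat> :: real set))"
    by (intro countable_SIGMA countable_Collect_finite_subset countable_edges countable_PiE) (auto simp: countable_rat)
  then have cQ: "countable Q" by (rule countable_subset[rotated]) (auto simp: Q_def)
  have Osets: "O' Dq \<in> sets ?\<Omega>" if "Dq \<in> Q" for Dq
    unfolding O'_def
  proof (rule sets.sets_Collect_countable_All')
    show "countable (fst Dq)" using that by (auto simp: Q_def countable_finite)
    fix e assume "e \<in> fst Dq"
    then have [measurable]: "(\<lambda>t. t e) \<in> borel_measurable ?\<Omega>" using m that by (auto simp: Q_def)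
    show "{t \<in> space ?\<Omega>. t e \<le> snd Dq e} \<in> sets ?\<Omega>" by measurable
  qed
  have lt: "T_in t b X x y < c \<longleftrightarrow> (\<exists>Dq\<in>Q. t \<in> O' Dq)" if t: "t \<in> good" for t
  proof
    have st: "\<And>y z. y \<in> X \<Longrightarrow> z \<in> X \<Longrightarrow> 0 \<le> step_time t b y z"
      using t step_nonneg_iff[OF b, of X t] by (auto simp: good_def)
    show "T_in t b X x y < c" if Dq: "\<exists>Dq\<in>Q. t \<in> O' Dq"
    proof -
      obtain xs where "xs \<in> paths X x y" "path_time t b xs < c" using Dq by (auto simp: Q_def O'_def)
      then show ?thesis using order_le_less_trans[OF T_in_le_path[OF st]] by blast
    qed
    assume "T_in t b X x y < c"
    moreover have "paths X x y \<noteq> {}" using paths_nonempty[OF xy] by blast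
    moreover have "bdd_below (path_time t b ` paths X x y)"
      by (rule bdd_belowI[of _ 0]) (auto simp: paths_def intro!: path_time_nonneg[OF st])
    ultimately have "\<exists>xs\<in>paths X x y. path_time t b xs < c"
      unfolding T_in_def by (simp add: cINF_less_iff)
    then obtain xs where xs: "xs \<in> paths X x y" "path_time t b xs < c" by blast
    have l0: "0 \<le> l1_length xs" unfolding l1_length_def by (intro sum_nonneg l1norm_nonneg)
    \<comment> \<open>Raising the weights along the path by \<gamma> uses at most half of the slack
      below c; the added 1 avoids division by zero for paths of length zero.\<close>
    define \<gamma> where "\<gamma> = (c - path_time t b xs) / (2 * (l1_length xs + 1))"
    have \<gamma>: "0 < \<gamma>" using xs l0 by (simp add: \<gamma>_def)
    have "\<gamma> * l1_length xs \<le> \<gamma> * (l1_length xs + 1)" using \<gamma> by simp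
    also have "\<dots> = (c - path_time t b xs) / 2" using l0 by (simp add: \<gamma>_def field_simps)
    finally have \<gamma>l: "path_time t b xs + \<gamma> * l1_length xs < c" using xs(2) by simp
    have "\<forall>e. \<exists>q\<in>\<rat>. t e \<le> q \<and> q \<le> t e + \<gamma>" using Rats_dense_in_interval[OF \<gamma>] by blast
    then obtain q where q: "\<And>e. q e \<in> \<rat> \<and> t e \<le> q e \<and> q e \<le> t e + \<gamma>" by metis
    let ?D = "path_edges xs"
    have "(?D, restrict q ?D) \<in> Q"
      unfolding Q_def
    proof (clarsimp, intro conjI bexI[OF _ xs(1)] allI impI)
      show "finite ?D" by (rule finite_path_edges)
      show "?D \<subseteq> edges" by (auto simp: path_edges_def)
      fix t' assume t': "\<forall>e\<in>?D. t' e \<le> q e"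
      have "path_time t' b xs \<le> path_time t b xs + \<gamma> * l1_length xs"
        by (rule path_time_le) (use \<gamma> t' q in \<open>auto intro: order_trans\<close>)
      then show "path_time t' b xs < c" using \<gamma>l by simp
    qed (use q in auto)
    moreover have "t \<in> O' (?D, restrict q ?D)" using t q by (auto simp: O'_def good_def)
    ultimately show "\<exists>Dq\<in>Q. t \<in> O' Dq" by blast
  qed
  have bad: "T_in t b X x y = Inf UNIV" if "t \<in> space ?\<Omega>" "t \<notin> good" for t
    using T_in_unbounded[OF _ xy, of t b] that step_nonneg_iff[OF b, of X t] by (auto simp: good_def)
  have "{t \<in> space ?\<Omega>. T_in t b X x y < c} = (good \<inter> (\<Union>Dq\<in>Q. O' Dq)) \<union> (if Inf (UNIV :: real set) < c then space ?\<Omega> - good else {})"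
  proof (rule set_eqI)
    fix t
    show "t \<in> {t \<in> space ?\<Omega>. T_in t b X x y < c} \<longleftrightarrow>
        t \<in> (good \<inter> (\<Union>Dq\<in>Q. O' Dq)) \<union> (if Inf (UNIV :: real set) < c then space ?\<Omega> - good else {})"
    proof (cases "t \<in> good")
      case True
      then show ?thesis using lt[OF True] by (auto simp: good_def)
    next
      case False
      then show ?thesis using bad[of t] by auto
    qed
  qed
  also have "\<dots> \<in> sets ?\<Omega>"
    using good_sets cQ Osets by (intro sets.Un sets.Int sets.countable_UN') (auto intro: sets.compl_sets)
  finally show "{t \<in> space ?\<Omega>. T_in t b X x y < c} \<in> sets ?\<Omega>" .
qed

lemma finite_used_edges_cube: "finite (used_edges (cube n) :: (int ^ 'n::finite) set set)"
proof -
  define V where "V = {v :: int ^ 'n. \<forall>j. v $ j \<in> {-1..int n}}"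
  have V: "finite V" unfolding V_def by (rule finite_lattice_box) simp
  have "\<exists>v\<in>V. \<exists>j. e = {v, v + axis j 1}" if eu: "e \<in> used_edges (cube n)" for e :: "(int ^ 'n) set"
  proof -
    obtain z where z: "e \<in> edges" "z \<in> cube n" "z \<in> points_of e" using eu by (auto simp: used_edges_def on_edge_iff)
    obtain v j where vj: "e = {v, v + axis j 1}" using edges_cases[OF z(1)] .
    have "v $ m \<in> {-1..int n}" for m
    proof -
      have "-1 \<le> real_of_int (v $ m)" "real_of_int (v $ m) \<le> real_of_int (int n)"
        using points_of_coordinates[of z v j m] z vj by (auto simp: cube_def) (smt (verit))+
      then show ?thesis by simp
    qed
    then have "v \<in> V" by (simp add: V_def)
    then show ?thesis using vj by blast
  qed
  then show ?thesis using card_edges_from_vertices(1)[OF V] by blast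
qed

definition LD_weights :: "real \<Rightarrow> nat \<Rightarrow> (real ^ 'n::finite \<Rightarrow> real) \<Rightarrow> real \<Rightarrow> ((int ^ 'n) set \<Rightarrow> real) set" where
  "LD_weights b n g \<epsilon> = {t \<in> space weights_algebra. d_infty (norm_metric g) (T_scaled t b n unit_cube) \<le> ereal \<epsilon>}"

lemma d_infty_le_iff:
  fixes g :: "real ^ 'n::finite \<Rightarrow> real"
  assumes n: "0 < n" and g: "g \<in> norms a b"
  shows "d_infty (norm_metric g) (T_scaled t b' n unit_cube) \<le> ereal \<epsilon> \<longleftrightarrow>
    (\<forall>x\<in>cube n. \<forall>y\<in>cube n. \<bar>T_in t b' (cube n) x y - g (x - y)\<bar> \<le> \<epsilon> * real n)"
proof -
  have "d_infty (norm_metric g) (T_scaled t b' n unit_cube) \<le> ereal \<epsilon> \<longleftrightarrow>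
      (\<forall>x\<in>unit_cube. \<forall>y\<in>unit_cube. \<bar>g (x - y) - T_scaled t b' n unit_cube x y\<bar> \<le> \<epsilon>)"
    by (auto simp: d_infty_def SUP_le_iff norm_metric_def)
  also have "\<dots> \<longleftrightarrow> (\<forall>x\<in>unit_cube. \<forall>y\<in>unit_cube.
      \<bar>T_in t b' (cube n) (real n *\<^sub>R x) (real n *\<^sub>R y) - g (real n *\<^sub>R x - real n *\<^sub>R y)\<bar> \<le> \<epsilon> * real n)"
  proof (intro ball_cong refl)
    fix x y :: "real ^ 'n"
    have "g (real n *\<^sub>R x - real n *\<^sub>R y) = real n * g (x - y)"
      by (simp add: normsD(2)[OF g] flip: scaleR_diff_right)
    moreover have "T_in t b' (cube n) (real n *\<^sub>R x) (real n *\<^sub>R y) = real n * T_scaled t b' n unit_cube x y"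
      using n by (simp add: T_scaled_def scaled_unit_cube)
    ultimately have "T_in t b' (cube n) (real n *\<^sub>R x) (real n *\<^sub>R y) - g (real n *\<^sub>R x - real n *\<^sub>R y)
        = real n * (T_scaled t b' n unit_cube x y - g (x - y))"
      by (simp add: right_diff_distrib)
    then show "\<bar>g (x - y) - T_scaled t b' n unit_cube x y\<bar> \<le> \<epsilon> \<longleftrightarrow>
      \<bar>T_in t b' (cube n) (real n *\<^sub>R x) (real n *\<^sub>R y) - g (real n *\<^sub>R x - real n *\<^sub>R y)\<bar> \<le> \<epsilon> * real n"
      using n by (simp only: abs_mult abs_minus_commute[of "g (x - y)"]) (simp add: mult.commute)
  qed
  finally show ?thesis unfolding scaled_unit_cube[OF n, symmetric] by simp
qed

lemma countable_dense_cube: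
  obtains C :: "(real ^ 'n::finite) set" where "countable C" "C \<subseteq> cube n"
    "\<And>x e. x \<in> cube n \<Longrightarrow> 0 < e \<Longrightarrow> \<exists>c\<in>C. l1norm (x - c) \<le> e"
proof (cases "n = 0")
  case True
  show ?thesis
  proof (rule that[of "{0}"])
    fix x :: "real ^ 'n" and e :: real assume x: "x \<in> cube n" and e: "0 < e"
    have "x = 0" using x True by (simp add: cube_def vec_eq_iff order_antisym)
    then show "\<exists>c\<in>{0}. l1norm (x - c) \<le> e" using e by simp
  qed (auto simp: zero_in_cube)
next
  case False
  then have n: "0 < n" by simp
  define Z where "Z k = (SOME Z. finite Z \<and> Z \<subseteq> (unit_cube :: (real ^ 'n) set) \<and> (\<forall>x\<in>unit_cube. \<exists>z\<in>Z. l1norm (x - z) \<le> 1 / real (Suc k)))" for k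
  have Z: "finite (Z k) \<and> Z k \<subseteq> unit_cube \<and> (\<forall>x\<in>unit_cube. \<exists>z\<in>Z k. l1norm (x - z) \<le> 1 / real (Suc k))" for k
  proof -
    obtain Z' :: "(real ^ 'n) set" where "finite Z'" "Z' \<subseteq> unit_cube" "\<And>x. x \<in> unit_cube \<Longrightarrow> \<exists>z\<in>Z'. l1norm (x - z) \<le> 1 / real (Suc k)"
      using finite_net[of "1 / real (Suc k)"] by auto
    then show ?thesis unfolding Z_def by (intro someI_ex[of "\<lambda>Z. finite Z \<and> Z \<subseteq> unit_cube \<and> (\<forall>x\<in>unit_cube. \<exists>z\<in>Z. l1norm (x - z) \<le> 1 / real (Suc k))"]) blast
  qed
  let ?C = "(\<lambda>z. real n *\<^sub>R z) ` (\<Union>k. Z k)"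
  show ?thesis
  proof (rule that[of ?C])
    show "countable ?C" using Z by (intro countable_image countable_UN) (auto intro: countable_finite)
    show "?C \<subseteq> cube n" using Z by (auto intro!: scaleR_in_cube)
    fix x :: "real ^ 'n" and e :: real assume x: "x \<in> cube n" and e: "0 < e"
    obtain u where u: "u \<in> unit_cube" "x = real n *\<^sub>R u" using x unfolding scaled_unit_cube[OF n, symmetric] by blast
    obtain k where k: "real n / e < real k" using reals_Archimedean2 by blast
    obtain z where z: "z \<in> Z k" "l1norm (u - z) \<le> 1 / real (Suc k)" using Z u(1) by blast
    have "l1norm (x - real n *\<^sub>R z) = real n * l1norm (u - z)"
      by (simp add: u(2) l1norm_scaleR flip: scaleR_diff_right)
    also have "\<dots> \<le> real n * (1 / real (Suc k))" using z by (intro mult_left_mono) auto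
    also have "\<dots> \<le> e" using k e by (simp add: field_simps)
    finally show "\<exists>c\<in>?C. l1norm (x - c) \<le> e" using z by blast
  qed
qed

text \<open>For nonnegative used weights the passage time is Lipschitz, so a countable dense set of
  pairs decides the event. Otherwise it is the constant \<open>Inf UNIV\<close> at all pairs, and
  the event contains all such configurations or none.\<close>

lemma LD_weights_sets:
  fixes g :: "real ^ 'n::finite \<Rightarrow> real"
  assumes n: "0 < n" and b: "0 \<le> b" and g: "g \<in> norms a b"
  shows "LD_weights b n g \<epsilon> \<in> sets weights_algebra"
proof -
  let ?\<Omega> = "weights_algebra :: ((int ^ 'n) set \<Rightarrow> real) measure"
  let ?X = "cube n :: (real ^ 'n) set"
  obtain C :: "(real ^ 'n) set" where C: "countable C" "C \<subseteq> ?X"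
    "\<And>x e. x \<in> ?X \<Longrightarrow> 0 < e \<Longrightarrow> \<exists>c\<in>C. l1norm (x - c) \<le> e" using countable_dense_cube[of n] by metis
  define good where "good = {t \<in> space ?\<Omega>. \<forall>e\<in>used_edges ?X. 0 \<le> t e}"
  have m: "(\<lambda>t. t e) \<in> borel_measurable ?\<Omega>" if "e \<in> edges" for e
    using that by (rule measurable_component_singleton)
  have good_sets: "good \<in> sets ?\<Omega>"
    unfolding good_def
  proof (rule sets.sets_Collect_countable_All'[OF _ countable_finite[OF finite_used_edges_cube]])
    fix e assume "e \<in> used_edges ?X"
    then have [measurable]: "(\<lambda>t. t e) \<in> borel_measurable ?\<Omega>" using m by (auto simp: used_edges_def)
    show "{t \<in> space ?\<Omega>. 0 \<le> t e} \<in> sets ?\<Omega>" by measurable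
  qed
  define L where "L = {t \<in> space ?\<Omega>. \<forall>x\<in>C. \<forall>y\<in>C. \<bar>T_in t b ?X x y - g (x - y)\<bar> \<le> \<epsilon> * real n}"
  have L: "L \<in> sets ?\<Omega>"
    unfolding L_def
  proof (intro sets.sets_Collect_countable_All' C(1))
    fix x y assume "x \<in> C" "y \<in> C"
    then have [measurable]: "(\<lambda>t. T_in t b ?X x y) \<in> borel_measurable ?\<Omega>"
      using C(2) by (intro T_in_measurable b) auto
    show "{t \<in> space ?\<Omega>. \<bar>T_in t b ?X x y - g (x - y)\<bar> \<le> \<epsilon> * real n} \<in> sets ?\<Omega>" by measurable
  qed
  define bad where "bad \<longleftrightarrow> (\<forall>x\<in>?X. \<forall>y\<in>?X. \<bar>Inf UNIV - g (x - y)\<bar> \<le> \<epsilon> * real n)"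
  have "LD_weights b n g \<epsilon> = (good \<inter> L) \<union> (if bad then space ?\<Omega> - good else {})"
  proof (rule set_eqI)
    fix t
    show "t \<in> LD_weights b n g \<epsilon> \<longleftrightarrow> t \<in> (good \<inter> L) \<union> (if bad then space ?\<Omega> - good else {})"
    proof (cases "t \<in> space ?\<Omega>")
      case False
      then show ?thesis by (auto simp: LD_weights_def good_def)
    next
      case t: True
      show ?thesis
      proof (cases "t \<in> good")
        case False
        then have "\<not> (\<forall>y\<in>?X. \<forall>z\<in>?X. 0 \<le> step_time t b y z)"
          using t step_nonneg_iff[OF b, of ?X t] by (auto simp: good_def)
        then have "T_in t b ?X x y = Inf UNIV" if "x \<in> ?X" "y \<in> ?X" for x y
          using T_in_unbounded that by blast
        then show ?thesis using t False by (simp add: LD_weights_def d_infty_le_iff[OF n g] bad_def)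
      next
        case True
        then have st: "\<And>y z. y \<in> ?X \<Longrightarrow> z \<in> ?X \<Longrightarrow> 0 \<le> step_time t b y z"
          using step_nonneg_iff[OF b, of ?X t] by (auto simp: good_def)
        \<comment> \<open>A Lipschitz constant for this one configuration; only finitely many edges
          are used in the cube, and dependence on t is harmless.\<close>
        define c where "c = Max (insert b (t ` used_edges ?X))"
        have c: "b \<le> c" "\<And>e. e \<in> used_edges ?X \<Longrightarrow> t e \<le> c"
          unfolding c_def using finite_used_edges_cube[where 'n = 'n, of n] by auto
        have stc: "step_time t b y z \<le> c * l1norm (y - z)" if yz: "y \<in> ?X" "z \<in> ?X" for y z
        proof (cases "y = z")
          case False
          show ?thesis
          proof (rule step_time_cases[of y z b])
            fix e assume e: "on_edge e y z" "e = edge_through y z" "e \<in> edges" "\<And>t. step_time t b y z = t e * l1norm (y - z)"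
            then have "e \<in> used_edges ?X" using yz False by (auto simp: used_edges_def)
            then show ?thesis unfolding e(4) using c(2) by (intro mult_right_mono l1norm_nonneg)
          next
            assume "\<And>t. step_time t b y z = b * l1norm (y - z)"
            then show ?thesis using c(1) by (simp add: mult_right_mono l1norm_nonneg)
          qed
        qed simp
        have "(\<forall>x\<in>?X. \<forall>y\<in>?X. \<bar>T_in t b ?X x y - g (x - y)\<bar> \<le> \<epsilon> * real n)" if tL: "t \<in> L"
        proof (intro ballI, rule field_le_epsilon)
          fix x y :: "real ^ 'n" and e :: real assume xy: "x \<in> ?X" "y \<in> ?X" and e: "0 < e"
          define \<delta> where "\<delta> = e / (2 * (c + b + 1))"
          have \<delta>: "0 < \<delta>" using e b c by (simp add: \<delta>_def)
          have \<delta>e: "(c + b) * (2 * \<delta>) \<le> e"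
          proof -
            have "2 * \<delta> = e / (c + b + 1)" unfolding \<delta>_def times_divide_eq_right by (rule mult_divide_mult_cancel_left) simp
            then have "(c + b) * (2 * \<delta>) = e * ((c + b) / (c + b + 1))" by simp
            also have "\<dots> \<le> e * 1" using e b c by (intro mult_left_mono) auto
            finally show ?thesis by simp
          qed
          obtain x' where x': "x' \<in> C" "l1norm (x - x') \<le> \<delta>" using C(3)[OF xy(1) \<delta>] by blast
          obtain y' where y': "y' \<in> C" "l1norm (y - y') \<le> \<delta>" using C(3)[OF xy(2) \<delta>] by blast
          have X': "x' \<in> ?X" "y' \<in> ?X" using x' y' C(2) by auto
          have s: "l1norm (x - x') + l1norm (y - y') \<le> 2 * \<delta>" using x' y' by simp
          have "\<bar>T_in t b ?X x y - T_in t b ?X x' y'\<bar> \<le> c * (l1norm (x - x') + l1norm (y - y'))"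
            by (rule nonneg_T_in_diff_le[OF st stc xy X'])
          also have "\<dots> \<le> c * (2 * \<delta>)" using s b c by (intro mult_left_mono) auto
          finally have 1: "\<bar>T_in t b ?X x y - T_in t b ?X x' y'\<bar> \<le> c * (2 * \<delta>)" .
          have "g (x - y) \<le> g (x' - y') + g ((x - x') + (y' - y))" "g (x' - y') \<le> g (x - y) + g (- ((x - x') + (y' - y)))"
            using normsD(3)[OF g, of "x' - y'" "(x - x') + (y' - y)"] normsD(3)[OF g, of "x - y" "- ((x - x') + (y' - y))"]
            by (simp_all add: algebra_simps)
          then have "\<bar>g (x' - y') - g (x - y)\<bar> \<le> g ((x - x') + (y' - y))" by (simp add: norms_minus[OF g] abs_le_iff del: minus_add_distrib)
          also have "\<dots> \<le> b * l1norm ((x - x') + (y' - y))" by (rule normsD(6)[OF g])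
          also have "\<dots> \<le> b * (2 * \<delta>)"
            using b s l1norm_triangle[of "x - x'" "y' - y"] by (intro mult_left_mono) (auto simp: l1norm_minus_commute[of y'])
          finally have 2: "\<bar>g (x' - y') - g (x - y)\<bar> \<le> b * (2 * \<delta>)" .
          have "\<bar>T_in t b ?X x' y' - g (x' - y')\<bar> \<le> \<epsilon> * real n" using tL x' y' by (auto simp: L_def)
          then show "\<bar>T_in t b ?X x y - g (x - y)\<bar> \<le> \<epsilon> * real n + e" using 1 2 \<delta>e by (simp add: distrib_right)
        qed
        then show ?thesis using t True C(2) by (auto simp: LD_weights_def d_infty_le_iff[OF n g] L_def)
      qed
    qed
  qed
  also have "\<dots> \<in> sets ?\<Omega>" using good_sets L by auto
  finally show ?thesis .
qed

lemma step_time_cong: "(\<And>e. e \<in> edges \<Longrightarrow> t e = t' e) \<Longrightarrow> step_time t b y z = step_time t' b y z"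
  by (rule step_time_cases[of y z b]) auto

lemma T_in_cong: "(\<And>e. e \<in> edges \<Longrightarrow> t e = t' e) \<Longrightarrow> T_in t b X x y = T_in t' b X x y"
  unfolding T_in_def path_time_def using step_time_cong[of t t'] by presburger

lemma LD_eq:
  "LD M \<tau> b n g \<epsilon> = {\<omega> \<in> space M. (\<lambda>e\<in>edges. \<tau> e \<omega>) \<in> LD_weights b n g \<epsilon>}"
proof -
  have "T_scaled (\<lambda>e. \<tau> e \<omega>) b n unit_cube = T_scaled (\<lambda>e\<in>edges. \<tau> e \<omega>) b n unit_cube" for \<omega>
    unfolding T_scaled_def using T_in_cong[of "\<lambda>e. \<tau> e \<omega>" "\<lambda>e\<in>edges. \<tau> e \<omega>"] by (intro ext) simp
  then show ?thesis by (auto simp: LD_def LD_weights_def space_PiM)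
qed

section \<open>The law of the weights\<close>

text \<open>Each point of U has a null ball around it; by Lindelof countably many of them cover
  U.\<close>

lemma null_if_disjoint_support:
  assumes \<nu>: "prob_space \<nu>" "sets \<nu> = sets borel" and U: "open U" "U \<inter> measure_support \<nu> = {}"
  shows "U \<in> null_sets \<nu>"
proof -
  interpret prob_space \<nu> by fact
  define \<F> where "\<F> = {ball x \<epsilon> |x \<epsilon>. x \<in> U \<and> 0 < \<epsilon> \<and> measure \<nu> (ball x \<epsilon>) = 0}"
  obtain \<F>' where \<F>': "\<F>' \<subseteq> \<F>" "countable \<F>'" "\<Union>\<F>' = \<Union>\<F>"
    by (rule Lindelof[of \<F>]) (auto simp: \<F>_def)
  have "U \<subseteq> \<Union>\<F>"
  proof
    fix x assume x: "x \<in> U"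
    then obtain \<epsilon> where "0 < \<epsilon>" "\<not> 0 < measure \<nu> (ball x \<epsilon>)" using U(2) by (auto simp: measure_support_def)
    then have "ball x \<epsilon> \<in> \<F>" "x \<in> ball x \<epsilon>" using x measure_nonneg[of \<nu> "ball x \<epsilon>"] by (auto simp: \<F>_def)
    then show "x \<in> \<Union>\<F>" by blast
  qed
  moreover have "\<Union>\<F>' \<in> null_sets \<nu>"
  proof -
    have "B \<in> null_sets \<nu>" if "B \<in> \<F>'" for B
      using that \<F>'(1) \<nu>(2) by (auto simp: \<F>_def null_sets_def emeasure_eq_measure)
    then show ?thesis using null_sets_UN'[OF \<F>'(2), of "\<lambda>B. B" \<nu>] by simp
  qed
  ultimately show ?thesis using \<F>'(3) null_sets_subset[of "\<Union>\<F>'" \<nu> U] U(1) \<nu>(2) by simp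
qed

locale fpp = prob_space M for M :: "'w measure" +
  fixes \<tau> :: "(int ^ 'n::finite) set \<Rightarrow> 'w \<Rightarrow> real" and \<nu> :: "real measure" and a b :: real
  assumes d2: "CARD('n) \<ge> 2"
    and \<nu>: "prob_space \<nu>" "sets \<nu> = sets borel"
    and a_def: "ereal a = (INF x\<in>measure_support \<nu>. ereal x)"
    and b_def: "ereal b = (SUP x\<in>measure_support \<nu>. ereal x)"
    and indep: "indep_vars (\<lambda>_. borel) \<tau> edges"
    and law: "\<forall>e\<in>edges. distr M borel (\<tau> e) = \<nu>"
    and ab: "0 < a" "a < b"
begin

interpretation nu: prob_space \<nu> by (rule \<nu>(1))

lemma support_bounds: "x \<in> measure_support \<nu> \<Longrightarrow> a \<le> x \<and> x \<le> b"
  using INF_lower[of x "measure_support \<nu>" ereal] SUP_upper[of x "measure_support \<nu>" ereal]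
  unfolding a_def[symmetric] b_def[symmetric] by simp

lemma AE_bounds: "AE x in \<nu>. x \<in> {a..b}"
proof -
  have "{..<a} \<union> {b<..} \<in> null_sets \<nu>"
    by (intro null_sets.Un null_if_disjoint_support \<nu>) (use support_bounds in force)+
  then show ?thesis by (rule AE_I') auto
qed

text \<open>As a is the infimum of the support, a support point lies within \<rho> of it and has a
  ball of positive measure. Intersecting with {a..b} keeps resampled weights in the admissible
  range.\<close>

lemma measure_near_a:
  assumes "0 < \<rho>"
  shows "0 < measure \<nu> ({a - \<rho>..a + \<rho>} \<inter> {a..b})"
proof -
  have "(INF x\<in>measure_support \<nu>. ereal x) < ereal (a + \<rho>)" using assms unfolding a_def[symmetric] by simp
  then obtain x where x: "x \<in> measure_support \<nu>" "x < a + \<rho>" by (auto simp: INF_less_iff)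
  define r where "r = a + \<rho> - x"
  have "0 < measure \<nu> (ball x r)" using x by (simp add: measure_support_def r_def)
  also have "\<dots> \<le> measure \<nu> ({a - \<rho>..a + \<rho>} \<inter> {a..b})"
  proof (rule nu.finite_measure_mono_AE)
    show "AE y in \<nu>. y \<in> ball x r \<longrightarrow> y \<in> {a - \<rho>..a + \<rho>} \<inter> {a..b}"
      using AE_bounds by eventually_elim (use assms in \<open>auto simp: r_def dist_real_def\<close>)
  qed (use \<nu>(2) in simp)
  finally show ?thesis .
qed

lemma measure_near_b:
  assumes "0 < \<rho>"
  shows "0 < measure \<nu> ({b - \<rho>..b + \<rho>} \<inter> {a..b})"
proof -
  have "ereal (b - \<rho>) < (SUP x\<in>measure_support \<nu>. ereal x)" using assms unfolding b_def[symmetric] by simp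
  then obtain x where x: "x \<in> measure_support \<nu>" "b - \<rho> < x" by (auto simp: less_SUP_iff)
  define r where "r = x - (b - \<rho>)"
  have "0 < measure \<nu> (ball x r)" using x by (simp add: measure_support_def r_def)
  also have "\<dots> \<le> measure \<nu> ({b - \<rho>..b + \<rho>} \<inter> {a..b})"
  proof (rule nu.finite_measure_mono_AE)
    show "AE y in \<nu>. y \<in> ball x r \<longrightarrow> y \<in> {b - \<rho>..b + \<rho>} \<inter> {a..b}"
      using AE_bounds by eventually_elim (use assms in \<open>auto simp: r_def dist_real_def\<close>)
  qed (use \<nu>(2) in simp)
  finally show ?thesis .
qed

lemma tau_measurable: "e \<in> edges \<Longrightarrow> \<tau> e \<in> borel_measurable M"
  using indep by (auto simp: indep_vars_def)

definition W :: "'w \<Rightarrow> (int ^ 'n) set \<Rightarrow> real" where "W \<omega> = (\<lambda>e\<in>edges. \<tau> e \<omega>)"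

lemma W_measurable: "W \<in> measurable M weights_algebra"
  unfolding W_def by (intro measurable_restrict tau_measurable)

definition P :: "((int ^ 'n) set \<Rightarrow> real) set \<Rightarrow> real" where
  "P A = prob (W -` A \<inter> space M)"

lemma prob_tau: "e \<in> edges \<Longrightarrow> S \<in> sets borel \<Longrightarrow> prob (\<tau> e -` S \<inter> space M) = measure \<nu> S"
  using law measure_distr[OF tau_measurable, of e S] by auto

lemma P_LD: "prob (LD M \<tau> b n g \<epsilon>) = P (LD_weights b n g \<epsilon>)"
  unfolding P_def LD_eq W_def by (intro arg_cong[where f = prob]) auto

text \<open>The almost sure range of the weights, to which the deterministic estimates apply;
  intersecting an event with it changes no probability.\<close>

definition admissible :: "((int ^ 'n) set \<Rightarrow> real) set" where
  "admissible = {t \<in> space weights_algebra. cfg a b t}"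

lemma admissible_sets: "admissible \<in> sets weights_algebra"
  unfolding admissible_def cfg_def
proof (rule sets.sets_Collect_countable_All'[OF _ countable_edges])
  fix e :: "(int ^ 'n) set" assume "e \<in> edges"
  then have [measurable]: "(\<lambda>t. t e) \<in> borel_measurable weights_algebra" by (rule measurable_component_singleton)
  show "{t \<in> space weights_algebra. a \<le> t e \<and> t e \<le> b} \<in> sets weights_algebra" by measurable
qed

lemma AE_admissible: "AE \<omega> in M. W \<omega> \<in> admissible"
proof -
  have "AE \<omega> in M. \<forall>e\<in>edges. \<tau> e \<omega> \<in> {a..b}"
  proof (rule AE_ball_countable[THEN iffD2, OF countable_edges], rule ballI)
    fix e :: "(int ^ 'n) set" assume e: "e \<in> edges"
    have "distr M borel (\<tau> e) = \<nu>" using law e by blast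
    with AE_bounds have "AE x in distr M borel (\<tau> e). x \<in> {a..b}" by (simp only:)
    then show "AE \<omega> in M. \<tau> e \<omega> \<in> {a..b}" by (subst (asm) AE_distr_iff[OF tau_measurable[OF e]]) auto
  qed
  then show ?thesis
  proof (eventually_elim)
    fix \<omega> assume "\<forall>e\<in>edges. \<tau> e \<omega> \<in> {a..b}"
    then show "W \<omega> \<in> admissible" by (auto simp: admissible_def cfg_def W_def space_PiM)
  qed
qed

lemma P_Int_admissible:
  assumes A: "A \<in> sets weights_algebra"
  shows "P (A \<inter> admissible) = P A"
  unfolding P_def
proof (rule finite_measure_eq_AE)
  show "AE \<omega> in M. \<omega> \<in> W -` (A \<inter> admissible) \<inter> space M \<longleftrightarrow> \<omega> \<in> W -` A \<inter> space M"
    using AE_admissible by eventually_elim simp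
  show "W -` (A \<inter> admissible) \<inter> space M \<in> events" "W -` A \<inter> space M \<in> events"
    using A admissible_sets by (intro measurable_sets[OF W_measurable]; simp)+
qed

lemma P_mono: "A \<subseteq> B \<Longrightarrow> B \<in> sets weights_algebra \<Longrightarrow> P A \<le> P B"
  unfolding P_def using W_measurable by (intro finite_measure_mono) auto

text \<open>Fubini: as soon as the section of \<open>A\<close> over a configuration outside \<open>F\<close> is nonempty, the section
  of \<open>A'\<close> contains the whole product of the sets \<open>S e\<close>.\<close>

lemma resample:
  assumes F: "finite F" "F \<subseteq> edges" and S: "\<And>e. e \<in> F \<Longrightarrow> S e \<in> sets borel"
    and A: "A \<in> sets weights_algebra" "A' \<in> sets weights_algebra"
    and AA': "\<And>t t'. t \<in> A \<Longrightarrow> t' \<in> extensional edges \<Longrightarrow> (\<And>e. e \<in> edges - F \<Longrightarrow> t' e = t e) \<Longrightarrow>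
        (\<And>e. e \<in> F \<Longrightarrow> t' e \<in> S e) \<Longrightarrow> t' \<in> A'"
  shows "P A * (\<Prod>e\<in>F. measure \<nu> (S e)) \<le> P A'"
\<comment> \<open>The intersection over e in F used below describes an event only for nonempty
  F.\<close>
proof (cases "F = {}")
  case True
  have "A \<subseteq> A'"
  proof
    fix t assume t: "t \<in> A"
    then have "t \<in> extensional edges" using sets.sets_into_space[OF A(1)] by (auto simp: space_PiM PiE_def)
    then show "t \<in> A'" by (rule AA'[OF t]) (use True in auto)
  qed
  then show ?thesis using True P_mono A by simp
next
  case False
  let ?G = "edges - F"
  let ?PG = "PiM ?G (\<lambda>_. borel :: real measure)" and ?PF = "PiM F (\<lambda>_. borel :: real measure)"
  define X where "X \<omega> = (\<lambda>e\<in>?G. \<tau> e \<omega>)" for \<omega>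
  define Y where "Y \<omega> = (\<lambda>e\<in>F. \<tau> e \<omega>)" for \<omega>
  have un: "?G \<union> F = edges" using F by auto
  have iv: "indep_var ?PG X ?PF Y"
    unfolding X_def[abs_def] Y_def[abs_def] using F by (intro indep_var_restrict[OF indep]) auto
  then have rv: "random_variable ?PG X" "random_variable ?PF Y"
    and joint: "distr M ?PG X \<Otimes>\<^sub>M distr M ?PF Y = distr M (?PG \<Otimes>\<^sub>M ?PF) (\<lambda>x. (X x, Y x))"
    by (auto simp: indep_var_distribution_eq)
  interpret Y: prob_space "distr M ?PF Y" by (rule prob_space_distr[OF rv(2)])
  interpret X: prob_space "distr M ?PG X" by (rule prob_space_distr[OF rv(1)])
  let ?m = "merge ?G F :: _ \<times> _ \<Rightarrow> (int ^ 'n) set \<Rightarrow> real"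
  have mm: "?m \<in> measurable (?PG \<Otimes>\<^sub>M ?PF) weights_algebra" using measurable_merge[of ?G F "\<lambda>_. borel :: real measure"] unfolding un .
  have Wm: "W \<omega> = ?m (X \<omega>, Y \<omega>)" for \<omega>
    using F by (auto simp: W_def X_def Y_def merge_def fun_eq_iff)
  define sec where "sec B x = Pair x -` (?m -` B \<inter> space (?PG \<Otimes>\<^sub>M ?PF))" for B x
  have PB: "ennreal (P B) = (\<integral>\<^sup>+x. emeasure (distr M ?PF Y) (sec B x) \<partial>distr M ?PG X)" if B: "B \<in> sets weights_algebra" for B
  proof -
    have mB: "?m -` B \<inter> space (?PG \<Otimes>\<^sub>M ?PF) \<in> sets (?PG \<Otimes>\<^sub>M ?PF)" using measurable_sets[OF mm B] .
    have "W -` B \<inter> space M = (\<lambda>\<omega>. (X \<omega>, Y \<omega>)) -` (?m -` B \<inter> space (?PG \<Otimes>\<^sub>M ?PF)) \<inter> space M"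
      using measurable_space[OF rv(1)] measurable_space[OF rv(2)] by (auto simp: Wm space_pair_measure)
    then have "ennreal (P B) = emeasure (distr M (?PG \<Otimes>\<^sub>M ?PF) (\<lambda>x. (X x, Y x))) (?m -` B \<inter> space (?PG \<Otimes>\<^sub>M ?PF))"
      using rv mB by (simp add: P_def emeasure_distr emeasure_eq_measure)
    also have "\<dots> = (\<integral>\<^sup>+x. emeasure (distr M ?PF Y) (sec B x) \<partial>distr M ?PG X)"
      unfolding joint[symmetric] sec_def using mB by (intro Y.emeasure_pair_measure_alt) simp
    finally show ?thesis .
  qed
  have sec_meas: "(\<lambda>x. emeasure (distr M ?PF Y) (sec B x)) \<in> borel_measurable (distr M ?PG X)" if B: "B \<in> sets weights_algebra" for B
    unfolding sec_def using measurable_sets[OF mm B] by (intro Y.measurable_emeasure_Pair) simp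
  define S' where "S' = PiE F S"
  have S': "S' \<in> sets ?PF" unfolding S'_def using F S by (intro sets_PiM_I_finite) auto
  define p where "p = (\<Prod>e\<in>F. measure \<nu> (S e))"
  have p0: "0 \<le> p" unfolding p_def by (intro prod_nonneg) simp
  have PS: "emeasure (distr M ?PF Y) S' = ennreal p"
  proof -
    have "Y -` S' \<inter> space M = (\<Inter>e\<in>F. \<tau> e -` S e \<inter> space M)"
      using False by (auto simp: Y_def S'_def)
    then have "emeasure (distr M ?PF Y) S' = ennreal (prob (\<Inter>e\<in>F. \<tau> e -` S e \<inter> space M))"
      using rv(2) S' by (simp add: emeasure_distr emeasure_eq_measure)
    also have "prob (\<Inter>e\<in>F. \<tau> e -` S e \<inter> space M) = p"
      unfolding p_def using indep_varsD[OF indep False F, of S] S prob_tau F(2) by (simp add: subset_iff)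
    finally show ?thesis .
  qed
  \<comment> \<open>If the section of A is nonempty, its probability is at most 1 and the section of
    A' has probability at least p; if it is empty, the left side vanishes.\<close>
  have key: "emeasure (distr M ?PF Y) (sec A x) * ennreal p \<le> emeasure (distr M ?PF Y) (sec A' x)"
    if x: "x \<in> space (distr M ?PG X)" for x
  proof (cases "sec A x = {}")
    case ne: False
    then obtain y where y: "(x, y) \<in> space (?PG \<Otimes>\<^sub>M ?PF)" "?m (x, y) \<in> A" by (auto simp: sec_def)
    have "S' \<subseteq> sec A' x"
    proof
      fix s assume s: "s \<in> S'"
      have "(x, s) \<in> space (?PG \<Otimes>\<^sub>M ?PF)" using y s sets.sets_into_space[OF S'] by (auto simp: space_pair_measure)
      moreover have "?m (x, s) \<in> A'"
      proof (rule AA'[OF y(2)])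
        have "?m (x, s) \<in> extensional (?G \<union> F)" by (rule extensional_merge)
        then show "?m (x, s) \<in> extensional edges" by (simp only: un)
        show "?m (x, s) e = ?m (x, y) e" if "e \<in> edges - F" for e using that by (simp add: merge_def)
        show "?m (x, s) e \<in> S e" if "e \<in> F" for e using that s by (auto simp: merge_def S'_def)
      qed
      ultimately show "s \<in> sec A' x" by (simp add: sec_def)
    qed
    moreover have "sec A' x \<in> sets (distr M ?PF Y)"
      unfolding sec_def sets_distr by (rule sets_Pair1[OF measurable_sets[OF mm A(2)]])
    ultimately have "ennreal p \<le> emeasure (distr M ?PF Y) (sec A' x)"
      unfolding PS[symmetric] by (rule emeasure_mono)
    moreover have "emeasure (distr M ?PF Y) (sec A x) * ennreal p \<le> 1 * ennreal p"
      by (intro mult_right_mono Y.emeasure_le_1) simp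
    ultimately show ?thesis by simp
  qed simp
  have "ennreal (P A * p) = (\<integral>\<^sup>+x. emeasure (distr M ?PF Y) (sec A x) * ennreal p \<partial>distr M ?PG X)"
    unfolding nn_integral_multc[OF sec_meas[OF A(1)]] PB[OF A(1), symmetric]
    using p0 by (simp add: P_def ennreal_mult)
  also have "\<dots> \<le> ennreal (P A')" unfolding PB[OF A(2)] by (intro nn_integral_mono key)
  finally show ?thesis unfolding p_def[symmetric] by (simp add: P_def ennreal_le_iff)
qed

end

section \<open>Semicontinuity of the rate\<close>

text \<open>A vector of l1-norm one is the difference of its positive and negative parts, both in
  the unit cube; the rest is homogeneity.\<close>

lemma norm_dist_l1norm:
  fixes g h :: "real ^ 'n::finite \<Rightarrow> real"
  assumes g: "g \<in> norms a b" and h: "h \<in> norms a b"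
  shows "\<bar>g x - h x\<bar> \<le> norm_dist g h * l1norm x"
proof (cases "x = 0")
  case True
  then show ?thesis using normsD(4)[OF g, of 0] normsD(4)[OF h, of 0] by simp
next
  case False
  then have l: "0 < l1norm x" using l1norm_pos[of x 0] by simp
  let ?u = "(1 / l1norm x) *\<^sub>R x"
  let ?y = "(\<chi> i. max (?u $ i) 0) :: real ^ 'n" and ?z = "(\<chi> i. max (- (?u $ i)) 0) :: real ^ 'n"
  have ui: "\<bar>?u $ i\<bar> \<le> 1" for i
    using abs_component_le_l1norm[of x i] l by (simp add: abs_mult divide_simps)
  have "?u $ i \<le> 1" "- (?u $ i) \<le> 1" for i using ui[of i] by linarith+
  then have "?y \<in> unit_cube" "?z \<in> unit_cube" unfolding unit_cube_def by auto
  moreover have "?y - ?z = ?u" by (simp add: vec_eq_iff max_def)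
  ultimately have "\<bar>g ?u - h ?u\<bar> \<le> norm_dist g h" using norm_dist_upper[OF g h, of ?y ?z] by simp
  moreover have "g ?u = g x / l1norm x" "h ?u = h x / l1norm x" using l by (simp_all only: normsD(2)[OF g] normsD(2)[OF h]) simp_all
  ultimately have "\<bar>(g x - h x) / l1norm x\<bar> \<le> norm_dist g h" by (simp add: diff_divide_distrib)
  then show ?thesis using l by (simp add: abs_divide divide_simps split: if_splits)
qed

lemma norms_le_axis_sum:
  fixes g :: "real ^ 'n::finite \<Rightarrow> real"
  assumes g: "g \<in> norms a b"
  shows "g x \<le> (\<Sum>i\<in>UNIV. \<bar>x $ i\<bar> * g (axis i 1))"
proof -
  have sub: "g (\<Sum>i\<in>I. f i) \<le> (\<Sum>i\<in>I. g (f i))" if "finite I" for f :: "'n \<Rightarrow> real ^ 'n" and I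
    using that
  proof (induction I)
    case (insert i I)
    then show ?case using normsD(3)[OF g, of "f i" "sum f I"] by simp
  qed (use normsD(4)[OF g, of 0] in simp)
  have "x = (\<Sum>i\<in>UNIV. (x $ i) *\<^sub>R axis i 1)"
    using basis_expansion[of x] by (simp add: scalar_mult_eq_scaleR)
  then have "g x = g (\<Sum>i\<in>UNIV. (x $ i) *\<^sub>R axis i 1)" by simp
  also have "\<dots> \<le> (\<Sum>i\<in>UNIV. g ((x $ i) *\<^sub>R axis i 1))" by (rule sub) simp
  finally show ?thesis by (simp add: normsD(2)[OF g])
qed

text \<open>By the triangle inequality a norm is at most the combination of its axis values weighted
  by the coordinates, so the largest of these finitely many values bounds its slope for
  \<open>l1norm\<close>.\<close>

lemma norms_gap:
  fixes g :: "real ^ 'n::finite \<Rightarrow> real"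
  assumes g: "g \<in> norms a b" and lt: "\<And>i. g (axis i 1) < b"
  obtains \<kappa> where "0 < \<kappa>" "\<And>x. g x \<le> (b - 2 * \<kappa>) * l1norm x"
proof -
  define m where "m = Max (range (\<lambda>i. g (axis i 1)))"
  have fin: "finite (range (\<lambda>i. g (axis i 1)))" by simp
  have "m \<in> range (\<lambda>i. g (axis i 1))" unfolding m_def by (rule Max_in) auto
  then have mb: "m < b" using lt by auto
  have mi: "g (axis i 1) \<le> m" for i unfolding m_def by (rule Max_ge[OF fin]) simp
  show ?thesis
  proof (rule that[of "(b - m) / 2"])
    fix x
    have "g x \<le> (\<Sum>i\<in>UNIV. \<bar>x $ i\<bar> * g (axis i 1))" by (rule norms_le_axis_sum[OF g])
    also have "\<dots> \<le> (\<Sum>i\<in>UNIV. \<bar>x $ i\<bar> * m)" using mi by (intro sum_mono mult_left_mono) auto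
    also have "\<dots> = m * l1norm x" by (simp add: l1norm_def sum_distrib_left mult.commute)
    finally have "g x \<le> m * l1norm x" .
    moreover have "b - 2 * ((b - m) / 2) = m" by (simp add: field_simps)
    ultimately show "g x \<le> (b - 2 * ((b - m) / 2)) * l1norm x" by (simp only:)
  qed (use mb in simp)
qed

text \<open>Strictness on the axes already gives a uniform gap. Hence a failure of strictness can be
  located on an axis, where \<open>rate_infinite\<close> exploits it.\<close>

lemma norms_star_iff:
  fixes g :: "real ^ 'n::finite \<Rightarrow> real"
  assumes g: "g \<in> norms a b"
  shows "g \<in> norms_star a b \<longleftrightarrow> (\<forall>i. g (axis i 1) < b)"
proof
  assume s: "g \<in> norms_star a b"
  show "\<forall>i. g (axis i 1) < b"
  proof
    fix i :: 'n
    have "(axis i 1 :: real ^ 'n) \<noteq> 0" by (simp add: axis_eq_0_iff)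
    then have "g (axis i 1) < b * l1norm (axis i 1)" using s unfolding norms_star_def by blast
    then show "g (axis i 1) < b" by simp
  qed
next
  assume lt: "\<forall>i. g (axis i 1) < b"
  obtain \<kappa> where \<kappa>: "0 < \<kappa>" "\<And>x. g x \<le> (b - 2 * \<kappa>) * l1norm x" using norms_gap[OF g] lt by blast
  have "g x < b * l1norm x" if "x \<noteq> 0" for x
  proof -
    have "0 < l1norm x" using l1norm_pos[of x 0] that by simp
    then have "(b - 2 * \<kappa>) * l1norm x < b * l1norm x" using \<kappa>(1) by simp
    then show ?thesis using \<kappa>(2)[of x] by linarith
  qed
  then show "g \<in> norms_star a b" using g by (simp add: norms_star_def)
qed

lemma neg_log_antimono: "0 \<le> p \<Longrightarrow> p \<le> q \<Longrightarrow> neg_log q \<le> neg_log p"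
  by (auto simp: neg_log_def)

lemma neg_log_mult:
  assumes "0 \<le> p" "0 < q" "p * q \<le> p'"
  shows "neg_log p' \<le> neg_log p + ereal (- ln q)"
proof (cases "p = 0")
  case False
  then have p: "0 < p" "0 < p * q" using assms by auto
  have "ln p + ln q = ln (p * q)" using p assms by (simp add: ln_mult)
  also have "ln (p * q) \<le> ln p'" using p(2) assms(3) by (intro ln_mono) auto
  finally have "ln p + ln q \<le> ln p'" .
  moreover have "p' \<noteq> 0" using p(2) assms(3) by linarith
  ultimately show ?thesis using p assms(2) by (simp add: neg_log_def)
qed (simp add: neg_log_def)

context fpp
begin

definition rate_at :: "(real ^ 'n \<Rightarrow> real) \<Rightarrow> real \<Rightarrow> ereal" where
  "rate_at g \<epsilon> = liminf (\<lambda>n. neg_log (P (LD_weights b n g \<epsilon>)) / ereal (real n ^ CARD('n)))"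

lemma P_nonneg: "0 \<le> P A"
  by (simp add: P_def)

lemma b_nonneg: "0 \<le> b"
  using ab by simp

lemma rate_at_mono:
  assumes h: "h \<in> norms a b" and sub: "\<And>n. 0 < n \<Longrightarrow> LD_weights b n g \<epsilon> \<subseteq> LD_weights b n h \<epsilon>'"
  shows "rate_at h \<epsilon>' \<le> rate_at g \<epsilon>"
  unfolding rate_at_def
proof (rule Liminf_mono, rule eventually_mono[OF eventually_gt_at_top[of 0]])
  fix n :: nat assume n: "0 < n"
  have "P (LD_weights b n g \<epsilon>) \<le> P (LD_weights b n h \<epsilon>')"
    by (rule P_mono[OF sub[OF n] LD_weights_sets[OF n b_nonneg h]])
  then show "neg_log (P (LD_weights b n h \<epsilon>')) / ereal (real n ^ CARD('n)) \<le> neg_log (P (LD_weights b n g \<epsilon>)) / ereal (real n ^ CARD('n))"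
    using n by (intro ereal_divide_right_mono neg_log_antimono P_nonneg) auto
qed

lemma rate_at_antimono:
  assumes "g \<in> norms a b" "\<epsilon> \<le> \<epsilon>'"
  shows "rate_at g \<epsilon>' \<le> rate_at g \<epsilon>"
proof (rule rate_at_mono[OF assms(1)])
  have "ereal \<epsilon> \<le> ereal \<epsilon>'" using assms by simp
  then show "LD_weights b n g \<epsilon> \<subseteq> LD_weights b n g \<epsilon>'" for n
    unfolding LD_weights_def by (auto intro: order_trans)
qed

lemma rate_eq_SUP:
  assumes g: "g \<in> norms a b"
  shows "rate M \<tau> b g = (SUP \<epsilon>\<in>{0<..}. rate_at g \<epsilon>)"
proof -
  have "rate M \<tau> b g = Lim (at_right 0) (rate_at g)"
    unfolding rate_def rate_at_def[abs_def] P_LD ..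
  moreover have "(rate_at g \<longlongrightarrow> (SUP \<epsilon>\<in>{0<..}. rate_at g \<epsilon>)) (at_right 0)"
  proof (rule order_tendstoI)
    fix y assume "y < (SUP \<epsilon>\<in>{0<..}. rate_at g \<epsilon>)"
    then obtain \<epsilon>0 where \<epsilon>0: "0 < \<epsilon>0" "y < rate_at g \<epsilon>0" by (auto simp: less_SUP_iff)
    have "eventually (\<lambda>\<epsilon>. \<epsilon> \<in> {0<..<\<epsilon>0}) (at_right 0)" using \<epsilon>0(1) by (rule eventually_at_right_real)
    then show "eventually (\<lambda>\<epsilon>. y < rate_at g \<epsilon>) (at_right 0)"
    proof (rule eventually_mono)
      fix \<epsilon> assume "\<epsilon> \<in> {0<..<\<epsilon>0}"
      then show "y < rate_at g \<epsilon>" using \<epsilon>0(2) rate_at_antimono[OF g, of \<epsilon> \<epsilon>0] by (auto intro: less_le_trans)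
    qed
  next
    fix y assume y: "(SUP \<epsilon>\<in>{0<..}. rate_at g \<epsilon>) < y"
    have "eventually (\<lambda>\<epsilon>::real. \<epsilon> \<in> {0<..<1}) (at_right 0)" by (rule eventually_at_right_real) simp
    then show "eventually (\<lambda>\<epsilon>. rate_at g \<epsilon> < y) (at_right 0)"
      by (rule eventually_mono) (use y in \<open>auto intro: le_less_trans[OF SUP_upper]\<close>)
  qed
  ultimately show ?thesis using tendsto_Lim[of "at_right (0::real)"] by (simp add: trivial_limit_at_right_real)
qed

text \<open>The \<epsilon> / 2 ball around h is contained in the \<epsilon> ball around g once h is
  within \<epsilon> / 2 of g.\<close>

lemma rate_lower_semicontinuous:
  assumes g: "g \<in> norms a b" and y: "y < rate M \<tau> b g"
  shows "\<exists>\<zeta>>0. \<forall>h\<in>norms a b. norm_dist g h < \<zeta> \<longrightarrow> y < rate M \<tau> b h"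
proof -
  obtain \<epsilon> where \<epsilon>: "0 < \<epsilon>" "y < rate_at g \<epsilon>" using y unfolding rate_eq_SUP[OF g] by (auto simp: less_SUP_iff)
  show ?thesis
  proof (intro exI[of _ "\<epsilon> / 2"] conjI ballI impI)
    fix h assume h: "h \<in> norms a b" and d: "norm_dist g h < \<epsilon> / 2"
    have "LD_weights b n h (\<epsilon> / 2) \<subseteq> LD_weights b n g \<epsilon>" if n: "0 < n" for n
    proof
      fix t assume t: "t \<in> LD_weights b n h (\<epsilon> / 2)"
      have "\<bar>T_in t b (cube n) p q - g (p - q)\<bar> \<le> \<epsilon> * real n" if pq: "p \<in> cube n" "q \<in> cube n" for p q
      proof -
        obtain x z where xz: "x \<in> unit_cube" "z \<in> unit_cube" "p = real n *\<^sub>R x" "q = real n *\<^sub>R z"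
          using pq unfolding scaled_unit_cube[OF n, symmetric] by blast
        have "p - q = real n *\<^sub>R (x - z)" by (simp add: xz scaleR_diff_right)
        then have "\<bar>g (p - q) - h (p - q)\<bar> = real n * \<bar>g (x - z) - h (x - z)\<bar>"
          by (simp add: normsD(2)[OF g] normsD(2)[OF h] abs_mult flip: right_diff_distrib)
        also have "\<dots> \<le> real n * (\<epsilon> / 2)"
          using norm_dist_upper[OF g h xz(1,2)] d by (intro mult_left_mono) auto
        finally have "\<bar>g (p - q) - h (p - q)\<bar> \<le> \<epsilon> / 2 * real n" by (simp add: mult.commute)
        moreover have "\<bar>T_in t b (cube n) p q - h (p - q)\<bar> \<le> \<epsilon> / 2 * real n"
          using t pq by (simp add: LD_weights_def d_infty_le_iff[OF n h])
        ultimately show ?thesis by linarith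
      qed
      then show "t \<in> LD_weights b n g \<epsilon>" using t by (simp add: LD_weights_def d_infty_le_iff[OF n g])
    qed
    then have "rate_at g \<epsilon> \<le> rate_at h (\<epsilon> / 2)" by (rule rate_at_mono[OF g])
    also have "\<dots> \<le> rate M \<tau> b h" unfolding rate_eq_SUP[OF h] using \<epsilon> by (intro SUP_upper) simp
    finally show "y < rate M \<tau> b h" using \<epsilon> by (auto intro: less_le_trans)
  qed (use \<epsilon> in simp)
qed

text \<open>Each core edge costs - ln p1, where p1 depends only on \<kappa>; the remaining modified
  edges together cost at most \<gamma> per unit of volume. Thus the added term involves neither
  \<epsilon> nor h.\<close>

lemma rate_at_compare:
  assumes g: "g \<in> norms a b" and h: "h \<in> norms a b"
    and \<kappa>: "0 < \<kappa>" "\<And>x. g x \<le> (b - 2 * \<kappa>) * l1norm x"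
    and \<delta>: "0 < \<delta>" "\<delta> < 1" and gh: "\<And>x. h x \<le> g x + \<kappa> * \<delta> * l1norm x" and \<epsilon>: "0 < \<epsilon>" and \<gamma>: "0 < \<gamma>"
  defines "c \<equiv> 2 * real CARD('n) ^ 2 * 2 ^ CARD('n)" and "p1 \<equiv> measure \<nu> ({b - \<kappa>..b + \<kappa>} \<inter> {a..b})"
  shows "\<exists>\<epsilon>'>0. rate_at h \<epsilon> \<le> rate_at g \<epsilon>' + ereal (c * \<delta> * (- ln p1) + \<gamma>)"
proof -
  interpret nu: prob_space \<nu> by (rule \<nu>(1))
  define d where "d = real CARD('n)"
  have d: "0 < d" by (simp add: d_def)
  \<comment> \<open>Passage times in the cube are at most b d n, so the relative error \<rho> / a
    amounts to at most \<epsilon> n / 4.\<close>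
  define \<rho> where "\<rho> = min a (a * \<epsilon> / (4 * b * d))"
  have \<rho>: "0 < \<rho>" "\<rho> \<le> a" "\<rho> \<le> a * \<epsilon> / (4 * b * d)" using ab \<epsilon> d by (auto simp: \<rho>_def)
  have \<rho>': "\<rho> * (b * real CARD('n)) \<le> a * \<epsilon> / 4"
  proof -
    have "\<rho> * (b * d) \<le> a * \<epsilon> / (4 * b * d) * (b * d)" using \<rho> ab d by (intro mult_right_mono) auto
    also have "\<dots> = a * \<epsilon> / 4" using ab d by simp
    finally show ?thesis by (simp add: d_def)
  qed
  define p2 where "p2 = min (measure \<nu> ({a - \<rho>..a + \<rho>} \<inter> {a..b})) (measure \<nu> ({b - \<rho>..b + \<rho>} \<inter> {a..b}))"
  have p: "0 < p1" "p1 \<le> 1" "0 < p2" "p2 \<le> 1"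
    using measure_near_a[OF \<rho>(1)] measure_near_b[OF \<rho>(1)] measure_near_b[OF \<kappa>(1)] nu.prob_le_1
    by (auto simp: p1_def p2_def min_le_iff_disj)
  \<comment> \<open>p2 shrinks with \<epsilon> through \<rho>, so the proportion of these edges is
    adjusted to it; the 1 in the denominator covers p2 = 1.\<close>
  define \<eta> where "\<eta> = \<gamma> / (1 - ln p2)"
  have lp: "ln p1 \<le> 0" "ln p2 \<le> 0" using p by auto
  have \<eta>: "0 < \<eta>" "\<eta> * (- ln p2) \<le> \<gamma>"
  proof -
    show "0 < \<eta>" using \<gamma> lp by (simp add: \<eta>_def)
    have "\<eta> * (- ln p2) \<le> \<eta> * (1 - ln p2)" using \<open>0 < \<eta>\<close> by (intro mult_left_mono) auto
    also have "\<dots> = \<gamma>" using lp by (simp add: \<eta>_def)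
    finally show "\<eta> * (- ln p2) \<le> \<gamma>" .
  qed
  let ?C = "c * \<delta> * (- ln p1) + \<gamma>"
  obtain \<epsilon>' where \<epsilon>': "0 < \<epsilon>'" and ev: "\<forall>\<^sub>F n in sequentially. \<exists>F1 F2 s. finite F1 \<and> finite F2 \<and> F1 \<subseteq> edges \<and> F2 \<subseteq> edges \<and> F1 \<inter> F2 = {}
    \<and> real (card F1) \<le> c * \<delta> * real n ^ CARD('n)
    \<and> real (card F2) \<le> \<eta> * real n ^ CARD('n) \<and> (\<forall>e. s e \<in> {a, b})
    \<and> (\<forall>t t'. cfg a b t \<longrightarrow> cfg a b t' \<longrightarrow> above g b n \<epsilon>' t \<longrightarrow> (\<forall>e. e \<notin> F1 \<union> F2 \<longrightarrow> t' e = t e)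
      \<longrightarrow> (\<forall>e\<in>F1. b - \<kappa> \<le> t' e) \<longrightarrow> (\<forall>e\<in>F2. \<bar>t' e - s e\<bar> \<le> \<rho>)
      \<longrightarrow> (\<forall>x\<in>cube n. \<forall>y\<in>cube n. \<bar>T_in t' b (cube n) x y - h (x - y)\<bar> \<le> \<epsilon> * real n))"
    using modify_configuration[OF d2 ab g h \<kappa> \<delta> gh \<epsilon> \<rho>(1) \<rho>' \<rho>(2) \<eta>(1)] unfolding c_def by blast
  have "\<forall>\<^sub>F n in sequentially. neg_log (P (LD_weights b n h \<epsilon>)) / ereal (real n ^ CARD('n))
      \<le> neg_log (P (LD_weights b n g \<epsilon>')) / ereal (real n ^ CARD('n)) + ereal ?C"
  proof (rule eventually_mono[OF eventually_conj[OF ev eventually_gt_at_top[of 0]]], elim conjE exE)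
    fix n F1 F2 s
    assume n: "0 < n" and F: "finite F1" "finite F2" "F1 \<subseteq> edges" "F2 \<subseteq> edges" "F1 \<inter> F2 = {}"
      and card: "real (card F1) \<le> c * \<delta> * real n ^ CARD('n)" "real (card F2) \<le> \<eta> * real n ^ CARD('n)"
      and s: "\<forall>e. s e \<in> {a, b}"
      and mod: "\<forall>t t'. cfg a b t \<longrightarrow> cfg a b t' \<longrightarrow> above g b n \<epsilon>' t \<longrightarrow> (\<forall>e. e \<notin> F1 \<union> F2 \<longrightarrow> t' e = t e)
      \<longrightarrow> (\<forall>e\<in>F1. b - \<kappa> \<le> t' e) \<longrightarrow> (\<forall>e\<in>F2. \<bar>t' e - s e\<bar> \<le> \<rho>)
      \<longrightarrow> (\<forall>x\<in>cube n. \<forall>y\<in>cube n. \<bar>T_in t' b (cube n) x y - h (x - y)\<bar> \<le> \<epsilon> * real n)"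
    define S where "S e = (if e \<in> F1 then {b - \<kappa>..b + \<kappa>} \<inter> {a..b} else {s e - \<rho>..s e + \<rho>} \<inter> {a..b})" for e
    \<comment> \<open>Restricting to admissible configurations supplies the bounds needed for the
      modification, at no loss of probability.\<close>
    let ?A = "LD_weights b n g \<epsilon>' \<inter> admissible"
    have Ag: "LD_weights b n g \<epsilon>' \<in> sets weights_algebra" by (rule LD_weights_sets[OF n b_nonneg g])
    have "P ?A * (\<Prod>e\<in>F1 \<union> F2. measure \<nu> (S e)) \<le> P (LD_weights b n h \<epsilon>)"
    proof (rule resample)
      show "finite (F1 \<union> F2)" "F1 \<union> F2 \<subseteq> edges" using F by auto
      show "S e \<in> sets borel" for e by (simp add: S_def)
      show "?A \<in> sets weights_algebra" using Ag admissible_sets by (rule sets.Int)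
      show "LD_weights b n h \<epsilon> \<in> sets weights_algebra" by (rule LD_weights_sets[OF n b_nonneg h])
      fix t t' assume t: "t \<in> ?A" and t': "t' \<in> extensional edges" "\<And>e. e \<in> edges - (F1 \<union> F2) \<Longrightarrow> t' e = t e"
        "\<And>e. e \<in> F1 \<union> F2 \<Longrightarrow> t' e \<in> S e"
      have ct: "cfg a b t" "t \<in> extensional edges" using t by (auto simp: admissible_def space_PiM PiE_def)
      have ct': "cfg a b t'"
        unfolding cfg_def
      proof
        fix e :: "(int ^ 'n) set" assume e: "e \<in> edges"
        show "a \<le> t' e \<and> t' e \<le> b"
        proof (cases "e \<in> F1 \<union> F2")
          case True
          then show ?thesis using t'(3)[OF True] by (auto simp: S_def split: if_splits)
        next
          case False
          then show ?thesis using t'(2)[of e] e ct(1) by (simp add: cfg_def)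
        qed
      qed
      have "above g b n \<epsilon>' t"
        unfolding above_def
      proof (intro ballI)
        fix x y :: "real ^ 'n" assume "x \<in> cube n" "y \<in> cube n"
        then have "\<bar>T_in t b (cube n) x y - g (x - y)\<bar> \<le> \<epsilon>' * real n"
          using t by (simp add: LD_weights_def d_infty_le_iff[OF n g])
        then show "g (x - y) - \<epsilon>' * real n \<le> T_in t b (cube n) x y" by linarith
      qed
      moreover have "\<forall>e. e \<notin> F1 \<union> F2 \<longrightarrow> t' e = t e" using t'(1,2) ct(2) by (metis Diff_iff extensional_arb)
      moreover have "\<forall>e\<in>F1. b - \<kappa> \<le> t' e" using t'(3) by (fastforce simp: S_def)
      moreover have "\<forall>e\<in>F2. \<bar>t' e - s e\<bar> \<le> \<rho>"
      proof
        fix e assume e: "e \<in> F2"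
        then have "e \<notin> F1" using F(5) by blast
        then show "\<bar>t' e - s e\<bar> \<le> \<rho>" using t'(3)[of e] e by (auto simp: S_def abs_le_iff)
      qed
      ultimately have "\<forall>x\<in>cube n. \<forall>y\<in>cube n. \<bar>T_in t' b (cube n) x y - h (x - y)\<bar> \<le> \<epsilon> * real n"
        using mod ct(1) ct' by blast
      then show "t' \<in> LD_weights b n h \<epsilon>"
        using t'(1) by (simp add: LD_weights_def d_infty_le_iff[OF n h] space_PiM PiE_def)
    qed
    moreover have "p1 ^ card F1 * p2 ^ card F2 \<le> (\<Prod>e\<in>F1 \<union> F2. measure \<nu> (S e))"
    proof -
      have "(\<Prod>e\<in>F1. measure \<nu> (S e)) = p1 ^ card F1" by (simp add: S_def p1_def)
      moreover have "(\<Prod>e\<in>F2. p2) \<le> (\<Prod>e\<in>F2. measure \<nu> (S e))"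
      proof (intro prod_mono conjI)
        fix e assume "e \<in> F2"
        then have "e \<notin> F1" using F(5) by blast
        then show "p2 \<le> measure \<nu> (S e)" using s[rule_format, of e] by (auto simp: S_def p2_def)
      qed (use p in simp)
      ultimately show ?thesis
        unfolding prod.union_disjoint[OF F(1,2,5)] using p by (simp add: mult_left_mono)
    qed
    then have "P ?A * (p1 ^ card F1 * p2 ^ card F2) \<le> P ?A * (\<Prod>e\<in>F1 \<union> F2. measure \<nu> (S e))"
      by (rule mult_left_mono[OF _ P_nonneg])
    ultimately have "P (LD_weights b n g \<epsilon>') * (p1 ^ card F1 * p2 ^ card F2) \<le> P (LD_weights b n h \<epsilon>)"
      unfolding P_Int_admissible[OF Ag] by linarith
    then have "neg_log (P (LD_weights b n h \<epsilon>)) \<le> neg_log (P (LD_weights b n g \<epsilon>')) + ereal (- ln (p1 ^ card F1 * p2 ^ card F2))"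
      using p by (intro neg_log_mult P_nonneg) auto
    also have "ereal (- ln (p1 ^ card F1 * p2 ^ card F2)) \<le> ereal (?C * real n ^ CARD('n))"
    proof -
      have "- ln (p1 ^ card F1 * p2 ^ card F2) = real (card F1) * (- ln p1) + real (card F2) * (- ln p2)"
        using p by (simp add: ln_mult ln_realpow)
      also have "\<dots> \<le> (c * \<delta> * real n ^ CARD('n)) * (- ln p1) + (\<eta> * real n ^ CARD('n)) * (- ln p2)"
        using card lp by (intro add_mono mult_right_mono) auto
      also have "\<dots> = (c * \<delta> * (- ln p1) + \<eta> * (- ln p2)) * real n ^ CARD('n)" by (simp add: algebra_simps)
      also have "\<dots> \<le> ?C * real n ^ CARD('n)" using \<eta>(2) by (intro mult_right_mono) auto
      finally show ?thesis by simp
    qed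
    finally have "neg_log (P (LD_weights b n h \<epsilon>)) \<le> neg_log (P (LD_weights b n g \<epsilon>')) + ereal (?C * real n ^ CARD('n))"
      by (simp add: add_left_mono)
    then have "neg_log (P (LD_weights b n h \<epsilon>)) / ereal (real n ^ CARD('n))
      \<le> (neg_log (P (LD_weights b n g \<epsilon>')) + ereal (?C * real n ^ CARD('n))) / ereal (real n ^ CARD('n))"
      using n by (intro ereal_divide_right_mono) auto
    also have "\<dots> = neg_log (P (LD_weights b n g \<epsilon>')) / ereal (real n ^ CARD('n)) + ereal ?C"
      using n by (cases "neg_log (P (LD_weights b n g \<epsilon>'))") (auto simp: add_divide_distrib)
    finally show "neg_log (P (LD_weights b n h \<epsilon>)) / ereal (real n ^ CARD('n))
      \<le> neg_log (P (LD_weights b n g \<epsilon>')) / ereal (real n ^ CARD('n)) + ereal ?C" .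
  qed
  then have "rate_at h \<epsilon> \<le> rate_at g \<epsilon>' + ereal ?C"
    unfolding rate_at_def by (subst Liminf_add_ereal_right[symmetric]) (auto intro: Liminf_mono)
  then show ?thesis using \<epsilon>' by blast
qed

text \<open>The loss in \<open>rate_at_compare\<close> is the same for all \<epsilon>, so the
  supremum over \<epsilon> can be taken. The radius \<kappa> \<delta> of the neighbourhood is
  exactly what slabs of proportion \<delta> gain.\<close>

lemma rate_upper_semicontinuous:
  assumes g: "g \<in> norms_star a b" and \<gamma>: "0 < \<gamma>"
  shows "\<exists>\<zeta>>0. \<forall>h\<in>norms a b. norm_dist g h < \<zeta> \<longrightarrow> rate M \<tau> b h \<le> rate M \<tau> b g + ereal \<gamma>"
proof -
  interpret nu: prob_space \<nu> by (rule \<nu>(1))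
  have gn: "g \<in> norms a b" using g by (simp add: norms_star_def)
  obtain \<kappa> where \<kappa>: "0 < \<kappa>" "\<And>x. g x \<le> (b - 2 * \<kappa>) * l1norm x"
    using norms_gap[OF gn] norms_star_iff[OF gn] g by blast
  define c where "c = 2 * real CARD('n) ^ 2 * 2 ^ CARD('n)"
  define p1 where "p1 = measure \<nu> ({b - \<kappa>..b + \<kappa>} \<inter> {a..b})"
  have "0 < p1" "p1 \<le> 1" using measure_near_b[OF \<kappa>(1)] nu.prob_le_1 by (auto simp: p1_def)
  then have lp: "0 \<le> - ln p1" by simp
  have c: "0 \<le> c" by (simp add: c_def)
  define k where "k = c * (- ln p1) + 1"
  have k: "1 \<le> k" "c * (- ln p1) \<le> k" using mult_nonneg_nonneg[OF c lp] by (auto simp: k_def)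
  \<comment> \<open>This makes the slabs cost at most \<gamma> / 2 and leaves \<gamma> / 2 for the
    other modified edges.\<close>
  define \<delta> where "\<delta> = min (1 / 2) (\<gamma> / (2 * k))"
  have \<delta>: "0 < \<delta>" "\<delta> < 1" "\<delta> \<le> \<gamma> / (2 * k)" using \<gamma> k by (auto simp: \<delta>_def)
  have cost: "c * \<delta> * (- ln p1) \<le> \<gamma> / 2"
  proof -
    have "c * \<delta> * (- ln p1) = (c * (- ln p1)) * \<delta>" by simp
    also have "\<dots> \<le> k * (\<gamma> / (2 * k))" using k \<delta> mult_nonneg_nonneg[OF c lp] by (intro mult_mono) auto
    also have "\<dots> = \<gamma> / 2" using k by simp
    finally show ?thesis .
  qed
  show ?thesis
  proof (intro exI[of _ "\<kappa> * \<delta>"] conjI ballI impI)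
    show "0 < \<kappa> * \<delta>" using \<kappa> \<delta> by simp
    fix h assume h: "h \<in> norms a b" and dist: "norm_dist g h < \<kappa> * \<delta>"
    have gh: "h x \<le> g x + \<kappa> * \<delta> * l1norm x" for x
    proof -
      have "norm_dist g h * l1norm x \<le> \<kappa> * \<delta> * l1norm x" using dist by (intro mult_right_mono l1norm_nonneg) simp
      then show ?thesis using norm_dist_l1norm[OF gn h, of x] by linarith
    qed
    show "rate M \<tau> b h \<le> rate M \<tau> b g + ereal \<gamma>"
      unfolding rate_eq_SUP[OF h]
    proof (rule SUP_least)
      fix \<epsilon> :: real assume "\<epsilon> \<in> {0<..}"
      then have \<epsilon>: "0 < \<epsilon>" by simp
      have "0 < \<gamma> / 2" using \<gamma> by simp
      from rate_at_compare[OF gn h \<kappa> \<delta>(1,2) gh \<epsilon> this]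
      obtain \<epsilon>' where \<epsilon>': "0 < \<epsilon>'" "rate_at h \<epsilon> \<le> rate_at g \<epsilon>' + ereal (c * \<delta> * (- ln p1) + \<gamma> / 2)"
        unfolding c_def p1_def by blast
      have "rate_at g \<epsilon>' \<le> rate M \<tau> b g" unfolding rate_eq_SUP[OF gn] using \<epsilon>' by (intro SUP_upper) simp
      moreover have "ereal (c * \<delta> * (- ln p1) + \<gamma> / 2) \<le> ereal \<gamma>" using cost by simp
      ultimately show "rate_at h \<epsilon> \<le> rate M \<tau> b g + ereal \<gamma>"
        using \<epsilon>'(2) by (meson add_mono order_trans)
    qed
  qed
qed

end

section \<open>Infinite rate outside the open set of norms\<close>

lemma T_in_lattice_line:
  fixes v :: "int ^ 'n::finite"
  assumes ab: "0 \<le> a" "a \<le> b" and t: "cfg a b t" and v: "\<And>j. 0 \<le> v $ j \<and> v $ j \<le> int n" "v $ i = 0" and k: "k \<le> n"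
  shows "T_in t b (cube n) (emb v) (emb (v + axis i (int k))) \<le> (\<Sum>j<k. t {v + axis i (int j), v + axis i (int j) + axis i 1})"
proof -
  have inc: "emb (v + axis i (int k)) \<in> cube n" if k: "k \<le> n" for k
    unfolding cube_def
  proof (rule CollectI, rule allI)
    fix j
    have "0 \<le> (v + axis i (int k)) $ j \<and> (v + axis i (int k)) $ j \<le> int n"
      using v k by (auto simp: axis_def)
    then have "real_of_int 0 \<le> real_of_int ((v + axis i (int k)) $ j) \<and> real_of_int ((v + axis i (int k)) $ j) \<le> real_of_int (int n)"
      unfolding of_int_le_iff .
    then show "0 \<le> emb (v + axis i (int k)) $ j \<and> emb (v + axis i (int k)) $ j \<le> real n" by simp
  qed
  show ?thesis using k
  proof (induction k)
    case 0
    have v0: "v + axis i (int 0) = v" by (simp add: axis_def vec_eq_iff)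
    show ?case using T_in_refl[OF ab t inc[of 0]] unfolding v0 by simp
  next
    case (Suc k)
    let ?w = "v + axis i (int k)"
    have w: "v + axis i (int (Suc k)) = ?w + axis i 1" by (simp add: axis_def vec_eq_iff)
    have v0: "axis i (int 0) = 0" by (simp add: axis_def vec_eq_iff)
    have "T_in t b (cube n) (emb ?w) (emb (?w + axis i 1)) \<le> step_time t b (emb ?w) (emb (?w + axis i 1))"
      using inc[of k] inc[of "Suc k"] Suc.prems unfolding w by (intro T_in_le_step[OF ab t]) auto
    then show ?case
      using Suc T_in_triangle[OF ab t, of "emb v" "cube n" "emb ?w" "emb (?w + axis i 1)"] inc[of 0] inc[of k] inc[of "Suc k"]
      unfolding w v0 by (simp add: step_time_lattice)
  qed
qed

lemma neg_log_ge: "0 \<le> p \<Longrightarrow> p \<le> exp (- c) \<Longrightarrow> ereal c \<le> neg_log p"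
proof -
  assume p: "0 \<le> p" "p \<le> exp (- c)"
  show "ereal c \<le> neg_log p"
  proof (cases "p = 0")
    case False
    then have "ln p \<le> ln (exp (- c))" using p by (intro ln_mono) auto
    then show ?thesis using False by (simp add: neg_log_def)
  qed (simp add: neg_log_def)
qed

context fpp
begin

text \<open>The exponential weight of the deficit below b; the maximum with 0 bounds it by one even
  outside the support.\<close>

definition damp :: "nat \<Rightarrow> real \<Rightarrow> real" where
  "damp k x = exp (- (real k * max 0 (b - x)))"

lemma damp_measurable [measurable]: "damp k \<in> borel_measurable borel"
  unfolding damp_def[abs_def] by measurable

lemma damp_bounds: "0 \<le> damp k x" "damp k x \<le> 1"
  by (auto simp: damp_def)

text \<open>Absence of an atom at b is essential: \<open>damp k b\<close> is 1, so the integral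
  never falls below the mass of {b}, while at every x < b the integrand tends to 0.\<close>

lemma damp_integral_tendsto_0:
  assumes "measure \<nu> {b} = 0"
  shows "(\<lambda>k. \<integral>x. damp k x \<partial>\<nu>) \<longlonglongrightarrow> 0"
proof -
  interpret nu: prob_space \<nu> by (rule \<nu>(1))
  have "{b} \<in> null_sets \<nu>" using assms \<nu>(2) by (simp add: null_sets_def nu.emeasure_eq_measure)
  then have "AE x in \<nu>. x \<notin> {b}" by (rule AE_not_in)
  with AE_bounds have lt: "AE x in \<nu>. x < b" by eventually_elim auto
  have m: "damp k \<in> borel_measurable \<nu>" for k
    using damp_measurable measurable_cong_sets[OF \<nu>(2) refl, of "borel :: real measure"] by blast
  have "(\<lambda>k. \<integral>x. damp k x \<partial>\<nu>) \<longlonglongrightarrow> (\<integral>x. 0 \<partial>\<nu>)"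
  proof (rule integral_dominated_convergence[where w = "\<lambda>_. 1"])
    show "AE x in \<nu>. (\<lambda>k. damp k x) \<longlonglongrightarrow> 0"
      using lt
    proof eventually_elim
      fix x assume x: "x < b"
      then have "damp k x = exp (- (b - x)) ^ k" for k
        by (simp add: damp_def algebra_simps flip: exp_of_nat_mult)
      moreover have "(\<lambda>k. exp (- (b - x)) ^ k) \<longlonglongrightarrow> 0" using x by (intro LIMSEQ_realpow_zero) auto
      ultimately show "(\<lambda>k. damp k x) \<longlonglongrightarrow> 0" by simp
    qed
  qed (use m damp_bounds in auto)
  then show ?thesis by simp
qed

text \<open>If \<open>g\<close> is maximal in the direction of the \<open>i\<close>-th axis, then \<open>n ^ (d - 1)\<close> disjoint lattice
  lines of length \<open>n\<close> are almost entirely made of edges with weight almost \<open>b\<close>; this is estimated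
  by the exponential Markov inequality.\<close>

lemma P_LD_maximal_direction:
  assumes g: "g \<in> norms a b" and gi: "g (axis i 1) = b" and n: "0 < n"
  shows "P (LD_weights b n g \<epsilon>) \<le> (exp (real k * \<epsilon>) * (\<integral>x. damp k x \<partial>\<nu>)) ^ (n ^ CARD('n))"
proof -
  have ab': "0 \<le> a" "a \<le> b" using ab by auto
  \<comment> \<open>Starting points on one face of the cube. The n ^ (d - 1) lines through them
    carry n edges each, so the exponent reaches the full volume n ^ d.\<close>
  define V where "V = {v :: int ^ 'n. \<forall>j. v $ j \<in> (if j = i then {0} else {0..<int n})}"
  define I where "I = V \<times> {..<n}"
  define ed where "ed = (\<lambda>(v :: int ^ 'n, j). {v + axis i (int j), v + axis i (int j) + axis i 1})"
  define N where "N = n ^ CARD('n)"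
  have finV: "finite V" unfolding V_def by (rule finite_lattice_box) simp
  have "card V = (\<Prod>j\<in>UNIV. card (if j = i then {0} else {0..<int n}))" unfolding V_def by (rule card_lattice_box)
  also have "\<dots> = n ^ (CARD('n) - 1)" by (subst prod.remove[of _ i]) (auto simp: card_Diff_singleton)
  finally have cardV: "card V * n = N" using d2 by (cases "CARD('n)") (auto simp: N_def)
  have finI: "finite I" using finV by (simp add: I_def)
  have cardI: "card I = N" using cardV by (simp add: I_def card_cartesian_product)
  have Vj: "v $ j \<in> (if j = i then {0} else {0..<int n})" if "v \<in> V" for v j using that unfolding V_def by blast
  have vi: "v $ i = 0" if "v \<in> V" for v using Vj[OF that, of i] by simp
  have vr: "0 \<le> v $ j \<and> v $ j \<le> int n" if "v \<in> V" for v j using Vj[OF that, of j] by (cases "j = i") auto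
  have inj: "inj_on ed I"
  proof (rule inj_onI, clarify)
    fix v j w l assume I: "(v, j) \<in> I" "(w, l) \<in> I" and eq: "ed (v, j) = ed (w, l)"
    have V: "v $ i = 0" "w $ i = 0" using I vi by (auto simp: I_def)
    have c: "v + axis i (int j) = w + axis i (int l)"
    proof -
      consider "v + axis i (int j) = w + axis i (int l)"
        | "v + axis i (int j) = w + axis i (int l) + axis i 1" "v + axis i (int j) + axis i 1 = w + axis i (int l)"
        using eq unfolding ed_def prod.case doubleton_eq_iff by blast
      then show ?thesis
      proof cases
        case 2
        from arg_cong[OF 2(1), of "\<lambda>z. z $ i"] arg_cong[OF 2(2), of "\<lambda>z. z $ i"]
        have "(v + axis i (int j)) $ i = (w + axis i (int l)) $ i + 1"
          "(v + axis i (int j)) $ i + 1 = (w + axis i (int l)) $ i"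
          by (simp_all only: vector_add_component axis_nth)
        then show ?thesis by linarith
      qed
    qed
    have "(v + axis i (int j)) $ i = (w + axis i (int l)) $ i" using c by simp
    then have "j = l" using V by (simp add: axis_def)
    then show "v = w \<and> j = l" using c by simp
  qed
  define E where "E = ed ` I"
  have E: "finite E" "E \<subseteq> edges" "card E = N"
    using finI card_image[OF inj] cardI axis_edge_in_edges by (auto simp: E_def ed_def)
  \<comment> \<open>The ends of a line are at g-distance b n, so a passage time close to g leaves a
    deficit of at most \<epsilon> n on each line.\<close>
  have few: "(\<Sum>e\<in>E. b - t e) \<le> \<epsilon> * real N" if t: "t \<in> LD_weights b n g \<epsilon>" "cfg a b t" for t
  proof -
    have line: "(\<Sum>j<n. b - t (ed (v, j))) \<le> \<epsilon> * real n" if v: "v \<in> V" for v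
    proof -
      let ?w = "v + axis i (int n)"
      have c: "emb v \<in> cube n" "emb ?w \<in> cube n"
        using vr[OF v] vi[OF v] by (auto simp: cube_def axis_def) (metis of_int_0_le_iff of_int_le_iff of_int_of_nat_eq)+
      have "emb v - emb ?w = (- real n) *\<^sub>R axis i 1" by (simp add: emb_add_axis vec_eq_iff axis_def)
      then have "g (emb v - emb ?w) = real n * b" by (simp only: normsD(2)[OF g] gi) simp
      moreover have "\<bar>T_in t b (cube n) (emb v) (emb ?w) - g (emb v - emb ?w)\<bar> \<le> \<epsilon> * real n"
        using t(1) c by (simp add: LD_weights_def d_infty_le_iff[OF n g])
      moreover have "T_in t b (cube n) (emb v) (emb ?w) \<le> (\<Sum>j<n. t (ed (v, j)))"
        using T_in_lattice_line[OF ab' t(2) vr[OF v] vi[OF v] order_refl] by (simp add: ed_def)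
      ultimately show ?thesis by (simp add: sum_subtractf)
    qed
    have "(\<Sum>e\<in>E. b - t e) = (\<Sum>x\<in>I. b - t (ed x))" unfolding E_def by (subst sum.reindex[OF inj]) simp
    also have "\<dots> = (\<Sum>v\<in>V. \<Sum>j<n. b - t (ed (v, j)))" unfolding I_def by (simp add: sum.cartesian_product)
    also have "\<dots> \<le> (\<Sum>v\<in>V. \<epsilon> * real n)" by (intro sum_mono line)
    also have "\<dots> = \<epsilon> * real N" by (simp flip: cardV)
    finally show ?thesis .
  qed
  have iv: "indep_vars (\<lambda>_. borel) (\<lambda>e \<omega>. damp k (\<tau> e \<omega>)) E"
    by (rule indep_vars_compose2[OF indep_vars_subset[OF indep E(2)]]) simp
  have dm: "(\<lambda>\<omega>. damp k (\<tau> e \<omega>)) \<in> borel_measurable M" if "e \<in> E" for e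
    using tau_measurable[of e] that E(2) by (auto intro: measurable_compose[OF _ damp_measurable])
  have int: "integrable M (\<lambda>\<omega>. damp k (\<tau> e \<omega>))" if "e \<in> E" for e
    using dm[OF that] damp_bounds by (intro integrable_const_bound[where B = 1]) auto
  have each: "(\<integral>\<omega>. damp k (\<tau> e \<omega>) \<partial>M) = (\<integral>x. damp k x \<partial>\<nu>)" if "e \<in> E" for e
  proof -
    have e: "e \<in> edges" using that E(2) by blast
    have "(\<integral>x. damp k x \<partial>distr M borel (\<tau> e)) = (\<integral>\<omega>. damp k (\<tau> e \<omega>) \<partial>M)"
      by (rule integral_distr[OF tau_measurable[OF e] damp_measurable])
    then show ?thesis using law e by simp
  qed
  define Z where "Z \<omega> = (\<Prod>e\<in>E. damp k (\<tau> e \<omega>))" for \<omega>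
  have EZ: "(\<integral>\<omega>. Z \<omega> \<partial>M) = (\<integral>x. damp k x \<partial>\<nu>) ^ N"
    unfolding Z_def by (subst indep_vars_lebesgue_integral[OF E(1) iv int]) (simp_all add: each E(3))
  have iZ: "integrable M Z" unfolding Z_def by (rule indep_vars_integrable[OF E(1) iv int])
  let ?A = "W -` (LD_weights b n g \<epsilon> \<inter> admissible) \<inter> space M"
  have A: "?A \<in> events"
    by (rule measurable_sets[OF W_measurable sets.Int[OF LD_weights_sets[OF n b_nonneg g] admissible_sets]])
  let ?c = "exp (- (real k * \<epsilon>)) ^ N"
  \<comment> \<open>Markov inequality: on the event the total deficit is at most \<epsilon> N, hence
    Z is at least exp (- k \<epsilon>) ^ N.\<close>
  have "?c * P (LD_weights b n g \<epsilon>) = (\<integral>\<omega>. ?c * indicator ?A \<omega> \<partial>M)"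
    unfolding P_Int_admissible[OF LD_weights_sets[OF n b_nonneg g], symmetric]
    using A by (simp add: P_def)
  also have "\<dots> \<le> (\<integral>\<omega>. Z \<omega> \<partial>M)"
  proof (rule integral_mono[OF _ iZ])
    show "integrable M (\<lambda>\<omega>. ?c * indicator ?A \<omega>)" using A by (intro integrable_mult_right integrable_real_indicator) (auto simp: emeasure_eq_measure)
    fix \<omega>
    show "?c * indicator ?A \<omega> \<le> Z \<omega>"
    proof (cases "\<omega> \<in> ?A")
      case True
      then have t: "W \<omega> \<in> LD_weights b n g \<epsilon>" "cfg a b (W \<omega>)" by (auto simp: admissible_def)
      have We: "W \<omega> e = \<tau> e \<omega>" if "e \<in> E" for e using that E(2) by (auto simp: W_def)
      have "damp k (\<tau> e \<omega>) = exp (- (real k * (b - W \<omega> e)))" if "e \<in> E" for e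
      proof -
        have "e \<in> edges" using that E(2) by blast
        then have "W \<omega> e \<le> b" using t(2) by (simp add: cfg_def)
        then show ?thesis by (simp add: damp_def We[OF that, symmetric])
      qed
      then have "Z \<omega> = exp (\<Sum>e\<in>E. - (real k * (b - W \<omega> e)))"
        unfolding Z_def by (simp add: exp_sum[OF E(1)])
      also have "(\<Sum>e\<in>E. - (real k * (b - W \<omega> e))) = - (real k * (\<Sum>e\<in>E. b - W \<omega> e))"
        by (simp add: sum_negf sum_distrib_left)
      also have "exp \<dots> \<ge> exp (- (real k * (\<epsilon> * real N)))" using few[OF t] by (simp add: mult_left_mono)
      also have "exp (- (real k * (\<epsilon> * real N))) = ?c" by (simp add: mult_ac flip: exp_of_nat_mult)
      finally show ?thesis using True by simp
    next
      case False
      then show ?thesis using damp_bounds by (simp add: Z_def prod_nonneg)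
    qed
  qed
  finally have "?c * P (LD_weights b n g \<epsilon>) \<le> (\<integral>x. damp k x \<partial>\<nu>) ^ N" unfolding EZ .
  then have "exp (real k * \<epsilon>) ^ N * (?c * P (LD_weights b n g \<epsilon>)) \<le> exp (real k * \<epsilon>) ^ N * (\<integral>x. damp k x \<partial>\<nu>) ^ N"
    by (rule mult_left_mono) simp
  moreover have "exp (real k * \<epsilon>) ^ N * ?c = 1" by (simp add: exp_minus flip: power_mult_distrib)
  then have "exp (real k * \<epsilon>) ^ N * (?c * P (LD_weights b n g \<epsilon>)) = P (LD_weights b n g \<epsilon>)"
    by (simp only: mult.assoc[symmetric] mult_1_left)
  ultimately show ?thesis unfolding N_def power_mult_distrib by linarith
qed

lemma rate_infinite:
  assumes g: "g \<in> norms a b" and gi: "g (axis i 1) = b" and \<nu>b: "measure \<nu> {b} = 0"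
  shows "rate M \<tau> b g = \<infinity>"
proof (rule ereal_top)
  fix K
  have "\<forall>\<^sub>F k in sequentially. (\<integral>x. damp k x \<partial>\<nu>) < exp (- (K + 1))"
    by (rule order_tendstoD(2)[OF damp_integral_tendsto_0[OF \<nu>b]]) simp
  then have "\<forall>\<^sub>F k in sequentially. (\<integral>x. damp k x \<partial>\<nu>) < exp (- (K + 1)) \<and> 0 < k"
    by (rule eventually_conj[OF _ eventually_gt_at_top])
  then obtain k where k: "(\<integral>x. damp k x \<partial>\<nu>) < exp (- (K + 1))" "0 < k"
    using eventually_happens[of _ sequentially] by auto
  \<comment> \<open>With k \<epsilon> = 1 the Markov bound loses only a factor e per edge, which the
    extra 1 in K + 1 absorbs.\<close>
  define \<epsilon> where "\<epsilon> = 1 / real k"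
  have \<epsilon>: "0 < \<epsilon>" "real k * \<epsilon> = 1" using k by (auto simp: \<epsilon>_def)
  have d0: "0 \<le> (\<integral>x. damp k x \<partial>\<nu>)" using damp_bounds by (intro integral_nonneg_AE) auto
  have "ereal K \<le> neg_log (P (LD_weights b n g \<epsilon>)) / ereal (real n ^ CARD('n))" if n: "0 < n" for n
  proof -
    have "P (LD_weights b n g \<epsilon>) \<le> (exp (real k * \<epsilon>) * (\<integral>x. damp k x \<partial>\<nu>)) ^ (n ^ CARD('n))"
      by (rule P_LD_maximal_direction[OF g gi n])
    also have "\<dots> \<le> (exp 1 * exp (- (K + 1))) ^ (n ^ CARD('n))"
      unfolding \<epsilon> using k d0 by (intro power_mono mult_left_mono) auto
    also have "\<dots> = exp (- (K * real n ^ CARD('n)))"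
      by (simp add: mult.commute flip: exp_add exp_of_nat_mult)
    finally have "ereal (K * real n ^ CARD('n)) \<le> neg_log (P (LD_weights b n g \<epsilon>))"
      by (intro neg_log_ge P_nonneg)
    then have "ereal (K * real n ^ CARD('n)) / ereal (real n ^ CARD('n)) \<le> neg_log (P (LD_weights b n g \<epsilon>)) / ereal (real n ^ CARD('n))"
      using n by (intro ereal_divide_right_mono) auto
    then show ?thesis using n by simp
  qed
  then have "ereal K \<le> rate_at g \<epsilon>"
    unfolding rate_at_def by (intro Liminf_bounded eventually_mono[OF eventually_gt_at_top[of 0]])
  also have "\<dots> \<le> rate M \<tau> b g" unfolding rate_eq_SUP[OF g] using \<epsilon> by (intro SUP_upper) simp
  finally show "ereal K \<le> rate M \<tau> b g" .
qed

lemma rate_upper: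
  assumes g: "g \<in> norms_star a b" and y: "rate M \<tau> b g < y"
  shows "\<exists>\<zeta>>0. \<forall>h\<in>norms a b. norm_dist g h < \<zeta> \<longrightarrow> rate M \<tau> b h < y"
proof -
  obtain \<gamma> where \<gamma>: "0 < \<gamma>" "rate M \<tau> b g + ereal \<gamma> < y"
  proof (cases "rate M \<tau> b g")
    case (real r)
    obtain z where z: "ereal r < ereal z" "ereal z < y" using ereal_dense2[of "ereal r" y] y real by auto
    show ?thesis by (rule that[of "z - r"]) (use z real in auto)
  next
    case MInf
    then show ?thesis using y by (intro that[of 1]) auto
  qed (use y in simp)
  show ?thesis using rate_upper_semicontinuous[OF g \<gamma>(1)] \<gamma>(2) by (meson order_le_less_trans)
qed

end

section \<open>Semicontinuity from both sides gives continuity\<close>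

lemma continuous_map_norm_topology:
  fixes f :: "(real ^ 'n::finite \<Rightarrow> real) \<Rightarrow> ereal"
  assumes S: "Metric_space S norm_dist"
    and lower: "\<And>g y. g \<in> S \<Longrightarrow> y < f g \<Longrightarrow> \<exists>\<zeta>>0. \<forall>h\<in>S. norm_dist g h < \<zeta> \<longrightarrow> y < f h"
    and upper: "\<And>g y. g \<in> S \<Longrightarrow> f g < y \<Longrightarrow> \<exists>\<zeta>>0. \<forall>h\<in>S. norm_dist g h < \<zeta> \<longrightarrow> f h < y"
  shows "continuous_map (norm_topology S) euclidean f"
proof -
  interpret Metric_space S norm_dist by (rule S)
  have ev: "eventually Q (atin mtopology g)" if "\<exists>\<zeta>>0. \<forall>h\<in>S. norm_dist g h < \<zeta> \<longrightarrow> Q h" for Q g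
    using that unfolding eventually_atin_metric commute[of _ g] by blast
  show ?thesis
    unfolding norm_topology_def continuous_map_atin limitin_canonical_iff topspace_mtopology
  proof (intro ballI order_tendstoI)
    fix g y assume "g \<in> S" "y < f g"
    then show "eventually (\<lambda>h. y < f h) (atin mtopology g)" by (intro ev lower)
  next
    fix g y assume "g \<in> S" "f g < y"
    then show "eventually (\<lambda>h. f h < y) (atin mtopology g)" by (intro ev upper)
  qed
qed

theorem proposition1p11:
  fixes M :: "'w measure"
    and \<tau> :: "(int ^ 'n::finite) set \<Rightarrow> 'w \<Rightarrow> real"
    and \<nu> :: "real measure"
    and a b :: real
  assumes "CARD('n) \<ge> 2"
    and "prob_space \<nu>" and "sets \<nu> = sets borel" and "AE x in \<nu>. 0 \<le> x"
    and "ereal a = (INF x\<in>measure_support \<nu>. ereal x)"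
    and "ereal b = (SUP x\<in>measure_support \<nu>. ereal x)"
    and "prob_space M"
    and "prob_space.indep_vars M (\<lambda>_. borel) \<tau> edges"
    and "\<forall>e\<in>edges. distr M borel (\<tau> e) = \<nu>"
    and "0 < a" and "a < b"
  shows "continuous_map (norm_topology (norms_star a b)) euclidean (rate M \<tau> b) \<and>
    (measure \<nu> {b} = 0 \<longrightarrow>
      continuous_map (norm_topology (norms a b)) euclidean (rate M \<tau> b))"
proof -
  interpret fpp M \<tau> \<nu> a b
    by (intro fpp.intro fpp_axioms.intro assms)
  have sub: "norms_star a b \<subseteq> norms a b" by (auto simp: norms_star_def)
  show ?thesis
  proof (intro conjI impI)
    show "continuous_map (norm_topology (norms_star a b)) euclidean (rate M \<tau> b)"
    proof (rule continuous_map_norm_topology[OF Metric_space_norms_star])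
      fix g :: "real ^ 'n \<Rightarrow> real" and y assume g: "g \<in> norms_star a b"
      show "\<exists>\<zeta>>0. \<forall>h\<in>norms_star a b. norm_dist g h < \<zeta> \<longrightarrow> y < rate M \<tau> b h" if "y < rate M \<tau> b g"
        using rate_lower_semicontinuous[OF _ that] g sub by blast
      show "\<exists>\<zeta>>0. \<forall>h\<in>norms_star a b. norm_dist g h < \<zeta> \<longrightarrow> rate M \<tau> b h < y" if "rate M \<tau> b g < y"
        using rate_upper[OF g that] sub by blast
    qed
    assume \<nu>b: "measure \<nu> {b} = 0"
    show "continuous_map (norm_topology (norms a b)) euclidean (rate M \<tau> b)"
    proof (rule continuous_map_norm_topology[OF Metric_space_norms])
      fix g :: "real ^ 'n \<Rightarrow> real" and y assume g: "g \<in> norms a b"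
      show "\<exists>\<zeta>>0. \<forall>h\<in>norms a b. norm_dist g h < \<zeta> \<longrightarrow> y < rate M \<tau> b h" if "y < rate M \<tau> b g"
        by (rule rate_lower_semicontinuous[OF g that])
      show "\<exists>\<zeta>>0. \<forall>h\<in>norms a b. norm_dist g h < \<zeta> \<longrightarrow> rate M \<tau> b h < y" if y: "rate M \<tau> b g < y"
      proof (cases "g \<in> norms_star a b")
        case True
        then show ?thesis by (rule rate_upper[OF _ y])
      next
        case False
        \<comment> \<open>The rate at g is infinite here, so the assumption that it lies below y is
          contradictory.\<close>
        then obtain i where "\<not> g (axis i 1) < b" using norms_star_iff[OF g] by blast
        then have "g (axis i 1) = b" using normsD(6)[OF g, of "axis i 1"] by simp
        then show ?thesis using rate_infinite[OF g _ \<nu>b] y by simp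
      qed
    qed
  qed
qed

end
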